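(* Let $n\ge 1$, $\alpha\in(0,1]$, $\beta\in(0,n)\setminus\mathbb{N}$, $0<q<p=1$, and let $\mu$ be a nonnegative Radon measure on $\mathbb{R}^{1+n}_{+}$. For $v_0\in\dot W^{\beta,1}(\mathbb{R}^n)$ let $v(t,x)=S_\alpha(t)v_0(x)$. Then (a) $\Rightarrow$ (b) $\Rightarrow$ (c) $\Rightarrow$ (d), where: (a) $\|v(t^{2\alpha},x)\|_{L^{q}(\mathbb{R}^{1+n}_{+},\mu)}\lesssim\|v_0\|_{\dot W^{\beta,1}(\mathbb{R}^n)}$ for all $v_0\in\dot W^{\beta,1}(\mathbb{R}^n)$; (b) $\|v(t^{2\alpha},x)\|_{L^{q,\infty}(\mathbb{R}^{1+n}_{+},\mu)}\lesssim\|v_0\|_{\dot W^{\beta,1}(\mathbb{R}^n)}$ for all $v_0\in\dot W^{\beta,1}(\mathbb{R}^n)$; (c) $\displaystyle\sup\left\{\frac{(\mu(T(O)))^{1/q}}{\mathrm{cap}_{\dot W^{\beta,1}(\mathbb{R}^n)}(O)}:\ O\subseteq\mathbb{R}^n\text{ open}\right\}<\infty$; (d) $\|v(t^{2\alpha},x)\|_{L^{q,1}(\mathbb{R}^{1+n}_{+},\mu)}\lesssim\|v_0\|_{\dot W^{\beta,1}(\mathbb{R}^n)}$ for all $v_0\in\dot W^{\beta,1}(\mathbb{R}^n)$.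
   Context: $\mathbb{R}^{1+n}_{+}=(0,\infty)\times\mathbb{R}^n$. $U\lesssim V$ means $U\le\theta V$ for some constant $\theta>0$ independent of the functions or sets under consideration. $v(t,x)=S_\alpha(t)v_0(x):=(K^\alpha_t* v_0)(x)$ (convolution in the space variable), with $K^\alpha_t(x)=(2\pi)^{-n/2}\int_{\mathbb{R}^n}e^{ix\cdot\xi}e^{-t|\xi|^{2\alpha}}d\xi$; it solves $\partial_t v+(-\Delta)^\alpha v=0$ on $\mathbb{R}^{1+n}_{+}$, $v(0,\cdot)=v_0$. The function $v(t^{2\alpha},x)$ is regarded as a function of $(t,x)\in\mathbb{R}^{1+n}_{+}$. For $\beta\in(0,n)\setminus\mathbb{N}$, $\dot W^{\beta,1}(\mathbb{R}^n)$ is the completion of $C_0^\infty(\mathbb{R}^n)$ with respect to $\|f\|_{\dot W^{\beta,1}(\mathbb{R}^n)}=\int_{\mathbb{R}^n}\frac{\|\Delta_h^kf\|_{L^1}}{|h|^{n+\beta}}dh$, where $k=1+[\beta]$ ($[\beta]$ the integer part), $\Delta_h^1f(x)=f(x+h)-f(x)$, $\Delta_h^kf=\Delta_h^1\Delta_h^{k-1}f$ for $k>1$. For $S\subseteq\mathbb{R}^n$, $\mathrm{cap}_{\dot W^{\beta,1}(\mathbb{R}^n)}(S)=\inf\{\|f\|_{\dot W^{\beta,1}(\mathbb{R}^n)}: f\in\dot W^{\beta,1}(\mathbb{R}^n),\ f\ge0,\ S\subseteq\mathrm{Int}(\{f\ge1\})\}$. For open $O\subseteq\mathbb{R}^n$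 the tent is $T(O)=\{(r,x)\in\mathbb{R}^{1+n}_{+}:B(x,r)\subseteq O\}$, with $B(x,r)$ the open ball of center $x$ and radius $r$. $\|f\|_{L^{q,1}(X,\mu)}=\int_0^\infty(\mu(\{|f|>\lambda\}))^{1/q}\,d\lambda$; $\|f\|_{L^q(X,\mu)}=\left(\int_X|f|^q d\mu\right)^{1/q}$; $\|f\|_{L^{q,\infty}(X,\mu)}=\sup_{\lambda>0}\lambda(\mu(\{|f|>\lambda\}))^{1/q}$. *)

theory Defs
  imports "HOL-Analysis.Analysis"
begin

text \<open>Power with a positive real exponent on $[0,\infty]$; the value at infinity is infinity.
  It is only used with the exponent $1/q > 0$.\<close>

definition enn_powr :: "ennreal \<Rightarrow> real \<Rightarrow> ennreal" where
  "enn_powr x a = (if x = \<infinity> then \<infinity> else ennreal (enn2real x powr a))"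

definition distr_fn :: "'a measure \<Rightarrow> ('a \<Rightarrow> 'b::real_normed_vector) \<Rightarrow> real \<Rightarrow> ennreal" where
  "distr_fn M f l = emeasure M {z \<in> space M. norm (f z) > l}"

definition Lq_norm :: "real \<Rightarrow> 'a measure \<Rightarrow> ('a \<Rightarrow> 'b::real_normed_vector) \<Rightarrow> ennreal" where
  "Lq_norm q M f = enn_powr (\<integral>\<^sup>+ z. ennreal (norm (f z) powr q) \<partial>M) (1 / q)"

definition Lq1_norm :: "real \<Rightarrow> 'a measure \<Rightarrow> ('a \<Rightarrow> 'b::real_normed_vector) \<Rightarrow> ennreal" where
  "Lq1_norm q M f = (\<integral>\<^sup>+ l\<in>{0<..}. enn_powr (distr_fn M f l) (1 / q) \<partial>lborel)"

definition Lqinf_norm :: "real \<Rightarrow> 'a measure \<Rightarrow> ('a \<Rightarrow> 'b::real_normed_vector) \<Rightarrow> ennreal" where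
  "Lqinf_norm q M f = (SUP l\<in>{0<..}. ennreal l * enn_powr (distr_fn M f l) (1 / q))"

text \<open>$C^k$ regularity on the whole space: $f$ is $C^{k+1}$ iff it is (Frechet) differentiable
  everywhere and each of its directional derivatives is $C^k$.\<close>

primrec Ck :: "nat \<Rightarrow> ('a::euclidean_space \<Rightarrow> real) \<Rightarrow> bool" where
  "Ck 0 f \<longleftrightarrow> continuous_on UNIV f"
| "Ck (Suc k) f \<longleftrightarrow> (\<forall>x. f differentiable (at x)) \<and>
     (\<forall>v. Ck k (\<lambda>x. frechet_derivative f (at x) v))"

definition test_functions :: "('a::euclidean_space \<Rightarrow> real) set" where
  "test_functions = {f. (\<forall>k. Ck k f) \<and> compact (closure {x. f x \<noteq> 0})}"

definition fdiff :: "'a::euclidean_space \<Rightarrow> ('a \<Rightarrow> real) \<Rightarrow> 'a \<Rightarrow> real" where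
  "fdiff h f = (\<lambda>x. f (x + h) - f x)"

definition W_norm :: "real \<Rightarrow> ('a::euclidean_space \<Rightarrow> real) \<Rightarrow> ennreal" where
  "W_norm \<beta> f =
     (let k = 1 + nat \<lfloor>\<beta>\<rfloor> in
      \<integral>\<^sup>+ h. (\<integral>\<^sup>+ x. ennreal \<bar>(fdiff h ^^ k) f x\<bar> \<partial>lborel)
              / ennreal (norm h powr (real DIM('a) + \<beta>)) \<partial>lborel)"

text \<open>The completion of the test functions with respect to \<open>W_norm \<beta>\<close>, for $0 < \beta < n$,
  realized as a space of functions: an element is the local $L^1$ limit of a Cauchy sequence
  of test functions.  By the Sobolev inequality
  $\|\varphi\|_{L^{n/(n-\beta)}} \lesssim \|\varphi\|_{\dot W^{\beta,1}}$ every Cauchy sequence has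
  such a limit, unique almost everywhere and determining the class of the sequence.  (The
  convergence of the functions must be required separately, since \<open>W_norm\<close> vanishes on constants.)
  By Fatou's lemma the norm of the completion is given by \<open>W_norm\<close> of the limit function.
  All Borel representatives of a class are included.\<close>

definition W_space :: "real \<Rightarrow> ('a::euclidean_space \<Rightarrow> real) set" where
  "W_space \<beta> = {f. f \<in> borel_measurable borel \<and>
     (\<exists>\<phi> :: nat \<Rightarrow> 'a \<Rightarrow> real.
        (\<forall>j. \<phi> j \<in> test_functions) \<and>
        (\<forall>e>0. \<exists>N. \<forall>i\<ge>N. \<forall>j\<ge>N. W_norm \<beta> (\<lambda>x. \<phi> i x - \<phi> j x) < ennreal e) \<and>
        (\<forall>K. compact K \<longrightarrow>
           (\<lambda>j. \<integral>\<^sup>+ x\<in>K. ennreal \<bar>\<phi> j x - f x\<bar> \<partial>lborel) \<longlonglongrightarrow> 0))}"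

text \<open>The capacity is infinity if there is no admissible function; quotients by such a capacity
  are 0 in \<open>ennreal\<close>, and so is the quotient 0/0, which arises only for the empty set.\<close>

definition W_cap :: "real \<Rightarrow> 'a::euclidean_space set \<Rightarrow> ennreal" where
  "W_cap \<beta> S = Inf {W_norm \<beta> f | f.
     f \<in> W_space \<beta> \<and> (\<forall>x. f x \<ge> 0) \<and> S \<subseteq> interior {x. f x \<ge> 1}}"

definition heat_kernel :: "real \<Rightarrow> real \<Rightarrow> 'a::euclidean_space \<Rightarrow> complex" where
  "heat_kernel \<alpha> t x = complex_of_real ((2 * pi) powr (- real DIM('a) / 2)) *
     (LINT \<xi>|lborel. exp (\<i> * complex_of_real (x \<bullet> \<xi>)) *
        complex_of_real (exp (- t * norm \<xi> powr (2 * \<alpha>))))"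

definition heat_semigroup :: "real \<Rightarrow> real \<Rightarrow> ('a::euclidean_space \<Rightarrow> real) \<Rightarrow> 'a \<Rightarrow> complex" where
  "heat_semigroup \<alpha> t v0 x =
     (LINT y|lborel. heat_kernel \<alpha> t (x - y) * complex_of_real (v0 y))"

text \<open>The function $v(t^{2\alpha}, x)$ on the upper half-space, where $v(t,x) = S_\alpha(t)v_0(x)$.\<close>

definition caloric_ext ::
    "real \<Rightarrow> ('a::euclidean_space \<Rightarrow> real) \<Rightarrow> real \<times> 'a \<Rightarrow> complex" where
  "caloric_ext \<alpha> v0 = (\<lambda>(t, x). heat_semigroup \<alpha> (t powr (2 * \<alpha>)) v0 x)"

definition half_space :: "(real \<times> 'a::euclidean_space) set" where
  "half_space = {0<..} \<times> UNIV"

definition tent :: "'a::euclidean_space set \<Rightarrow> (real \<times> 'a) set" where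
  "tent U = {(r, x) \<in> half_space. ball x r \<subseteq> U}"

definition radon_half_space :: "(real \<times> 'a::euclidean_space) measure \<Rightarrow> bool" where
  "radon_half_space \<mu> \<longleftrightarrow>
     sets \<mu> = sets (restrict_space borel half_space) \<and>
     (\<forall>K. compact K \<and> K \<subseteq> half_space \<longrightarrow> emeasure \<mu> K < \<infinity>) \<and>
     (\<forall>A\<in>sets \<mu>. emeasure \<mu> A = (SUP K\<in>{K. compact K \<and> K \<subseteq> A}. emeasure \<mu> K))"

end

theory Submission
  imports Defs "HOL-Probability.Characteristic_Functions"
begin

text \<open>The heart of the matter is the implication from (c) to (d), a strong type capacitary inequality.
  With $n$ the dimension, $k = 1 + \lfloor\beta\rfloor$ and $d = n - \beta$, a telescoping sum of
  doubly averaged approximate identities, whose errors are averages of $k$-th differences, bounds the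
  caloric extension at $(t, x)$ pointwise by a sum $\sum c_Q$ over the dyadic cubes $Q \ni x$ of side
  $\ell(Q) \ge t$, where $\sum_Q c_Q \ell(Q)^d \lesssim \|v_0\|_{\dot W^{\beta,1}}$.  This only uses
  that the heat kernel is nonnegative, integrable and $O(\min(1, |x|^{-n}))$, which holds since
  $e^{-|\xi|^{2\alpha}}$ is a limit of convex combinations of Gaussians.  The level set at height
  $\theta$ is then covered by the boxes over those cubes at which the partial sums of the $c_Q$, taken
  from large cubes to small ones, first exceed $\theta$; integrating in $\theta$ charges each cube exactly
  $c_Q$, and the capacity of a union of cubes is at most a multiple of $\sum \ell(Q)^d$.  For the step
  from (b) to (c), the caloric extension of an admissible function is bounded below on the
  tent, as the kernel has positive mass in a ball.\<close>

section \<open>Preliminaries on Lebesgue integrals\<close>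


text \<open>\<open>W_norm\<close> controls k-th differences only in the mean, over the step and over
  the position. Comparing one average of f at two scales leaves the position fixed, which
  \<open>W_norm\<close> cannot bound. For commuting averages A and B, A^2 - B^2 = (A + B)(A - B):
  the inner factor yields k-th differences, the outer one averages their position. At scale s this
  costs a multiple of s^(\<beta> - n) times the seminorm, which is summable over large dyadic scales
  because \<beta> < n. The bound |x|^(-n) on the kernel holds for Gaussians of every width with one
  constant; hence it passes to limits of their convex combinations. It is not integrable at
  infinity, so all dyadic shells around x count with equal weight. Scaling rescues the sum over
  shells: a mean at scale 2^l of differences at scale 2^(l - i) carries the factor 2^(-i \<beta>),
  and \<beta> > 0. The exponent 1/q enters the last step only through one inequality: \<mu>(union of
  boxes)^(1/q) is at most a multiple of the sum of (side)^d. Its right side is additive over cubes,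
  and integrating its left side over the heights is exactly the L^(q,1) norm.\<close>

lemma nn_integral_lborel_affine:
  fixes f :: "'a::euclidean_space \<Rightarrow> ennreal" and c :: real
  assumes [measurable]: "f \<in> borel_measurable borel" and c: "c \<noteq> 0"
  shows "(\<integral>\<^sup>+x. f x \<partial>lborel) = ennreal (\<bar>c\<bar> ^ DIM('a)) * (\<integral>\<^sup>+x. f (t + c *\<^sub>R x) \<partial>lborel)"
  by (subst lborel_affine[OF c, of t])
    (simp add: nn_integral_density nn_integral_distr nn_integral_cmult)

lemma nn_integral_lborel_translate:
  fixes f :: "'a::euclidean_space \<Rightarrow> ennreal"
  assumes "f \<in> borel_measurable borel"
  shows "(\<integral>\<^sup>+x. f (t + x) \<partial>lborel) = (\<integral>\<^sup>+x. f x \<partial>lborel)"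
  using nn_integral_lborel_affine[OF assms, of 1 t] by simp

lemma nn_integral_lborel_reflect:
  fixes f :: "'a::euclidean_space \<Rightarrow> ennreal"
  assumes "f \<in> borel_measurable borel"
  shows "(\<integral>\<^sup>+x. f (t - x) \<partial>lborel) = (\<integral>\<^sup>+x. f x \<partial>lborel)"
  using nn_integral_lborel_affine[OF assms, of "-1" t] by simp

lemma integral_lborel_scale:
  fixes f :: "'a::euclidean_space \<Rightarrow> 'b::{banach, second_countable_topology}" and c :: real
  assumes [measurable]: "f \<in> borel_measurable borel" and c: "c \<noteq> 0"
  shows "(LINT x|lborel. f x) = (\<bar>c\<bar> ^ DIM('a)) *\<^sub>R (LINT x|lborel. f (c *\<^sub>R x))"
  by (subst lborel_affine[OF c, of 0]) (simp add: integral_density integral_distr)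

lemma sets_borel_ball[measurable]: "ball (c::'a::euclidean_space) r \<in> sets borel"
  by simp

lemma emeasure_lborel_ball:
  fixes z :: "'a::euclidean_space"
  assumes "r \<ge> 0"
  shows "emeasure lborel (ball z r) = ennreal (unit_ball_vol DIM('a) * r ^ DIM('a))"
  using assms by (rule emeasure_ball)

lemma suminf_ennreal_geometric_lt_top:
  fixes x :: real assumes "0 \<le> x" "x < 1"
  shows "(\<Sum>j::nat. ennreal (x ^ j)) < \<infinity>"
  using assms by (subst suminf_ennreal2) (auto intro!: summable_geometric)

lemma suminf_ge_term_ennreal:
  fixes f :: "nat \<Rightarrow> ennreal" shows "f i \<le> (\<Sum>j. f j)"
  using sum_le_suminf[of f "{i}"] by (simp add: summableI)

lemma nn_integral_suminf_indicator:
  fixes c :: "nat \<Rightarrow> ennreal"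
  assumes "\<And>j. A j \<in> sets M"
  shows "(\<integral>\<^sup>+x. (\<Sum>j. c j * indicator (A j) x) \<partial>M) = (\<Sum>j. c j * emeasure M (A j))"
  using assms by (subst nn_integral_suminf) (simp_all add: nn_integral_cmult_indicator)

lemma dyadic_bracket:
  fixes r :: real assumes "r \<ge> 1"
  obtains j :: nat where "2 ^ j \<le> r" "r < 2 ^ Suc j"
proof -
  define j where "j = (LEAST j. r < 2 ^ Suc j)"
  have ex: "\<exists>j. r < 2 ^ Suc j"
    using real_arch_pow[of 2 r] by (metis one_less_numeral_iff semiring_norm(76) order_less_trans power_strict_increasing lessI)
  have 1: "r < 2 ^ Suc j" unfolding j_def by (rule LeastI_ex[OF ex])
  have 2: "2 ^ j \<le> r"
  proof (cases j)
    case 0 then show ?thesis using assms by simp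
  next
    case (Suc i)
    then have "\<not> r < 2 ^ Suc i" using not_less_Least[of i "\<lambda>j. r < 2 ^ Suc j"] j_def by auto
    then show ?thesis using Suc by simp
  qed
  show ?thesis using that 1 2 by blast
qed

lemma powr_power_two:
  fixes a :: real shows "(2 powr a) ^ j = (2 ^ j) powr a"
  by (induction j) (simp_all add: powr_mult)

lemma ennreal_mult_less_top_lt:
  fixes a b :: ennreal shows "a < \<infinity> \<Longrightarrow> b < \<infinity> \<Longrightarrow> a * b < \<infinity>"
  by (simp add: ennreal_mult_less_top)

lemma suminf_powr_lt_top:
  fixes \<gamma> :: real assumes "\<gamma> > 0"
  shows "(\<Sum>j::nat. ennreal ((2 powr (-\<gamma>)) ^ j)) < \<infinity>"
proof (rule suminf_ennreal_geometric_lt_top)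
  have "2 powr (-\<gamma>) < 2 powr (0::real)" using assms by (intro powr_less_mono) auto
  then show "2 powr (-\<gamma>) < 1" by simp
qed simp

text \<open>On the shell between radii 2^j and 2^(j+1) the integrand is at most 2^(-j(n+\<gamma>)),
  and the enclosing ball has volume O(2^(jn)). What remains is a geometric series of ratio
  2^(-\<gamma>).\<close>

lemma nn_integral_outside_unit_ball_lt_top:
  fixes \<gamma> :: real assumes "\<gamma> > 0"
  shows "(\<integral>\<^sup>+(x::'a::euclidean_space). indicator {x. 1 \<le> norm x} x * ennreal (norm x powr (-(DIM('a) + \<gamma>))) \<partial>lborel) < \<infinity>"
proof -
  let ?n = "real DIM('a)" and ?v = "unit_ball_vol DIM('a)"
  have "(\<integral>\<^sup>+(x::'a). indicator {x. 1 \<le> norm x} x * ennreal (norm x powr (-(?n + \<gamma>))) \<partial>lborel)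
     \<le> (\<integral>\<^sup>+(x::'a). (\<Sum>j. ennreal ((2 ^ j) powr (-(?n + \<gamma>))) * indicator (ball 0 (2 ^ Suc j)) x) \<partial>lborel)"
  proof (rule nn_integral_mono)
    fix x :: 'a
    show "indicator {x. 1 \<le> norm x} x * ennreal (norm x powr (-(?n + \<gamma>)))
      \<le> (\<Sum>j. ennreal ((2 ^ j) powr (-(?n + \<gamma>))) * indicator (ball 0 (2 ^ Suc j)) x)"
    proof (cases "1 \<le> norm x")
      case True
      then obtain j where j: "2 ^ j \<le> norm x" "norm x < 2 ^ Suc j" using dyadic_bracket by blast
      have "norm x powr (-(?n + \<gamma>)) \<le> (2 ^ j) powr (-(?n + \<gamma>))"
        using j True assms by (intro powr_mono2') auto
      then have "indicator {x. 1 \<le> norm x} x * ennreal (norm x powr (-(?n + \<gamma>)))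
         \<le> ennreal ((2 ^ j) powr (-(?n + \<gamma>))) * indicator (ball 0 (2 ^ Suc j)) x"
        using True j by (simp add: ennreal_leI)
      also have "\<dots> \<le> (\<Sum>j. ennreal ((2 ^ j) powr (-(?n + \<gamma>))) * indicator (ball 0 (2 ^ Suc j)) x)"
        by (rule suminf_ge_term_ennreal)
      finally show ?thesis .
    qed simp
  qed
  also have "\<dots> = (\<Sum>j. ennreal ((2 ^ j) powr (-(?n + \<gamma>))) * emeasure lborel (ball (0::'a) (2 ^ Suc j)))"
    by (rule nn_integral_suminf_indicator) simp
  also have "\<dots> = (\<Sum>j. ennreal (2 ^ DIM('a) * ?v) * ennreal ((2 powr (-\<gamma>)) ^ j))"
  proof (rule suminf_cong)
    fix j :: nat
    have "x powr (-(?n + \<gamma>)) * x ^ DIM('a) = x powr (-\<gamma>)" if "x > 0" for x :: real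
      proof -
      have "x powr (-(?n + \<gamma>)) * x powr ?n = x powr (-\<gamma>)" by (simp add: powr_add[symmetric])
      then show ?thesis using that by (simp add: powr_realpow)
    qed
    from this[of "2 ^ j"]
    have "(2 ^ j) powr (-(?n + \<gamma>)) * (2 ^ j) ^ DIM('a) = ((2 powr (-\<gamma>)) ^ j :: real)"
      by (simp only: powr_power_two) simp
    then show "ennreal ((2 ^ j) powr (-(?n + \<gamma>))) * emeasure lborel (ball (0::'a) (2 ^ Suc j))
       = ennreal (2 ^ DIM('a) * ?v) * ennreal ((2 powr (-\<gamma>)) ^ j)"
      by (simp add: emeasure_lborel_ball ennreal_mult[symmetric] power_mult_distrib mult_ac flip: ennreal_mult)
  qed
  also have "\<dots> = ennreal (2 ^ DIM('a) * ?v) * (\<Sum>j. ennreal ((2 powr (-\<gamma>)) ^ j))"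
    by (rule ennreal_suminf_cmult)
  also have "\<dots> < \<infinity>"
    by (rule ennreal_mult_less_top_lt[OF _ suminf_powr_lt_top[OF assms]]) simp
  finally show ?thesis .
qed

lemma nn_integral_unit_ball_lt_top:
  fixes \<gamma> :: real assumes "\<gamma> > 0"
  shows "(\<integral>\<^sup>+(x::'a::euclidean_space). indicator (ball 0 1) x * ennreal (norm x powr (\<gamma> - DIM('a))) \<partial>lborel) < \<infinity>"
proof -
  let ?n = "real DIM('a)" and ?v = "unit_ball_vol DIM('a)"
  \<comment> \<open>A bound for the integrand where |x| lies between 2^(-j-1) and 2^(-j). Since
    \<gamma> - n may have either sign, |x|^\<gamma> is taken at the outer radius and |x|^(-n) at the
    inner one. The ball of radius 2 / 2^j contains this shell.\<close>
  define b where "b j = (2 powr (-\<gamma>)) ^ j * (2 * 2 ^ j) ^ DIM('a)" for j :: nat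
  have "(\<integral>\<^sup>+(x::'a). indicator (ball 0 1) x * ennreal (norm x powr (\<gamma> - ?n)) \<partial>lborel)
     \<le> (\<integral>\<^sup>+(x::'a). (\<Sum>j. ennreal (b j) * indicator (ball 0 (2 / 2 ^ j)) x) \<partial>lborel)"
  proof (rule nn_integral_mono)
    fix x :: 'a
    show "indicator (ball 0 1) x * ennreal (norm x powr (\<gamma> - ?n))
      \<le> (\<Sum>j. ennreal (b j) * indicator (ball 0 (2 / 2 ^ j)) x)"
    proof (cases "norm x < 1 \<and> x \<noteq> 0")
      case True
      then have "1 \<le> 1 / norm x" by (simp add: field_simps)
      then obtain j where j: "2 ^ j \<le> 1 / norm x" "1 / norm x < 2 ^ Suc j" using dyadic_bracket by blast
      have j': "norm x \<le> 1 / 2 ^ j" "1 / 2 ^ Suc j \<le> norm x" using True j by (simp_all add: field_simps)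
      have "norm x powr (\<gamma> - ?n) = norm x powr \<gamma> * norm x powr (- ?n)"
        using powr_add[of "norm x" \<gamma> "- ?n"] by simp
      also have "\<dots> \<le> (1 / 2 ^ j) powr \<gamma> * (1 / 2 ^ Suc j) powr (- ?n)"
        using j' True assms by (intro mult_mono powr_mono2 powr_mono2') auto
      also have "(1 / 2 ^ j) powr \<gamma> = (2 powr (-\<gamma>)) ^ j"
        unfolding powr_power_two by (simp add: powr_divide powr_minus_divide)
      also have "(1 / 2 ^ Suc j) powr (- ?n) = (2 * 2 ^ j) ^ DIM('a)"
        by (simp add: powr_divide powr_minus_divide powr_realpow)
      also note b_def[symmetric]
      finally have "indicator (ball 0 1) x * ennreal (norm x powr (\<gamma> - ?n))
         \<le> ennreal (b j) * indicator (ball 0 (2 / 2 ^ j)) x"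
        using True j' by (auto simp: ennreal_leI indicator_def field_simps)
      also have "\<dots> \<le> (\<Sum>j. ennreal (b j) * indicator (ball 0 (2 / 2 ^ j)) x)"
        by (rule suminf_ge_term_ennreal)
      finally show ?thesis .
    qed (auto simp: indicator_def)
  qed
  also have "\<dots> = (\<Sum>j. ennreal (b j) * emeasure lborel (ball (0::'a) (2 / 2 ^ j)))"
    by (rule nn_integral_suminf_indicator) simp
  also have "\<dots> = (\<Sum>j. ennreal (4 ^ DIM('a) * ?v) * ennreal ((2 powr (-\<gamma>)) ^ j))"
  proof (rule suminf_cong)
    fix j :: nat
    have "(2 * 2 ^ j) ^ DIM('a) * (2 / 2 ^ j) ^ DIM('a) = (4 ^ DIM('a) :: real)"
      by (simp only: power_mult_distrib[symmetric]) simp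
    moreover have "b j * (?v * (2 / 2 ^ j) ^ DIM('a)) = ((2 * 2 ^ j) ^ DIM('a) * (2 / 2 ^ j) ^ DIM('a)) * ?v * (2 powr (-\<gamma>)) ^ j"
      unfolding b_def by (simp only: mult_ac)
    ultimately have eq: "b j * (?v * (2 / 2 ^ j) ^ DIM('a)) = (4 ^ DIM('a) * ?v) * (2 powr (-\<gamma>)) ^ j"
      by (simp only: mult_ac)
    have "b j \<ge> 0" unfolding b_def by simp
    then have "ennreal (b j) * emeasure lborel (ball (0::'a) (2 / 2 ^ j)) = ennreal (b j * (?v * (2 / 2 ^ j) ^ DIM('a)))"
      by (simp only: emeasure_lborel_ball ennreal_mult' zero_le_divide_iff zero_le_power zero_le_numeral simp_thms)
    also have "\<dots> = ennreal (4 ^ DIM('a) * ?v) * ennreal ((2 powr (-\<gamma>)) ^ j)"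
      unfolding eq by (rule ennreal_mult') simp
    finally show "ennreal (b j) * emeasure lborel (ball (0::'a) (2 / 2 ^ j))
       = ennreal (4 ^ DIM('a) * ?v) * ennreal ((2 powr (-\<gamma>)) ^ j)" .
  qed
  also have "\<dots> = ennreal (4 ^ DIM('a) * ?v) * (\<Sum>j. ennreal ((2 powr (-\<gamma>)) ^ j))"
    by (rule ennreal_suminf_cmult)
  also have "\<dots> < \<infinity>"
    by (rule ennreal_mult_less_top_lt[OF _ suminf_powr_lt_top[OF assms]]) simp
  finally show ?thesis .
qed

lemma power_le_fact_exp:
  fixes x :: real assumes "x \<ge> 0" shows "x ^ n \<le> fact n * exp x"
proof -
  have "x ^ n / fact n \<le> (\<Sum>j. x ^ j / fact j)"
    using sum_le_suminf[OF summable_exp_generic[of x], of "{n}"] assms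
    by (simp add: divide_inverse scaleR_conv_of_real mult_ac)
  also have "\<dots> = exp x" by (simp add: exp_def divide_inverse scaleR_conv_of_real mult_ac)
  finally show ?thesis by (simp add: field_simps)
qed

lemma exp_neg_powr_le:
  fixes r a b :: real assumes "r \<ge> 1" "a > 0" "b > 0"
  obtains C where "C > 0" "\<And>r. r \<ge> 1 \<Longrightarrow> exp (- (r powr a)) \<le> C * r powr (- b)"
proof -
  obtain N :: nat where N: "b / a \<le> real N" using real_arch_simple by blast
  have "exp (- (r powr a)) \<le> fact N * r powr (- b)" if r: "r \<ge> 1" for r
  proof -
    have "r powr b = (r powr a) powr (b / a)" using assms by (simp add: powr_powr)
    also have "\<dots> \<le> (r powr a) powr N" using N r assms by (intro powr_mono) (auto simp: ge_one_powr_ge_zero)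
    also have "\<dots> = (r powr a) ^ N" using r by (simp add: powr_realpow)
    also have "\<dots> \<le> fact N * exp (r powr a)" by (rule power_le_fact_exp) simp
    finally show ?thesis using r by (simp add: exp_minus powr_minus field_simps)
  qed
  then show ?thesis using that[of "fact N"] by simp
qed

lemma integrable_exp_neg_norm_powr:
  fixes a :: real assumes "a > 0"
  shows "integrable lborel (\<lambda>x::'a::euclidean_space. exp (- (norm x powr a)))"
proof (rule integrableI_bounded)
  let ?n = "real DIM('a)"
  obtain C where C: "C > 0" "\<And>r. r \<ge> 1 \<Longrightarrow> exp (- (r powr a)) \<le> C * r powr (- (?n + 1))"
    using exp_neg_powr_le[of 1 a "?n + 1"] assms by auto
  have "(\<integral>\<^sup>+(x::'a). ennreal (norm (exp (- (norm x powr a)))) \<partial>lborel)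
     \<le> (\<integral>\<^sup>+(x::'a). indicator (ball 0 1) x + ennreal C * (indicator {x. 1 \<le> norm x} x * ennreal (norm x powr (-(?n + 1)))) \<partial>lborel)"
  proof (rule nn_integral_mono)
    fix x :: 'a
    show "ennreal (norm (exp (- (norm x powr a)))) \<le> indicator (ball 0 1) x + ennreal C * (indicator {x. 1 \<le> norm x} x * ennreal (norm x powr (-(?n + 1))))"
      using C(2)[of "norm x"] C(1) by (cases "norm x < 1") (auto simp: ennreal_mult[symmetric] ennreal_leI)
  qed
  also have "\<dots> = emeasure lborel (ball (0::'a) 1) + ennreal C * (\<integral>\<^sup>+(x::'a). indicator {x. 1 \<le> norm x} x * ennreal (norm x powr (-(?n + 1))) \<partial>lborel)"
    by (subst nn_integral_add) (auto simp: nn_integral_cmult intro!: borel_measurable_indicator)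
  also have "\<dots> < \<infinity>"
    using nn_integral_outside_unit_ball_lt_top[of 1, where 'a='a]
    by (auto simp: emeasure_lborel_ball ennreal_mult_less_top)
  finally show "(\<integral>\<^sup>+(x::'a). ennreal (norm (exp (- (norm x powr a)))) \<partial>lborel) < \<infinity>" .
qed simp

section \<open>Positivity and decay of the fractional heat kernel\<close>


lemma integral_lborel_prod_Basis:
  fixes f :: "'a::euclidean_space \<Rightarrow> real \<Rightarrow> complex"
  assumes int: "\<And>b. b \<in> Basis \<Longrightarrow> integrable lborel (f b)"
  shows "(LINT x|lborel. (\<Prod>b\<in>Basis. f b (x \<bullet> b))) = (\<Prod>b\<in>Basis. LINT t|lborel. f b t)"
proof -
  interpret product_sigma_finite "\<lambda>_::'a. lborel :: real measure"
    by (simp add: product_sigma_finite_def lborel.sigma_finite_measure_axioms)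
  have [measurable]: "b \<in> Basis \<Longrightarrow> f b \<in> borel_measurable borel" for b
    using borel_measurable_integrable[OF int] by simp
  have "(LINT x|lborel. (\<Prod>b\<in>Basis. f b (x \<bullet> b)))
      = (LINT x|(\<Pi>\<^sub>M b\<in>(Basis::'a set). lborel). (\<Prod>b\<in>Basis. f b ((\<Sum>b\<in>Basis. x b *\<^sub>R b) \<bullet> b)))"
    by (subst lborel_eq) (rule integral_distr, auto intro!: borel_measurable_prod measurable_compose[OF borel_measurable_inner])
  also have "\<dots> = (LINT x|(\<Pi>\<^sub>M b\<in>(Basis::'a set). lborel). (\<Prod>b\<in>Basis. f b (x b)))"
    by (intro Bochner_Integration.integral_cong refl prod.cong) (simp add: inner_sum_left inner_Basis if_distrib sum.delta cong: if_cong)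
  also have "\<dots> = (\<Prod>b\<in>Basis. LINT t|lborel. f b t)"
    by (rule product_integral_prod) (auto intro: int)
  finally show ?thesis .
qed

text \<open>Read off from the characteristic function of the standard normal distribution: the
  substitution t = c x with c = 1 / sqrt (2 s) turns s t^2 into x^2 / 2.\<close>

lemma gaussian_fourier_real:
  fixes y s :: real assumes s: "s > 0"
  shows "(LINT t|lborel. exp (\<i> * of_real (y * t)) * of_real (exp (- s * t\<^sup>2)))
       = complex_of_real (sqrt (pi / s) * exp (- y\<^sup>2 / (4 * s)))" (is "?L = ?R")
    and "integrable lborel (\<lambda>t. exp (\<i> * of_real (y * t)) * complex_of_real (exp (- s * t\<^sup>2)))"
proof -
  define c where "c = 1 / sqrt (2 * s)"
  have c: "c > 0" "s * c\<^sup>2 = 1 / 2" using s by (simp_all add: c_def power_divide)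
  have "integrable std_normal_distribution (\<lambda>x. exp (\<i> * of_real (y * c * x)))"
    by (rule prob_space.integrable_iexp[OF prob_space_normal_density]) auto
  then have int: "integrable lborel (\<lambda>x. complex_of_real (std_normal_density x) * exp (\<i> * of_real (y * c * x)))"
    by (subst (asm) integrable_density) (auto simp: scaleR_conv_of_real)
  have eq: "complex_of_real (std_normal_density x) * exp (\<i> * of_real (y * c * x)) =
     of_real (1 / sqrt (2 * pi)) * (exp (\<i> * of_real (y * (0 + c * x))) * of_real (exp (- s * (0 + c * x)\<^sup>2)))" for x
  proof -
    have "s * (c * x)\<^sup>2 = (s * c\<^sup>2) * x\<^sup>2" by (simp add: power_mult_distrib)
    then have "s * (c * x)\<^sup>2 = x\<^sup>2 / 2" using c by simp
    then show ?thesis by (simp add: std_normal_density_def mult_ac)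
  qed
  have eq2: "of_real (sqrt (2 * pi)) * (complex_of_real (std_normal_density x) * exp (\<i> * of_real (y * c * x))) =
     exp (\<i> * of_real (y * (0 + c * x))) * of_real (exp (- s * (0 + c * x)\<^sup>2))" for x
  proof -
    have "of_real (sqrt (2 * pi)) * complex_of_real (1 / sqrt (2 * pi)) = 1"
      by (simp only: of_real_mult[symmetric]) simp
    then show ?thesis unfolding eq by (simp only: mult.assoc[symmetric] mult_1_left)
  qed
  have int2: "integrable lborel (\<lambda>x. exp (\<i> * of_real (y * (0 + c * x))) * complex_of_real (exp (- s * (0 + c * x)\<^sup>2)))"
    unfolding eq2[symmetric] using int by simp
  then show "integrable lborel (\<lambda>t. exp (\<i> * of_real (y * t)) * complex_of_real (exp (- s * t\<^sup>2)))"
    using lborel_integrable_real_affine_iff[of c "\<lambda>t. exp (\<i> * of_real (y * t)) * complex_of_real (exp (- s * t\<^sup>2))" 0] c by simp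
  have "?L = \<bar>c\<bar> *\<^sub>R (LINT x|lborel. exp (\<i> * of_real (y * (0 + c * x))) * complex_of_real (exp (- s * (0 + c * x)\<^sup>2)))"
    by (rule lborel_integral_real_affine) (use c in simp)
  also have "(LINT x|lborel. exp (\<i> * of_real (y * (0 + c * x))) * complex_of_real (exp (- s * (0 + c * x)\<^sup>2)))
     = of_real (sqrt (2 * pi)) * (LINT x|lborel. complex_of_real (std_normal_density x) * exp (\<i> * of_real (y * c * x)))"
    unfolding eq2[symmetric] by simp
  also have "(LINT x|lborel. complex_of_real (std_normal_density x) * exp (\<i> * of_real (y * c * x)))
     = char std_normal_distribution (y * c)"
    unfolding char_def by (subst integral_density) (auto simp: scaleR_conv_of_real)
  also have "\<dots> = of_real (exp (- (y * c)\<^sup>2 / 2))" by (simp add: char_std_normal_distribution)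
  also have "- (y * c)\<^sup>2 / 2 = - y\<^sup>2 / (4 * s)"
    using s by (simp add: c_def power_mult_distrib power_divide)
  finally have "?L = of_real (\<bar>c\<bar> * sqrt (2 * pi) * exp (- y\<^sup>2 / (4 * s)))" by (simp add: scaleR_conv_of_real)
  also have "\<bar>c\<bar> * sqrt (2 * pi) = sqrt (pi / s)"
    using s by (simp add: c_def real_sqrt_divide real_sqrt_mult)
  finally show "?L = ?R" .
qed

lemma norm_sq_Basis:
  fixes x :: "'a::euclidean_space" shows "(norm x)\<^sup>2 = (\<Sum>b\<in>Basis. (x \<bullet> b)\<^sup>2)"
  by (subst power2_norm_eq_inner, subst euclidean_inner) (simp add: power2_eq_square)

lemma exp_prod_Basis:
  fixes x :: "'a::euclidean_space"
  shows "exp (\<i> * of_real (x \<bullet> \<xi>)) * complex_of_real (exp (- s * (norm \<xi>)\<^sup>2))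
     = (\<Prod>b\<in>Basis. exp (\<i> * of_real ((x \<bullet> b) * (\<xi> \<bullet> b))) * complex_of_real (exp (- s * (\<xi> \<bullet> b)\<^sup>2)))"
proof -
  have "norm \<xi> ^ 2 = (\<Sum>b\<in>Basis. (\<xi> \<bullet> b)\<^sup>2)"
    by (rule norm_sq_Basis)
  then show ?thesis
    by (simp add: prod.distrib exp_sum[symmetric] of_real_prod[symmetric] euclidean_inner[of x \<xi>] sum_distrib_left del: of_real_prod of_real_sum)
      (simp add: sum_distrib_left)
qed

lemma gaussian_fourier:
  fixes x :: "'a::euclidean_space"
  assumes s: "s > 0"
  shows "(LINT \<xi>|lborel. exp (\<i> * of_real (x \<bullet> \<xi>)) * of_real (exp (- s * (norm \<xi>)\<^sup>2)))
       = complex_of_real (sqrt (pi / s) ^ DIM('a) * exp (- (norm x)\<^sup>2 / (4 * s)))"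
proof -
  have "norm x ^ 2 = (\<Sum>b\<in>Basis. (x \<bullet> b)\<^sup>2)"
    by (rule norm_sq_Basis)
  then have n: "exp (- (norm x)\<^sup>2 / (4 * s)) = (\<Prod>b\<in>Basis. exp (- (x \<bullet> b)\<^sup>2 / (4 * s)))"
    by (simp add: exp_sum[symmetric] sum_divide_distrib sum_negf)
  have "(LINT \<xi>|lborel. exp (\<i> * of_real (x \<bullet> \<xi>)) * of_real (exp (- s * (norm \<xi>)\<^sup>2)))
     = (\<Prod>b\<in>Basis. complex_of_real (sqrt (pi / s) * exp (- (x \<bullet> b)\<^sup>2 / (4 * s))))"
    unfolding exp_prod_Basis
    by (subst integral_lborel_prod_Basis) (simp_all only: gaussian_fourier_real[OF s])
  also have "\<dots> = of_real (\<Prod>b\<in>(Basis::'a set). sqrt (pi / s) * exp (- (x \<bullet> b)\<^sup>2 / (4 * s)))"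
    by (rule of_real_prod[symmetric])
  also have "(\<Prod>b\<in>(Basis::'a set). sqrt (pi / s) * exp (- (x \<bullet> b)\<^sup>2 / (4 * s)))
     = sqrt (pi / s) ^ DIM('a) * exp (- (norm x)\<^sup>2 / (4 * s))"
    unfolding n by (simp add: prod.distrib)
  finally show ?thesis .
qed

text \<open>The properties of Gaussian transforms that survive both nonnegative combinations (where
  \<open>A\<close> adds up) and pointwise limits. The constants are normalized so that every
  Gaussian has \<open>A = 1\<close>, whatever its width. Values are complex because the functions
  arise as Fourier integrals.\<close>

definition good_kernel :: "real \<Rightarrow> ('a::euclidean_space \<Rightarrow> complex) \<Rightarrow> bool" where
  "good_kernel A u \<longleftrightarrow> u \<in> borel_measurable borel \<and>
    (\<forall>x. Im (u x) = 0 \<and> 0 \<le> Re (u x) \<and> norm x ^ DIM('a) * Re (u x) \<le> A * ((2 * sqrt pi) ^ DIM('a) * fact DIM('a))) \<and>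
    (\<integral>\<^sup>+x. ennreal (Re (u x)) \<partial>lborel) \<le>
      ennreal A * (ennreal ((2 * sqrt pi) ^ DIM('a)) * (\<integral>\<^sup>+(y::'a). ennreal (exp (- (norm y)\<^sup>2)) \<partial>lborel))"

lemma power_le_fact_exp_square:
  fixes u :: real assumes "u \<ge> 0" shows "u ^ n \<le> fact n * exp (u\<^sup>2)"
proof (cases "u \<le> 1")
  case True
  have "u ^ n \<le> 1" using True assms by (rule power_le_one[rotated])
  also have "\<dots> \<le> fact n * exp (u\<^sup>2)"
    using mult_mono[of 1 "fact n" 1 "exp (u\<^sup>2)"] by (simp add: fact_ge_1)
  finally show ?thesis .
next
  case False
  have "u ^ n \<le> (u\<^sup>2) ^ n" using False by (intro power_mono) (auto simp: power2_eq_square)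
  also have "\<dots> \<le> fact n * exp (u\<^sup>2)" by (rule power_le_fact_exp) simp
  finally show ?thesis .
qed

lemma good_kernel_gaussian:
  assumes s: "s > 0"
  shows "good_kernel 1 (\<lambda>x::'a::euclidean_space. LINT \<xi>|lborel. exp (\<i> * of_real (x \<bullet> \<xi>)) * of_real (exp (- s * (norm \<xi>)\<^sup>2)))"
proof -
  \<comment> \<open>The width of exp(-|x|^2 / (4 s)). In terms of it the amplitude (pi / s)^(n/2) is
    (2 sqrt pi / c)^n, so that \<open>s\<close> cancels from the decay bound and from the
    integral.\<close>
  define c where "c = 2 * sqrt s"
  have c: "c > 0" "c\<^sup>2 = 4 * s" "sqrt (pi / s) = 2 * sqrt pi / c"
    using s by (simp_all add: c_def power_mult_distrib real_sqrt_divide)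
  have bd: "norm x ^ DIM('a) * (sqrt (pi / s) ^ DIM('a) * exp (- (norm x)\<^sup>2 / (4 * s))) \<le> (2 * sqrt pi) ^ DIM('a) * fact DIM('a)" for x :: 'a
  proof -
    have "(norm x / c) ^ DIM('a) \<le> fact DIM('a) * exp ((norm x / c)\<^sup>2)"
      using c by (intro power_le_fact_exp_square) simp
    then have "(norm x / c) ^ DIM('a) / exp ((norm x / c)\<^sup>2) \<le> fact DIM('a)"
      by (subst pos_divide_le_eq) auto
    then have "(norm x / c) ^ DIM('a) * exp (- ((norm x / c)\<^sup>2)) \<le> fact DIM('a)"
      by (simp only: exp_minus divide_inverse)
    then have "(2 * sqrt pi) ^ DIM('a) * ((norm x / c) ^ DIM('a) * exp (- ((norm x / c)\<^sup>2))) \<le> (2 * sqrt pi) ^ DIM('a) * fact DIM('a)"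
      by (intro mult_left_mono) auto
    then show ?thesis using c by (simp add: power_divide mult_ac)
  qed
  have int: "(\<integral>\<^sup>+(x::'a). ennreal (sqrt (pi / s) ^ DIM('a) * exp (- (norm x)\<^sup>2 / (4 * s))) \<partial>lborel)
     = ennreal ((2 * sqrt pi) ^ DIM('a)) * (\<integral>\<^sup>+(y::'a). ennreal (exp (- (norm y)\<^sup>2)) \<partial>lborel)"
  proof -
    have "(\<integral>\<^sup>+(x::'a). ennreal (sqrt (pi / s) ^ DIM('a) * exp (- (norm x)\<^sup>2 / (4 * s))) \<partial>lborel)
       = ennreal (\<bar>c\<bar> ^ DIM('a)) * (\<integral>\<^sup>+(x::'a). ennreal (sqrt (pi / s) ^ DIM('a) * exp (- (norm (0 + c *\<^sub>R x))\<^sup>2 / (4 * s))) \<partial>lborel)"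
      using c by (intro nn_integral_lborel_affine) auto
    also have "(norm (0 + c *\<^sub>R x))\<^sup>2 / (4 * s) = (norm x)\<^sup>2" for x :: 'a
      using c s by (simp add: power_mult_distrib)
    then have "(\<integral>\<^sup>+(x::'a). ennreal (sqrt (pi / s) ^ DIM('a) * exp (- (norm (0 + c *\<^sub>R x))\<^sup>2 / (4 * s))) \<partial>lborel)
      = ennreal (sqrt (pi / s) ^ DIM('a)) * (\<integral>\<^sup>+(x::'a). ennreal (exp (- (norm x)\<^sup>2)) \<partial>lborel)"
      using s by (subst nn_integral_cmult[symmetric]) (auto simp: ennreal_mult minus_divide_left[symmetric])
    also have "ennreal (\<bar>c\<bar> ^ DIM('a)) * (ennreal (sqrt (pi / s) ^ DIM('a)) * (\<integral>\<^sup>+(x::'a). ennreal (exp (- (norm x)\<^sup>2)) \<partial>lborel))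
       = ennreal (\<bar>c\<bar> ^ DIM('a) * sqrt (pi / s) ^ DIM('a)) * (\<integral>\<^sup>+(x::'a). ennreal (exp (- (norm x)\<^sup>2)) \<partial>lborel)"
      using s by (simp add: ennreal_mult mult.assoc)
    also have "\<bar>c\<bar> ^ DIM('a) * sqrt (pi / s) ^ DIM('a) = (2 * sqrt pi) ^ DIM('a)"
      using c by (simp only: power_mult_distrib[symmetric]) simp
    finally show ?thesis .
  qed
  show ?thesis
    unfolding good_kernel_def gaussian_fourier[OF s] Re_complex_of_real Im_complex_of_real int mult_1_left ennreal_1
    using s bd by (intro conjI allI order_refl refl) (auto simp del: of_real_mult)
qed

lemma good_kernel_0: "good_kernel 0 (\<lambda>_. 0)"
  by (simp add: good_kernel_def)

lemma good_kernel_add: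
  fixes u v :: "'a::euclidean_space \<Rightarrow> complex"
  assumes u: "good_kernel A u" and v: "good_kernel B v" and "A \<ge> 0" "B \<ge> 0"
  shows "good_kernel (A + B) (\<lambda>x. u x + v x)"
proof -
  have [measurable]: "u \<in> borel_measurable borel" "v \<in> borel_measurable borel"
    using u v by (auto simp: good_kernel_def)
  have "(\<integral>\<^sup>+x. ennreal (Re (u x + v x)) \<partial>lborel) = (\<integral>\<^sup>+x. ennreal (Re (u x)) \<partial>lborel) + (\<integral>\<^sup>+x. ennreal (Re (v x)) \<partial>lborel)"
    using u v by (subst nn_integral_add[symmetric]) (auto simp: good_kernel_def)
  then show ?thesis
    using u v assms(3,4) unfolding good_kernel_def
    by (auto simp: distrib_left distrib_right intro!: add_mono)
qed

lemma good_kernel_scale: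
  fixes u :: "'a::euclidean_space \<Rightarrow> complex"
  assumes u: "good_kernel A u" and "A \<ge> 0" "w \<ge> 0"
  shows "good_kernel (w * A) (\<lambda>x. of_real w * u x)"
proof -
  have [measurable]: "u \<in> borel_measurable borel"
    using u by (auto simp: good_kernel_def)
  have "(\<integral>\<^sup>+x. ennreal (Re (of_real w * u x)) \<partial>lborel) = ennreal w * (\<integral>\<^sup>+x. ennreal (Re (u x)) \<partial>lborel)"
    using u assms by (subst nn_integral_cmult[symmetric]) (auto simp: good_kernel_def ennreal_mult)
  moreover have "norm x ^ DIM('a) * (w * Re (u x)) \<le> w * A * ((2 * sqrt pi) ^ DIM('a) * fact DIM('a))" for x
    using mult_left_mono[of "norm x ^ DIM('a) * Re (u x)" "A * ((2 * sqrt pi) ^ DIM('a) * fact DIM('a))" w] u assms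
    by (auto simp: good_kernel_def mult_ac)
  ultimately show ?thesis
    using u assms(2,3) unfolding good_kernel_def
    by (auto simp: ennreal_mult mult.assoc intro!: mult_left_mono)
qed

lemma good_kernel_mono:
  fixes u :: "'a::euclidean_space \<Rightarrow> complex"
  assumes u: "good_kernel A u" and "A \<le> B"
  shows "good_kernel B u"
proof -
  have "A * ((2 * sqrt pi) ^ DIM('a) * fact DIM('a)) \<le> B * ((2 * sqrt pi) ^ DIM('a) * fact DIM('a))"
    using assms by (intro mult_right_mono) auto
  moreover have "ennreal A * X \<le> ennreal B * X" for X
    using assms by (intro mult_right_mono) (auto simp: ennreal_leI)
  ultimately show ?thesis using u unfolding good_kernel_def by (meson order_trans)
qed

text \<open>All conditions are equalities or one-sided bounds at a point, except the integral bound;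
  as that is an upper bound, Fatou's lemma carries it over without a majorant.\<close>

lemma good_kernel_limit:
  fixes u :: "nat \<Rightarrow> 'a::euclidean_space \<Rightarrow> complex"
  assumes u: "\<And>m. good_kernel A (u m)" and lim: "\<And>x. (\<lambda>m. u m x) \<longlonglongrightarrow> v x"
  shows "good_kernel A v"
proof -
  have [measurable]: "u m \<in> borel_measurable borel" for m using u by (auto simp: good_kernel_def)
  have [measurable]: "v \<in> borel_measurable borel" by (rule borel_measurable_LIMSEQ_metric[OF _ lim]) simp
  have re: "(\<lambda>m. Re (u m x)) \<longlonglongrightarrow> Re (v x)" and im: "(\<lambda>m. Im (u m x)) \<longlonglongrightarrow> Im (v x)" for x
    using tendsto_Re[OF lim] tendsto_Im[OF lim] by auto
  have "Im (v x) = 0" for x using im[of x] u by (simp add: good_kernel_def LIMSEQ_const_iff)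
  moreover have "0 \<le> Re (v x)" for x using re[of x] by (rule LIMSEQ_le_const) (use u in \<open>auto simp: good_kernel_def\<close>)
  moreover have "norm x ^ DIM('a) * Re (v x) \<le> A * ((2 * sqrt pi) ^ DIM('a) * fact DIM('a))" for x
    by (rule LIMSEQ_le_const2[OF tendsto_mult_left[OF re]]) (use u in \<open>auto simp: good_kernel_def\<close>)
  moreover have "(\<integral>\<^sup>+x. ennreal (Re (v x)) \<partial>lborel) \<le>
      ennreal A * (ennreal ((2 * sqrt pi) ^ DIM('a)) * (\<integral>\<^sup>+(y::'a). ennreal (exp (- (norm y)\<^sup>2)) \<partial>lborel))"
  proof -
    have "(\<integral>\<^sup>+x. ennreal (Re (v x)) \<partial>lborel) = (\<integral>\<^sup>+x. liminf (\<lambda>m. ennreal (Re (u m x))) \<partial>lborel)"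
      by (intro nn_integral_cong lim_imp_Liminf[symmetric] tendsto_ennrealI re) simp
    also have "\<dots> \<le> liminf (\<lambda>m. \<integral>\<^sup>+x. ennreal (Re (u m x)) \<partial>lborel)"
      by (rule nn_integral_liminf) simp
    also have "\<dots> \<le> ennreal A * (ennreal ((2 * sqrt pi) ^ DIM('a)) * (\<integral>\<^sup>+(y::'a). ennreal (exp (- (norm y)\<^sup>2)) \<partial>lborel))"
      by (rule Liminf_le) (use u in \<open>auto simp: good_kernel_def\<close>)
    finally show ?thesis .
  qed
  ultimately show ?thesis by (auto simp: good_kernel_def)
qed


section \<open>Combinations of exponentials and their limits\<close>

lemma integrable_gaussian:
  fixes \<delta> :: real assumes "\<delta> > 0"
  shows "integrable lborel (\<lambda>\<xi>::'a::euclidean_space. exp (- \<delta> * (norm \<xi>)\<^sup>2))"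
proof -
  have c: "sqrt \<delta> \<noteq> 0" using assms by simp
  have "integrable lborel (\<lambda>x::'a. exp (- (norm x powr 2)))"
    by (rule integrable_exp_neg_norm_powr) simp
  then have 1: "(\<integral>\<^sup>+(x::'a). ennreal (exp (- (norm x)\<^sup>2)) \<partial>lborel) < \<infinity>"
    by (subst (asm) integrable_iff_bounded) auto
  have "(\<integral>\<^sup>+(x::'a). ennreal (exp (- (norm x)\<^sup>2)) \<partial>lborel) =
     ennreal (\<bar>sqrt \<delta>\<bar> ^ DIM('a)) * (\<integral>\<^sup>+(x::'a). ennreal (exp (- (norm (0 + sqrt \<delta> *\<^sub>R x))\<^sup>2)) \<partial>lborel)"
    using c by (intro nn_integral_lborel_affine) auto
  also have "(\<lambda>x::'a. ennreal (exp (- (norm (0 + sqrt \<delta> *\<^sub>R x))\<^sup>2))) = (\<lambda>x. ennreal (exp (- (\<delta> * (norm x)\<^sup>2))))"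
    using assms by (simp add: power_mult_distrib)
  finally have "ennreal (\<bar>sqrt \<delta>\<bar> ^ DIM('a)) * (\<integral>\<^sup>+(x::'a). ennreal (exp (- (\<delta> * (norm x)\<^sup>2))) \<partial>lborel) < \<infinity>"
    using 1 by simp
  then have "(\<integral>\<^sup>+(x::'a). ennreal (exp (- (\<delta> * (norm x)\<^sup>2))) \<partial>lborel) < \<infinity>"
    using assms by (auto simp: ennreal_mult_less_top)
  then show ?thesis by (intro integrableI_bounded) auto
qed

text \<open>Evaluated at l = |\<xi>|^2, each summand is a multiple of a Gaussian. The case s = 0
  admits constants, which make products and powers stay in the class but are not integrable in
  \<xi>; hence the damping in \<open>damped_fourier\<close>.\<close>

inductive exp_combination :: "(real \<Rightarrow> real) \<Rightarrow> bool" where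
  zero: "exp_combination (\<lambda>_. 0)"
| add_exp: "exp_combination F \<Longrightarrow> w \<ge> 0 \<Longrightarrow> s \<ge> 0 \<Longrightarrow> exp_combination (\<lambda>l. F l + w * exp (- s * l))"

lemma exp_combination_add:
  assumes "exp_combination G" "exp_combination F"
  shows "exp_combination (\<lambda>l. F l + G l)"
  using assms
proof (induction arbitrary: F rule: exp_combination.induct)
  case zero then show ?case by simp
next
  case (add_exp G w s)
  from exp_combination.add_exp[OF add_exp.IH[OF add_exp.prems] add_exp.hyps(2,3)]
  show ?case by (simp add: add.assoc)
qed

lemma exp_combination_mult_exp:
  assumes "exp_combination F" "w \<ge> 0" "s \<ge> 0"
  shows "exp_combination (\<lambda>l. w * exp (- s * l) * F l)"
  using assms
proof (induction rule: exp_combination.induct)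
  case zero then show ?case by (simp add: exp_combination.zero)
next
  case (add_exp F w' s')
  have "exp_combination (\<lambda>l. w * exp (- s * l) * F l + (w * w') * exp (- (s + s') * l))"
    by (rule exp_combination.add_exp[OF add_exp.IH]) (use add_exp in auto)
  moreover have "w * exp (- s * l) * F l + (w * w') * exp (- (s + s') * l) = w * exp (- s * l) * (F l + w' * exp (- s' * l))" for l
  proof -
    have "exp (- (s + s') * l) = exp (- s * l) * exp (- s' * l)" by (simp add: exp_add[symmetric] algebra_simps)
    then show ?thesis by (simp only:) (simp add: algebra_simps)
  qed
  ultimately show ?case by simp
qed

lemma exp_combination_mult:
  assumes "exp_combination G" "exp_combination F"
  shows "exp_combination (\<lambda>l. F l * G l)"
  using assms
proof (induction arbitrary: F rule: exp_combination.induct)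
  case zero then show ?case by (simp add: exp_combination.zero)
next
  case (add_exp G w s)
  from exp_combination_add[OF exp_combination_mult_exp[OF add_exp.prems add_exp.hyps(2,3)] add_exp.IH[OF add_exp.prems]]
  show ?case by (simp add: algebra_simps)
qed

lemma exp_combination_exp: "w \<ge> 0 \<Longrightarrow> s \<ge> 0 \<Longrightarrow> exp_combination (\<lambda>l. w * exp (- s * l))"
  using exp_combination.add_exp[OF exp_combination.zero] by simp

lemma exp_combination_scale: "exp_combination F \<Longrightarrow> w \<ge> 0 \<Longrightarrow> exp_combination (\<lambda>l. w * F l)"
  using exp_combination_mult_exp[of F w 0] by simp

lemma exp_combination_power: "exp_combination F \<Longrightarrow> exp_combination (\<lambda>l. F l ^ j)"
proof (induction j)
  case 0 show ?case using exp_combination_exp[of 1 0] by simp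
next
  case (Suc j) then show ?case using exp_combination_mult[of "\<lambda>l. F l ^ j" F] by simp
qed

lemma exp_combination_sum:
  assumes "finite I" "\<And>i. i \<in> I \<Longrightarrow> exp_combination (F i)"
  shows "exp_combination (\<lambda>l. \<Sum>i\<in>I. F i l)"
  using assms by (induction I rule: finite_induct) (auto intro: exp_combination.zero exp_combination_add)

text \<open>\<open>F 0\<close> is the sum of the weights. It serves both as the supremum bound and
  as the constant in \<open>good_kernel\<close>.\<close>

lemma exp_combination_bounds:
  assumes "exp_combination F"
  shows "F \<in> borel_measurable borel \<and> (\<forall>l\<ge>0. 0 \<le> F l \<and> F l \<le> F 0)"
  using assms
proof (induction rule: exp_combination.induct)
  case (add_exp F w s)
  have "F \<in> borel_measurable borel" using add_exp.IH by simp
  then have "(\<lambda>l. F l + w * exp (- s * l)) \<in> borel_measurable borel" by measurable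
  moreover have "0 \<le> F l + w * exp (- s * l) \<and> F l + w * exp (- s * l) \<le> F 0 + w * exp (- s * 0)" if "l \<ge> 0" for l
  proof -
    have "exp (- s * l) \<le> 1" using add_exp.hyps that by simp
    then have "w * exp (- s * l) \<le> w * 1" using add_exp.hyps by (intro mult_left_mono) auto
    moreover have "0 \<le> w * exp (- s * l)" using add_exp.hyps by simp
    ultimately show ?thesis using add_exp.IH that by fastforce
  qed
  ultimately show ?case by blast
qed auto

text \<open>The factor with \<delta> makes the integral converge for any bounded F and turns a
  summand exp(-s l) into a Gaussian with parameter s + \<delta> > 0.\<close>

definition damped_fourier :: "(real \<Rightarrow> real) \<Rightarrow> real \<Rightarrow> 'a::euclidean_space \<Rightarrow> complex" where
  "damped_fourier F \<delta> x =
     (LINT \<xi>|lborel. exp (\<i> * of_real (x \<bullet> \<xi>)) * of_real (F ((norm \<xi>)\<^sup>2) * exp (- \<delta> * (norm \<xi>)\<^sup>2)))"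

lemma integrable_damped_fourier:
  fixes x :: "'a::euclidean_space"
  assumes [measurable]: "F \<in> borel_measurable borel" and F: "\<And>l. l \<ge> 0 \<Longrightarrow> \<bar>F l\<bar> \<le> C" and "\<delta> > 0"
  shows "integrable lborel (\<lambda>\<xi>. exp (\<i> * of_real (x \<bullet> \<xi>)) * complex_of_real (F ((norm \<xi>)\<^sup>2) * exp (- \<delta> * (norm \<xi>)\<^sup>2)))"
proof (rule Bochner_Integration.integrable_bound[OF integrable_mult_right[of C, OF integrable_gaussian[OF \<open>\<delta> > 0\<close>]]])
  show "AE \<xi> in lborel. norm (exp (\<i> * of_real (x \<bullet> \<xi>)) * complex_of_real (F ((norm \<xi>)\<^sup>2) * exp (- \<delta> * (norm \<xi>)\<^sup>2)))
     \<le> norm (C * exp (- \<delta> * (norm \<xi>)\<^sup>2))"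
  proof (rule AE_I2)
    fix \<xi> :: 'a
    have "\<bar>F ((norm \<xi>)\<^sup>2)\<bar> \<le> \<bar>C\<bar>" using F[of "(norm \<xi>)\<^sup>2"] by simp
    then show "norm (exp (\<i> * of_real (x \<bullet> \<xi>)) * complex_of_real (F ((norm \<xi>)\<^sup>2) * exp (- \<delta> * (norm \<xi>)\<^sup>2)))
     \<le> norm (C * exp (- \<delta> * (norm \<xi>)\<^sup>2))"
      by (simp add: norm_mult abs_mult del: of_real_mult)
  qed
qed measurable

lemma good_kernel_exp_combination:
  assumes "exp_combination F" "\<delta> > 0"
  shows "good_kernel (F 0) (damped_fourier F \<delta> :: 'a::euclidean_space \<Rightarrow> complex)"
  using assms
proof (induction rule: exp_combination.induct)
  case zero
  have "damped_fourier (\<lambda>_. 0) \<delta> = (\<lambda>_::'a. 0)" by (simp add: damped_fourier_def fun_eq_iff)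
  then show ?case by (simp add: good_kernel_0)
next
  case (add_exp F w s)
  let ?g = "\<lambda>x::'a. LINT \<xi>|lborel. exp (\<i> * of_real (x \<bullet> \<xi>)) * complex_of_real (exp (- (s + \<delta>) * (norm \<xi>)\<^sup>2))"
  have [measurable]: "F \<in> borel_measurable borel" and F: "\<And>l. l \<ge> 0 \<Longrightarrow> \<bar>F l\<bar> \<le> F 0" "F 0 \<ge> 0"
    using exp_combination_bounds[OF add_exp.hyps(1)] by auto
  have sd: "s + \<delta> > 0" using add_exp by simp
  have eq: "damped_fourier (\<lambda>l. F l + w * exp (- s * l)) \<delta> = (\<lambda>x::'a. damped_fourier F \<delta> x + of_real w * ?g x)"
  proof
    fix x :: 'a
    have "damped_fourier (\<lambda>l. F l + w * exp (- s * l)) \<delta> x =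
      (LINT \<xi>|lborel. exp (\<i> * of_real (x \<bullet> \<xi>)) * complex_of_real (F ((norm \<xi>)\<^sup>2) * exp (- \<delta> * (norm \<xi>)\<^sup>2))
        + of_real w * (exp (\<i> * of_real (x \<bullet> \<xi>)) * complex_of_real (1 * exp (- (s + \<delta>) * (norm \<xi>)\<^sup>2))))"
      unfolding damped_fourier_def
    proof (rule Bochner_Integration.integral_cong[OF refl])
      fix \<xi> :: 'a
      have "exp (- (s + \<delta>) * (norm \<xi>)\<^sup>2) = exp (- s * (norm \<xi>)\<^sup>2) * exp (- \<delta> * (norm \<xi>)\<^sup>2)"
        by (simp add: exp_add[symmetric] algebra_simps)
      then show "exp (\<i> * of_real (x \<bullet> \<xi>)) * complex_of_real ((F ((norm \<xi>)\<^sup>2) + w * exp (- s * (norm \<xi>)\<^sup>2)) * exp (- \<delta> * (norm \<xi>)\<^sup>2)) =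
        exp (\<i> * of_real (x \<bullet> \<xi>)) * complex_of_real (F ((norm \<xi>)\<^sup>2) * exp (- \<delta> * (norm \<xi>)\<^sup>2))
        + of_real w * (exp (\<i> * of_real (x \<bullet> \<xi>)) * complex_of_real (1 * exp (- (s + \<delta>) * (norm \<xi>)\<^sup>2)))"
        by (simp only: of_real_mult of_real_add) (simp add: algebra_simps)
    qed
    also have "\<dots> = damped_fourier F \<delta> x + of_real w * ?g x"
      unfolding damped_fourier_def
    proof (subst Bochner_Integration.integral_add)
      show "integrable lborel (\<lambda>\<xi>. exp (\<i> * of_real (x \<bullet> \<xi>)) * complex_of_real (F ((norm \<xi>)\<^sup>2) * exp (- \<delta> * (norm \<xi>)\<^sup>2)))"
        by (rule integrable_damped_fourier[of F "F 0" \<delta> x]) (use F add_exp.prems in auto)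
      show "integrable lborel (\<lambda>\<xi>. of_real w * (exp (\<i> * of_real (x \<bullet> \<xi>)) * complex_of_real (1 * exp (- (s + \<delta>) * (norm \<xi>)\<^sup>2))))"
        by (intro integrable_mult_right integrable_damped_fourier[of "\<lambda>_. 1" 1 "s + \<delta>" x]) (use sd in auto)
    qed (simp only: integral_mult_right_zero mult_1_left)
    finally show "damped_fourier (\<lambda>l. F l + w * exp (- s * l)) \<delta> x = damped_fourier F \<delta> x + of_real w * ?g x" .
  qed
  have "good_kernel (F 0 + w * 1) (\<lambda>x. damped_fourier F \<delta> x + of_real w * ?g x)"
    using add_exp F by (intro good_kernel_add good_kernel_scale good_kernel_gaussian[OF sd]) auto
  then show ?case unfolding eq by (simp only: mult_zero_right exp_zero)
qed

text \<open>The property that is pushed through three successive limits. The bound is asked for l >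
  0 only, because the approximations converge there and \<xi> = 0 is a null set. The type argument
  merely carries the dimension.\<close>

definition positive_type :: "'a::euclidean_space itself \<Rightarrow> (real \<Rightarrow> real) \<Rightarrow> bool" where
  "positive_type _ F \<longleftrightarrow> F \<in> borel_measurable borel \<and> (\<forall>l>0. \<bar>F l\<bar> \<le> 1) \<and>
     (\<forall>\<delta>>0. good_kernel 1 (damped_fourier F \<delta> :: 'a \<Rightarrow> complex))"

lemma positive_type_exp_combination:
  assumes "exp_combination F" "F 0 \<le> 1"
  shows "positive_type TYPE('a::euclidean_space) F"
proof -
  have "\<bar>F l\<bar> \<le> 1" if "l > 0" for l 
  proof -
    have "0 \<le> F l" "F l \<le> F 0" using exp_combination_bounds[OF assms(1)] that by auto
    then show ?thesis using assms(2) by simp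
  qed
  then show ?thesis
    unfolding positive_type_def using exp_combination_bounds[OF assms(1)]
      good_kernel_mono[OF good_kernel_exp_combination[OF assms(1)] assms(2)] by blast
qed

text \<open>The Gaussian exp(-\<delta> |\<xi>|^2) dominates all damped integrands since |F| is at
  most 1, so the damped transforms converge pointwise and \<open>good_kernel_limit\<close>
  applies.\<close>

lemma positive_type_limit:
  fixes F :: "nat \<Rightarrow> real \<Rightarrow> real"
  assumes F: "\<And>m. positive_type TYPE('a::euclidean_space) (F m)"
    and lim: "\<And>l. l > 0 \<Longrightarrow> (\<lambda>m. F m l) \<longlonglongrightarrow> G l" and [measurable]: "G \<in> borel_measurable borel"
  shows "positive_type TYPE('a) G"
proof -
  have [measurable]: "F m \<in> borel_measurable borel" for m using F by (auto simp: positive_type_def)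
  have F1: "\<bar>F m l\<bar> \<le> 1" if "l > 0" for m l using F that by (auto simp: positive_type_def)
  have "\<bar>G l\<bar> \<le> 1" if "l > 0" for l
    using tendsto_rabs[OF lim[OF that]] by (rule LIMSEQ_le_const2) (use F1 that in auto)
  moreover have "good_kernel 1 (damped_fourier G \<delta> :: 'a \<Rightarrow> complex)" if "\<delta> > 0" for \<delta>
  proof (rule good_kernel_limit)
    show "good_kernel 1 (damped_fourier (F m) \<delta> :: 'a \<Rightarrow> complex)" for m
      using F that by (auto simp: positive_type_def)
    fix x :: 'a
    show "(\<lambda>m. damped_fourier (F m) \<delta> x) \<longlonglongrightarrow> damped_fourier G \<delta> x"
      unfolding damped_fourier_def
    proof (rule integral_dominated_convergence[OF _ _ integrable_gaussian[OF that]])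
      have "AE \<xi> in lborel. \<xi> \<noteq> (0::'a)" by (rule AE_lborel_singleton)
      then show "AE \<xi> in lborel. (\<lambda>m. exp (\<i> * of_real (x \<bullet> \<xi>)) * complex_of_real (F m ((norm \<xi>)\<^sup>2) * exp (- \<delta> * (norm \<xi>)\<^sup>2)))
         \<longlonglongrightarrow> exp (\<i> * of_real (x \<bullet> \<xi>)) * complex_of_real (G ((norm \<xi>)\<^sup>2) * exp (- \<delta> * (norm \<xi>)\<^sup>2))"
        by eventually_elim (intro tendsto_intros lim, simp)
      fix m
      from \<open>AE \<xi> in lborel. \<xi> \<noteq> (0::'a)\<close>
      show "AE \<xi> in lborel. norm (exp (\<i> * of_real (x \<bullet> \<xi>)) * complex_of_real (F m ((norm \<xi>)\<^sup>2) * exp (- \<delta> * (norm \<xi>)\<^sup>2)))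
         \<le> exp (- \<delta> * (norm \<xi>)\<^sup>2)"
      proof eventually_elim
        fix \<xi> :: 'a assume "\<xi> \<noteq> 0"
        then show "norm (exp (\<i> * of_real (x \<bullet> \<xi>)) * complex_of_real (F m ((norm \<xi>)\<^sup>2) * exp (- \<delta> * (norm \<xi>)\<^sup>2)))
         \<le> exp (- \<delta> * (norm \<xi>)\<^sup>2)"
          using F1[of "(norm \<xi>)\<^sup>2" m] by (simp add: norm_mult abs_mult mult_le_cancel_right1 del: of_real_mult)
      qed
    qed measurable
  qed
  ultimately show ?thesis by (auto simp: positive_type_def)
qed

text \<open>This coefficient equals \<alpha> (1 - \<alpha>) (2 - \<alpha>) ... (k - \<alpha>) / (k +
  1)!, and no factor is negative when 0 < \<alpha> \<le> 1.\<close>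

lemma binomial_coeff_nonneg:
  fixes \<alpha> :: real assumes "0 < \<alpha>" "\<alpha> \<le> 1"
  shows "- ((\<alpha> gchoose Suc k) * (-1) ^ Suc k) \<ge> 0"
proof -
  have "(-1) ^ Suc k * (\<alpha> gchoose Suc k) = (of_nat (Suc k) - \<alpha> - 1) gchoose Suc k"
    by (subst gbinomial_negated_upper) (simp add: power_mult_distrib[symmetric])
  also have "\<dots> = (\<Prod>i=0..k. (of_nat k - \<alpha>) - of_nat i) / fact (Suc k)"
    by (simp add: gbinomial_Suc)
  also have "(\<Prod>i=0..k. (of_nat k - \<alpha>) - of_nat i) = - \<alpha> * (\<Prod>i<k. (of_nat k - \<alpha>) - of_nat i)"
    by (simp add: atLeast0AtMost lessThan_Suc_atMost[symmetric])
  finally have "- ((\<alpha> gchoose Suc k) * (-1) ^ Suc k) = \<alpha> * (\<Prod>i<k. (of_nat k - \<alpha>) - of_nat i) / fact (Suc k)"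
    by (simp add: mult.commute)
  also have "\<dots> \<ge> 0"
  proof -
    have "of_nat k - \<alpha> - of_nat i \<ge> 0" if "i < k" for i
    proof -
      have "real i + 1 \<le> real k" using that by simp
      then show ?thesis using assms by linarith
    qed
    then show ?thesis using assms by (intro divide_nonneg_nonneg mult_nonneg_nonneg prod_nonneg) auto
  qed
  finally show ?thesis .
qed

lemma binomial_series:
  fixes \<alpha> :: real assumes "0 < \<alpha>" "\<alpha> \<le> 1"
  obtains a :: "nat \<Rightarrow> real" where "\<And>k. a k \<ge> 0" "\<And>m. (\<Sum>k<m. a k) \<le> 1"
    "\<And>y. 0 < y \<Longrightarrow> y < 1 \<Longrightarrow> (\<lambda>k. a k * y ^ k) sums (1 - (1 - y) powr \<alpha>)"
proof -
  define a where "a k = (if k = 0 then 0 else - ((\<alpha> gchoose k) * (-1) ^ k))" for k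
  have a0: "a k \<ge> 0" for k using binomial_coeff_nonneg[OF assms, of "k - 1"] by (cases k) (auto simp: a_def)
  have sums: "(\<lambda>k. a k * y ^ k) sums (1 - (1 - y) powr \<alpha>)" if "0 < y" "y < 1" for y
  proof -
    have "(\<lambda>k. (\<alpha> gchoose k) * (-y) ^ k) sums (1 + (-y)) powr \<alpha>"
      using that by (intro gen_binomial_real) auto
    from sums_diff[OF sums_single[of 0 "\<lambda>_. 1"] this]
    have "(\<lambda>k. (if k = 0 then 1 else 0) - (\<alpha> gchoose k) * (-y) ^ k) sums (1 - (1 - y) powr \<alpha>)" by simp
    moreover have "(if k = 0 then 1 else 0) - (\<alpha> gchoose k) * (-y) ^ k = a k * y ^ k" for k
      using power_minus[of y k] by (auto simp: a_def)
    ultimately show ?thesis by simp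
  qed
  \<comment> \<open>A partial sum is a polynomial in y that stays below 1 on (0, 1) by positivity of
    the coefficients; continuity at 1 from the left gives the bound.\<close>
  have "(\<Sum>k<m. a k) \<le> 1" for m
  proof -
    have "((\<lambda>y. \<Sum>k<m. a k * y ^ k) \<longlongrightarrow> (\<Sum>k<m. a k * 1 ^ k)) (at_left (1::real))"
      by (intro tendsto_intros)
    moreover have "eventually (\<lambda>y. (\<Sum>k<m. a k * y ^ k) \<le> 1) (at_left (1::real))"
      using eventually_at_left_real[of 0 1, OF zero_less_one]
    proof eventually_elim
      fix y :: real assume y: "y \<in> {0<..<1}"
      have "(\<Sum>k<m. a k * y ^ k) \<le> 1 - (1 - y) powr \<alpha>"
        using sums[of y] y a0 by (auto intro!: sum_le_suminf[THEN order_trans] simp: sums_iff)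
      also have "\<dots> \<le> 1" by simp
      finally show "(\<Sum>k<m. a k * y ^ k) \<le> 1" .
    qed
    ultimately have "(\<Sum>k<m. a k * 1 ^ k) \<le> 1" by (rule tendsto_upperbound) simp
    then show ?thesis by simp
  qed
  then show ?thesis using that[of a] a0 sums by blast
qed

text \<open>Following Feller's proof of Bernstein's theorem, \<open>exp (- l powr \<alpha>)\<close> is approximated by its
  Taylor series at \<open>N\<close> evaluated at \<open>N - N * exp (- l / N)\<close>; the Taylor coefficients have
  alternating signs.\<close>

lemma positive_type_exp_powr:
  fixes \<alpha> :: real assumes \<alpha>: "0 < \<alpha>" "\<alpha> \<le> 1"
  shows "positive_type TYPE('a::euclidean_space) (\<lambda>l. exp (- (l powr \<alpha>)))"
proof -
  obtain a :: "nat \<Rightarrow> real" where a: "\<And>k. a k \<ge> 0" "\<And>m. (\<Sum>k<m. a k) \<le> 1"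
    "\<And>y. 0 < y \<Longrightarrow> y < 1 \<Longrightarrow> (\<lambda>k. a k * y ^ k) sums (1 - (1 - y) powr \<alpha>)"
    using binomial_series[OF \<alpha>] by blast
  let ?y = "\<lambda>N l. exp (- (1 / real (Suc N)) * l)"
  let ?w = "\<lambda>N. real (Suc N) powr \<alpha>"
  \<comment> \<open>With y = exp(-l / Suc N), the target exp(-(Suc N * (1 - y))^\<alpha>) factors as
    exp(-w) exp(w (1 - (1 - y)^\<alpha>)), where w is \<open>?w N\<close>. Both the binomial and the
    exponential series have nonnegative coefficients in y. \<open>P N M\<close> truncates the first
    at \<open>M\<close>, the second is truncated at \<open>J\<close>; then J, M and N tend to
    infinity in this order.\<close>
  define P where "P N M l = ?w N * (\<Sum>k<M. a k * ?y N l ^ k)" for N M l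
  have P: "exp_combination (P N M)" for N M
    unfolding P_def by (intro exp_combination_scale exp_combination_sum a exp_combination_power)
      (use exp_combination_exp[of 1 "1 / real (Suc N)"] in auto)
  have P0: "0 \<le> P N M 0" "P N M 0 \<le> ?w N" for N M
    using a mult_left_le[OF a(2), of "?w N" M] by (auto simp: P_def intro!: mult_nonneg_nonneg sum_nonneg)
  have [measurable]: "P N M \<in> borel_measurable borel" for N M using exp_combination_bounds[OF P] by simp
  have es: "(\<lambda>j. p ^ j / fact j) sums exp p" for p :: real
    using exp_converges[of p] by (simp add: divide_inverse mult.commute)
  have 1: "positive_type TYPE('a) (\<lambda>l. exp (- ?w N) * (\<Sum>j<J. P N M l ^ j / fact j))" for N M J
  proof (rule positive_type_exp_combination)
    have "exp_combination (\<lambda>l. P N M l ^ j / fact j)" for j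
      using exp_combination_scale[OF exp_combination_power[OF P[of N M], of j], of "1 / fact j"] by simp
    then show "exp_combination (\<lambda>l. exp (- ?w N) * (\<Sum>j<J. P N M l ^ j / fact j))"
      by (intro exp_combination_scale exp_combination_sum) auto
    \<comment> \<open>At l = 0 every y is 1, and since the partial sums of \<open>a\<close> are at
      most 1, \<open>P N M 0\<close> stays below \<open>?w N\<close>. The prefactor
      \<open>exp (- ?w N)\<close> then keeps the total weight at most 1.\<close>
    have "(\<Sum>j<J. P N M 0 ^ j / fact j) \<le> exp (P N M 0)"
      using es[of "P N M 0"] P0(1)[of N M] by (auto intro!: sum_le_suminf[THEN order_trans] simp: sums_iff)
    also have "\<dots> \<le> exp (?w N)" using P0 by simp
    finally have "exp (- ?w N) * (\<Sum>j<J. P N M 0 ^ j / fact j) \<le> exp (- ?w N) * exp (?w N)"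
      by (intro mult_left_mono) auto
    then show "exp (- ?w N) * (\<Sum>j<J. P N M 0 ^ j / fact j) \<le> 1" by (simp add: exp_minus)
  qed
  have 2: "positive_type TYPE('a) (\<lambda>l. exp (- ?w N) * exp (P N M l))" for N M
    by (rule positive_type_limit[OF 1[of N M]])
      (use es in \<open>auto intro!: tendsto_mult_left simp: sums_def\<close>)
  have 3: "positive_type TYPE('a) (\<lambda>l. exp (- ((real (Suc N) * (1 - ?y N l)) powr \<alpha>)))" for N
  proof (rule positive_type_limit[OF 2[of N]])
    fix l :: real assume l: "l > 0"
    then have y: "0 < ?y N l" "?y N l < 1" by auto
    have "(\<lambda>M. P N M l) \<longlonglongrightarrow> ?w N * (1 - (1 - ?y N l) powr \<alpha>)"
      unfolding P_def using a(3)[OF y] by (intro tendsto_mult_left) (simp add: sums_def)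
    then have "(\<lambda>M. exp (- ?w N) * exp (P N M l)) \<longlonglongrightarrow> exp (- ?w N) * exp (?w N * (1 - (1 - ?y N l) powr \<alpha>))"
      by (intro tendsto_mult_left tendsto_exp)
    also have "exp (- ?w N) * exp (?w N * (1 - (1 - ?y N l) powr \<alpha>)) = exp (- ((real (Suc N) * (1 - ?y N l)) powr \<alpha>))"
      using y by (subst powr_mult) (auto simp: exp_add[symmetric] right_diff_distrib simp del: of_nat_Suc)
    finally show "(\<lambda>M. exp (- ?w N) * exp (P N M l)) \<longlonglongrightarrow> exp (- ((real (Suc N) * (1 - ?y N l)) powr \<alpha>))" .
  qed measurable
  show ?thesis
  proof (rule positive_type_limit[OF 3])
    fix l :: real assume l: "l > 0"
    \<comment> \<open>The limit of Suc N * (1 - exp(-l / Suc N)) is minus the derivative of exp(-l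
      h) at h = 0.\<close>
    have "((\<lambda>h. (exp (- l * (0 + h)) - exp (- l * 0)) / h) \<longlongrightarrow> - l) (at 0)"
    proof -
      have "((\<lambda>h. exp (- l * h)) has_real_derivative - l) (at 0)" by (auto intro!: derivative_eq_intros)
      then show ?thesis by (simp only: DERIV_def)
    qed
    then have "((\<lambda>h. (exp (- l * h) - 1) / h) \<longlongrightarrow> - l) (at 0)" by simp
    moreover have "filterlim (\<lambda>N. 1 / real (Suc N)) (at 0) sequentially"
      by (rule filterlim_atI) (use LIMSEQ_Suc[OF lim_1_over_n] in auto)
    ultimately have "(\<lambda>N. (exp (- l * (1 / real (Suc N))) - 1) / (1 / real (Suc N))) \<longlonglongrightarrow> - l"
      by (rule filterlim_compose)
    then have "(\<lambda>N. - ((exp (- l * (1 / real (Suc N))) - 1) / (1 / real (Suc N)))) \<longlonglongrightarrow> - (- l)"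
      by (rule tendsto_minus)
    then have "(\<lambda>N. real (Suc N) * (1 - ?y N l)) \<longlonglongrightarrow> l"
      by (simp add: algebra_simps)
    then have "(\<lambda>N. (real (Suc N) * (1 - ?y N l)) powr \<alpha>) \<longlonglongrightarrow> l powr \<alpha>"
      using l by (intro tendsto_powr) auto
    then show "(\<lambda>N. exp (- ((real (Suc N) * (1 - ?y N l)) powr \<alpha>))) \<longlonglongrightarrow> exp (- (l powr \<alpha>))"
      by (intro tendsto_exp tendsto_minus)
  qed measurable
qed


section \<open>The profile of the fractional heat kernel\<close>

definition stable_fourier :: "real \<Rightarrow> 'a::euclidean_space \<Rightarrow> complex" where
  "stable_fourier \<alpha> x = (LINT \<xi>|lborel. exp (\<i> * of_real (x \<bullet> \<xi>)) * of_real (exp (- (norm \<xi> powr (2 * \<alpha>)))))"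

lemma norm_square_powr: "(norm \<xi>)\<^sup>2 powr \<alpha> = norm \<xi> powr (2 * \<alpha>)"
  by (cases "norm \<xi> = 0") (auto simp: powr_powr powr_realpow[symmetric] mult.commute simp flip: powr_numeral)

text \<open>The damping is removed by letting \<delta> = 1 / Suc m tend to 0;
  exp(-|\<xi>|^(2\<alpha>)) is itself integrable and serves as majorant.\<close>

lemma good_kernel_stable_fourier:
  assumes \<alpha>: "0 < \<alpha>" "\<alpha> \<le> 1"
  shows "good_kernel 1 (stable_fourier \<alpha> :: 'a::euclidean_space \<Rightarrow> complex)"
proof (rule good_kernel_limit)
  let ?F = "\<lambda>l. exp (- (l powr \<alpha>))"
  let ?u = "\<lambda>m. damped_fourier ?F (1 / real (Suc m)) :: 'a \<Rightarrow> complex"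
  show "good_kernel 1 (?u m)" for m
    using positive_type_exp_powr[OF \<alpha>, where 'a='a] by (simp add: positive_type_def)
  fix x :: 'a
  show "(\<lambda>m. ?u m x) \<longlonglongrightarrow> stable_fourier \<alpha> x"
    unfolding damped_fourier_def stable_fourier_def norm_square_powr
  proof (rule integral_dominated_convergence[where w = "\<lambda>\<xi>. exp (- (norm \<xi> powr (2 * \<alpha>)))"])
    show "integrable lborel (\<lambda>\<xi>::'a. exp (- (norm \<xi> powr (2 * \<alpha>))))"
      using \<alpha> by (intro integrable_exp_neg_norm_powr) simp
    have "(\<lambda>m. complex_of_real (exp (- (norm \<xi> powr (2 * \<alpha>))) * exp (- (1 / real (Suc m)) * (norm \<xi>)\<^sup>2)))
       \<longlonglongrightarrow> complex_of_real (exp (- (norm \<xi> powr (2 * \<alpha>))) * exp (- 0 * (norm \<xi>)\<^sup>2))" for \<xi> :: 'a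
      by (intro tendsto_of_real tendsto_mult tendsto_const tendsto_exp tendsto_minus LIMSEQ_Suc[OF lim_1_over_n])
    then show "AE \<xi> in lborel. (\<lambda>m. exp (\<i> * of_real (x \<bullet> \<xi>)) * complex_of_real (exp (- (norm \<xi> powr (2 * \<alpha>))) * exp (- (1 / real (Suc m)) * (norm \<xi>)\<^sup>2)))
       \<longlonglongrightarrow> exp (\<i> * of_real (x \<bullet> \<xi>)) * complex_of_real (exp (- (norm \<xi> powr (2 * \<alpha>))))"
      by (intro AE_I2 tendsto_mult_left) simp
    show "AE \<xi> in lborel. norm (exp (\<i> * of_real (x \<bullet> \<xi>)) * complex_of_real (exp (- (norm \<xi> powr (2 * \<alpha>))) * exp (- (1 / real (Suc m)) * (norm \<xi>)\<^sup>2)))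
       \<le> exp (- (norm \<xi> powr (2 * \<alpha>)))" for m
      by (rule AE_I2) (simp add: norm_mult mult_le_cancel_left1)
  qed measurable
qed

text \<open>The substitution of \<xi> / s for \<xi> makes time s^(2\<alpha>) disappear from the
  symbol. Thus \<open>s\<close> is a length, and the kernel is the integral-preserving dilate by
  \<open>s\<close> of one fixed profile.\<close>

lemma heat_kernel_eq_stable_fourier:
  fixes x :: "'a::euclidean_space"
  assumes "s > 0"
  shows "heat_kernel \<alpha> (s powr (2 * \<alpha>)) x =
    of_real ((2 * pi) powr (- real DIM('a) / 2)) * (stable_fourier \<alpha> ((1 / s) *\<^sub>R x) / of_real (s ^ DIM('a)))"
proof -
  have "(LINT \<xi>|lborel. exp (\<i> * of_real (x \<bullet> \<xi>)) * complex_of_real (exp (- (s powr (2 * \<alpha>)) * norm \<xi> powr (2 * \<alpha>))))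
    = (\<bar>1 / s\<bar> ^ DIM('a)) *\<^sub>R (LINT \<xi>|lborel. exp (\<i> * of_real (x \<bullet> ((1 / s) *\<^sub>R \<xi>))) * complex_of_real (exp (- (s powr (2 * \<alpha>)) * norm ((1 / s) *\<^sub>R \<xi>) powr (2 * \<alpha>))))"
    using assms by (intro integral_lborel_scale) auto
  also have "(\<lambda>\<xi>. exp (\<i> * of_real (x \<bullet> ((1 / s) *\<^sub>R \<xi>))) * complex_of_real (exp (- (s powr (2 * \<alpha>)) * norm ((1 / s) *\<^sub>R \<xi>) powr (2 * \<alpha>))))
    = (\<lambda>\<xi>. exp (\<i> * of_real (((1 / s) *\<^sub>R x) \<bullet> \<xi>)) * complex_of_real (exp (- (norm \<xi> powr (2 * \<alpha>)))))"
  proof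
    fix \<xi> :: 'a
    have "s powr (2 * \<alpha>) * norm ((1 / s) *\<^sub>R \<xi>) powr (2 * \<alpha>) = (s * norm ((1 / s) *\<^sub>R \<xi>)) powr (2 * \<alpha>)"
      using assms by (subst powr_mult) auto
    also have "s * norm ((1 / s) *\<^sub>R \<xi>) = norm \<xi>" using assms by simp
    finally show "exp (\<i> * of_real (x \<bullet> ((1 / s) *\<^sub>R \<xi>))) * complex_of_real (exp (- (s powr (2 * \<alpha>)) * norm ((1 / s) *\<^sub>R \<xi>) powr (2 * \<alpha>)))
     = exp (\<i> * of_real (((1 / s) *\<^sub>R x) \<bullet> \<xi>)) * complex_of_real (exp (- (norm \<xi> powr (2 * \<alpha>))))"
      by (simp only: inner_scaleR_right inner_scaleR_left mult_minus_left)
  qed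
  finally show ?thesis using assms by (simp add: heat_kernel_def stable_fourier_def power_divide scaleR_conv_of_real)
qed

lemma stable_fourier_tendsto:
  fixes x :: "nat \<Rightarrow> 'a::euclidean_space"
  assumes \<alpha>: "0 < \<alpha>" and "x \<longlonglongrightarrow> y"
  shows "(\<lambda>m. stable_fourier \<alpha> (x m)) \<longlonglongrightarrow> stable_fourier \<alpha> y"
  unfolding stable_fourier_def
proof (rule integral_dominated_convergence[where w = "\<lambda>\<xi>. exp (- (norm \<xi> powr (2 * \<alpha>)))"])
  show "integrable lborel (\<lambda>\<xi>::'a. exp (- (norm \<xi> powr (2 * \<alpha>))))"
    using \<alpha> by (intro integrable_exp_neg_norm_powr) simp
  show "AE \<xi> in lborel. (\<lambda>m. exp (\<i> * of_real (x m \<bullet> \<xi>)) * complex_of_real (exp (- (norm \<xi> powr (2 * \<alpha>)))))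
       \<longlonglongrightarrow> exp (\<i> * of_real (y \<bullet> \<xi>)) * complex_of_real (exp (- (norm \<xi> powr (2 * \<alpha>))))"
    by (intro AE_I2 tendsto_mult tendsto_const tendsto_exp tendsto_of_real tendsto_inner assms)
qed (auto simp: norm_mult)

lemma stable_fourier_0_pos:
  assumes \<alpha>: "0 < \<alpha>"
  shows "Re (stable_fourier \<alpha> (0::'a::euclidean_space)) > 0"
proof -
  let ?g = "\<lambda>\<xi>::'a. exp (- (norm \<xi> powr (2 * \<alpha>)))"
  have int: "integrable lborel ?g" using \<alpha> by (intro integrable_exp_neg_norm_powr) simp
  have "stable_fourier \<alpha> (0::'a) = of_real (LINT \<xi>|lborel. ?g \<xi>)"
    unfolding stable_fourier_def by simp
  moreover have "(LINT \<xi>|lborel. ?g \<xi>) \<noteq> 0"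
  proof
    assume "(LINT \<xi>|lborel. ?g \<xi>) = 0"
    then have "AE \<xi> in lborel. ?g \<xi> = 0"
      using integral_nonneg_eq_0_iff_AE[OF int] by simp
    then have "AE \<xi> in (lborel::'a measure). False" by simp
    then have "emeasure lborel (UNIV :: 'a set) = 0"
      by (subst (asm) AE_iff_measurable[OF _ refl]) auto
    then show False by simp
  qed
  ultimately show ?thesis using integral_nonneg_AE[of ?g lborel] by (simp add: less_le)
qed

lemma stable_fourier_bounded:
  fixes x :: "'a::euclidean_space"
  shows "Re (stable_fourier \<alpha> x) \<le> (LINT \<xi>|(lborel::'a measure). exp (- (norm \<xi> powr (2 * \<alpha>))))"
proof -
  have "Re (stable_fourier \<alpha> x) \<le> norm (stable_fourier \<alpha> x)" by (rule complex_Re_le_cmod)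
  also have "\<dots> \<le> (LINT \<xi>|lborel. norm (exp (\<i> * of_real (x \<bullet> \<xi>)) * complex_of_real (exp (- (norm \<xi> powr (2 * \<alpha>))))))"
    unfolding stable_fourier_def by (rule integral_norm_bound)
  finally show ?thesis by (simp add: norm_mult)
qed

text \<open>If the nonnegative profile had no mass in the unit ball, it would vanish almost
  everywhere there, so its zeros would accumulate at 0. By continuity it would vanish at 0, where it
  is the integral of a positive function.\<close>

lemma stable_fourier_mass_near_0:
  assumes \<alpha>: "0 < \<alpha>" "\<alpha> \<le> 1"
  shows "(\<integral>\<^sup>+x. indicator (ball 0 1) x * ennreal (Re (stable_fourier \<alpha> (x::'a::euclidean_space))) \<partial>lborel) > 0"
proof (rule ccontr)
  have good: "good_kernel 1 (stable_fourier \<alpha> :: 'a \<Rightarrow> complex)" by (rule good_kernel_stable_fourier[OF \<alpha>])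
  then have [measurable]: "(stable_fourier \<alpha> :: 'a \<Rightarrow> complex) \<in> borel_measurable borel" by (simp add: good_kernel_def)
  assume "\<not> ?thesis"
  then have "(\<integral>\<^sup>+x. indicator (ball 0 1) x * ennreal (Re (stable_fourier \<alpha> (x::'a))) \<partial>lborel) = 0" by simp
  then have ae: "AE x in lborel. indicator (ball 0 1) x * ennreal (Re (stable_fourier \<alpha> (x::'a))) = 0"
    by (subst (asm) nn_integral_0_iff_AE) auto
  have "\<exists>x. norm x < 1 / real (Suc m) \<and> Re (stable_fourier \<alpha> (x::'a)) = 0" for m
  proof (rule ccontr)
    assume no: "\<not> ?thesis"
    have "AE x in lborel. x \<notin> ball (0::'a) (1 / real (Suc m))"
      using ae
    proof eventually_elim
      fix x :: 'a assume x: "indicator (ball 0 1) x * ennreal (Re (stable_fourier \<alpha> x)) = 0"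
      show "x \<notin> ball 0 (1 / real (Suc m))"
      proof
        assume b: "x \<in> ball 0 (1 / real (Suc m))"
        have "1 / real (Suc m) \<le> 1" by simp
        then have "x \<in> ball 0 1" using b unfolding mem_ball_0 by linarith
        then have "Re (stable_fourier \<alpha> x) \<le> 0" using x by (simp add: ennreal_eq_0_iff)
        then have "Re (stable_fourier \<alpha> x) = 0" using good by (auto simp: good_kernel_def intro: antisym)
        then show False using no b by auto
      qed
    qed
    then have "emeasure lborel (ball (0::'a) (1 / real (Suc m))) = 0"
      by (drule_tac emeasure_eq_0_AE) (simp del: mem_ball mem_ball_0 of_nat_Suc)
    moreover have "unit_ball_vol DIM('a) * (1 / real (Suc m)) ^ DIM('a) > 0" by (intro mult_pos_pos zero_less_power) auto
    ultimately show False by (simp add: emeasure_lborel_ball ennreal_eq_0_iff del: of_nat_Suc)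
  qed
  then obtain x :: "nat \<Rightarrow> 'a" where x: "\<And>m. norm (x m) < 1 / real (Suc m)" "\<And>m. Re (stable_fourier \<alpha> (x m)) = 0"
    by metis
  have "x \<longlonglongrightarrow> 0"
    using x(1) by (intro Lim_null_comparison[OF _ LIMSEQ_Suc[OF lim_1_over_n]]) (auto intro!: always_eventually less_imp_le simp del: of_nat_Suc)
  from tendsto_Re[OF stable_fourier_tendsto[OF \<alpha>(1) this]] have "Re (stable_fourier \<alpha> (0::'a)) = 0"
    by (simp add: x LIMSEQ_const_iff)
  then show False using stable_fourier_0_pos[OF \<alpha>(1), where 'a='a] by simp
qed

lemma heat_kernel_profile:
  assumes \<alpha>: "0 < \<alpha>" "\<alpha> \<le> 1"
  obtains k :: "'a::euclidean_space \<Rightarrow> real" and C :: real where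
    "k \<in> borel_measurable borel" "\<And>x. k x \<ge> 0" "C > 0" "\<And>x. k x \<le> C" "\<And>x. norm x ^ DIM('a) * k x \<le> C"
    "(\<integral>\<^sup>+x. ennreal (k x) \<partial>lborel) \<le> ennreal C"
    "(\<integral>\<^sup>+x. indicator (ball 0 1) x * ennreal (k x) \<partial>lborel) > 0"
    "\<And>s x. s > 0 \<Longrightarrow> heat_kernel \<alpha> (s powr (2 * \<alpha>)) x = of_real (k ((1 / s) *\<^sub>R x) / s ^ DIM('a))"
proof -
  define c where "c = (2 * pi) powr (- real DIM('a) / 2)"
  define k where "k = (\<lambda>x::'a. c * Re (stable_fourier \<alpha> x))"
  have c: "c > 0" by (simp add: c_def)
  have good: "good_kernel 1 (stable_fourier \<alpha> :: 'a \<Rightarrow> complex)" by (rule good_kernel_stable_fourier[OF \<alpha>])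
  then have [measurable]: "(stable_fourier \<alpha> :: 'a \<Rightarrow> complex) \<in> borel_measurable borel" by (simp add: good_kernel_def)
  let ?A = "(LINT \<xi>|(lborel::'a measure). exp (- (norm \<xi> powr (2 * \<alpha>))))"
  let ?B = "(2 * sqrt pi) ^ DIM('a) * fact DIM('a) :: real"
  have "(\<integral>\<^sup>+(y::'a). ennreal (exp (- (norm y)\<^sup>2)) \<partial>lborel) < \<infinity>"
    using integrable_gaussian[OF zero_less_one, where 'a='a] by (subst (asm) integrable_iff_bounded) auto
  moreover have Dle: "(\<integral>\<^sup>+x. ennreal (Re (stable_fourier \<alpha> (x::'a))) \<partial>lborel) \<le>
      ennreal ((2 * sqrt pi) ^ DIM('a)) * (\<integral>\<^sup>+(y::'a). ennreal (exp (- (norm y)\<^sup>2)) \<partial>lborel)"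
    using good unfolding good_kernel_def by simp
  ultimately have "(\<integral>\<^sup>+x. ennreal (Re (stable_fourier \<alpha> (x::'a))) \<partial>lborel) < \<infinity>"
    by (auto simp: ennreal_mult_less_top intro: le_less_trans)
  then obtain D where D: "D \<ge> 0" "(\<integral>\<^sup>+x. ennreal (Re (stable_fourier \<alpha> (x::'a))) \<partial>lborel) = ennreal D"
    by (cases "\<integral>\<^sup>+x. ennreal (Re (stable_fourier \<alpha> (x::'a))) \<partial>lborel") auto
  define C where "C = c * (\<bar>?A\<bar> + ?B + D)"
  have B: "?B > 0" by simp
  have le: "c * \<bar>?A\<bar> \<le> C" "c * ?B \<le> C" "c * D \<le> C"
    using c D(1) B unfolding C_def by (auto intro!: mult_left_mono)
  show ?thesis
  proof (rule that[of k C])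
    show "k \<in> borel_measurable borel" by (simp add: k_def)
    show "k x \<ge> 0" for x using good c by (auto simp: k_def good_kernel_def)
    have "0 < c * ?B" using c B by (rule mult_pos_pos)
    then show "C > 0" using le(2) by linarith
    show "k x \<le> C" for x
    proof -
      have "c * Re (stable_fourier \<alpha> x) \<le> c * \<bar>?A\<bar>"
        using c order_trans[OF stable_fourier_bounded[of \<alpha> x] abs_ge_self] by (intro mult_left_mono) auto
      then show ?thesis using le(1) unfolding k_def by (rule order_trans)
    qed
    show "norm x ^ DIM('a) * k x \<le> C" for x
    proof -
      have "norm x ^ DIM('a) * Re (stable_fourier \<alpha> x) \<le> ?B" using good by (simp add: good_kernel_def)
      from mult_left_mono[OF this, of c] have "c * (norm x ^ DIM('a) * Re (stable_fourier \<alpha> x)) \<le> C"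
        using c le(2) by linarith
      then show ?thesis by (simp add: k_def mult_ac)
    qed
    have "(\<integral>\<^sup>+x. ennreal (k x) \<partial>lborel) = ennreal c * ennreal D"
      unfolding k_def D(2)[symmetric] using c by (subst nn_integral_cmult[symmetric]) (auto simp: ennreal_mult')
    then show "(\<integral>\<^sup>+x. ennreal (k x) \<partial>lborel) \<le> ennreal C"
      using c D(1) le(3) by (simp add: ennreal_mult[symmetric] ennreal_leI)
    have "(\<integral>\<^sup>+x. indicator (ball 0 1) x * ennreal (k x) \<partial>lborel) =
       ennreal c * (\<integral>\<^sup>+x. indicator (ball 0 1) x * ennreal (Re (stable_fourier \<alpha> (x::'a))) \<partial>lborel)"
      unfolding k_def using c by (subst nn_integral_cmult[symmetric]) (auto simp: ennreal_mult' mult_ac)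
    then show "(\<integral>\<^sup>+x. indicator (ball 0 1) x * ennreal (k x) \<partial>lborel) > 0"
      using c stable_fourier_mass_near_0[OF \<alpha>, where 'a='a] by (simp add: ennreal_zero_less_mult_iff)
    have im: "stable_fourier \<alpha> x = of_real (Re (stable_fourier \<alpha> x))" for x :: 'a
      using good by (auto simp: good_kernel_def complex_eq_iff)
    show "heat_kernel \<alpha> (s powr (2 * \<alpha>)) x = of_real (k ((1 / s) *\<^sub>R x) / s ^ DIM('a))" if "s > 0" for s and x :: 'a
      using that by (subst heat_kernel_eq_stable_fourier, simp, subst im) (simp add: k_def c_def)
  qed
qed

text \<open>Joint measurability in (t, x) makes the superlevel sets measurable for \<mu>. The
  convolution is a parameter integral of a jointly measurable function, and such an integral is
  measurable whether or not it converges.\<close>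

lemma borel_measurable_caloric_ext:
  fixes v :: "'a::euclidean_space \<Rightarrow> real"
  assumes [measurable]: "v \<in> borel_measurable borel"
  shows "caloric_ext \<alpha> v \<in> borel_measurable borel"
proof -
  have [measurable]: "(\<lambda>p. heat_kernel \<alpha> (fst p) (snd p :: 'a)) \<in> borel_measurable (borel \<Otimes>\<^sub>M borel)"
    unfolding heat_kernel_def by measurable
  have [measurable]: "(\<lambda>z. heat_kernel \<alpha> (fst (fst z) powr (2 * \<alpha>)) (snd (fst z) - snd z :: 'a)) \<in> borel_measurable ((borel \<Otimes>\<^sub>M borel) \<Otimes>\<^sub>M lborel)"
    using measurable_compose[of "\<lambda>z. (fst (fst z) powr (2 * \<alpha>), snd (fst z) - snd z :: 'a)" "(borel \<Otimes>\<^sub>M borel) \<Otimes>\<^sub>M lborel" "borel \<Otimes>\<^sub>M borel" "\<lambda>p. heat_kernel \<alpha> (fst p) (snd p :: 'a)" borel]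
    by simp
  have "(\<lambda>p. LINT y|lborel. heat_kernel \<alpha> (fst p powr (2 * \<alpha>)) (snd p - y :: 'a) * complex_of_real (v y)) \<in> borel_measurable (borel \<Otimes>\<^sub>M borel)"
    by (rule lborel.borel_measurable_lebesgue_integral) (simp add: split_beta')
  then show ?thesis unfolding caloric_ext_def heat_semigroup_def borel_prod by (simp add: split_beta')
qed

section \<open>Iterated differences and the seminorm\<close>


lemma funpow_fdiff_expansion:
  "(fdiff h ^^ k) f x = (\<Sum>i\<le>k. (-1) ^ (k - i) * real (k choose i) * f (x + real i *\<^sub>R h))"
proof (induction k arbitrary: x)
  case (Suc k)
  let ?c = "\<lambda>k i. (-1) ^ (k - i) * real (k choose i)"
  have "(fdiff h ^^ Suc k) f x = (fdiff h ^^ k) f (x + h) - (fdiff h ^^ k) f x"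
    by (simp add: fdiff_def)
  also have "(fdiff h ^^ k) f (x + h) = (\<Sum>i\<le>k. ?c k i * f (x + real (Suc i) *\<^sub>R h))"
    unfolding Suc by (simp add: algebra_simps)
  also have "(fdiff h ^^ k) f x = (-1) ^ k * f x + (\<Sum>i<k. ?c k (Suc i) * f (x + real (Suc i) *\<^sub>R h))"
    unfolding Suc by (subst sum.atMost_shift) simp
  also have "(\<Sum>i<k. ?c k (Suc i) * f (x + real (Suc i) *\<^sub>R h)) = (\<Sum>i\<le>k. ?c k (Suc i) * f (x + real (Suc i) *\<^sub>R h))"
    by (rule sum.mono_neutral_left) (auto simp: not_less)
  finally have "(fdiff h ^^ Suc k) f x = (\<Sum>i\<le>k. (?c k i - ?c k (Suc i)) * f (x + real (Suc i) *\<^sub>R h)) - (-1) ^ k * f x"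
    by (simp add: sum_subtractf left_diff_distrib)
  also have "(\<Sum>i\<le>k. (?c k i - ?c k (Suc i)) * f (x + real (Suc i) *\<^sub>R h)) = (\<Sum>i\<le>k. ?c (Suc k) (Suc i) * f (x + real (Suc i) *\<^sub>R h))"
  proof (rule sum.cong[OF refl])
    fix i assume "i \<in> {..k}"
    have "?c k i - ?c k (Suc i) = ?c (Suc k) (Suc i)"
    proof (cases "i = k")
      case False
      with \<open>i \<in> {..k}\<close> obtain m where "k - i = Suc m" "k - Suc i = m" by (metis Suc_diff_Suc atMost_iff le_neq_implies_less)
      then show ?thesis by (simp add: algebra_simps)
    qed simp
    then show "(?c k i - ?c k (Suc i)) * f (x + real (Suc i) *\<^sub>R h) = ?c (Suc k) (Suc i) * f (x + real (Suc i) *\<^sub>R h)" by simp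
  qed
  also have "\<dots> - (-1) ^ k * f x = (\<Sum>i\<le>Suc k. ?c (Suc k) i * f (x + real i *\<^sub>R h))"
    by (subst sum.atMost_Suc_shift) simp
  finally show ?case .
qed simp

lemma borel_measurable_funpow_fdiff[measurable (raw)]:
  fixes f :: "'a::euclidean_space \<Rightarrow> real"
  assumes [measurable]: "f \<in> borel_measurable borel" "h \<in> borel_measurable M" "g \<in> borel_measurable M"
  shows "(\<lambda>z. (fdiff (h z) ^^ k) f (g z)) \<in> borel_measurable M"
  unfolding funpow_fdiff_expansion by measurable

lemma funpow_fdiff_lincomb:
  "(fdiff h ^^ k) (\<lambda>x. a * f x + b * g x) y = a * (fdiff h ^^ k) f y + b * (fdiff h ^^ k) g y"
  unfolding funpow_fdiff_expansion by (simp add: sum_distrib_left sum.distrib[symmetric] algebra_simps)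

lemma funpow_fdiff_add:
  "(fdiff h ^^ k) (\<lambda>x. f x + g x) y = (fdiff h ^^ k) f y + (fdiff h ^^ k) g y"
  using funpow_fdiff_lincomb[of k h 1 f 1 g y] by simp

lemma funpow_fdiff_scaling:
  assumes "r \<noteq> 0"
  shows "(fdiff h ^^ k) (\<lambda>x. f ((1 / r) *\<^sub>R (x - a))) y = (fdiff ((1 / r) *\<^sub>R h) ^^ k) f ((1 / r) *\<^sub>R (y - a))"
  unfolding funpow_fdiff_expansion by (simp add: algebra_simps)

lemma W_norm_altdef:
  "W_norm \<beta> f = (\<integral>\<^sup>+h. (\<integral>\<^sup>+x. ennreal \<bar>(fdiff h ^^ (1 + nat \<lfloor>\<beta>\<rfloor>)) f x\<bar> \<partial>lborel)
     / ennreal (norm h powr (real DIM('a::euclidean_space) + \<beta>)) \<partial>(lborel::'a measure))"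
  by (simp add: W_norm_def)

lemma W_norm_add_le:
  fixes f g :: "'a::euclidean_space \<Rightarrow> real"
  assumes [measurable]: "f \<in> borel_measurable borel" "g \<in> borel_measurable borel"
  shows "W_norm \<beta> (\<lambda>x. f x + g x) \<le> W_norm \<beta> f + W_norm \<beta> g"
proof -
  define k where "k = 1 + nat \<lfloor>\<beta>\<rfloor>"
  let ?I = "\<lambda>f h. (\<integral>\<^sup>+x. ennreal \<bar>(fdiff h ^^ k) f x\<bar> \<partial>lborel)"
  let ?w = "\<lambda>h::'a. ennreal (norm h powr (real DIM('a) + \<beta>))"
  have "?I (\<lambda>x. f x + g x) h \<le> ?I f h + ?I g h" for h
    by (subst nn_integral_add[symmetric])
      (auto intro!: nn_integral_mono simp: funpow_fdiff_add ennreal_plus[symmetric] ennreal_leI simp del: ennreal_plus)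
  then have "W_norm \<beta> (\<lambda>x. f x + g x) \<le> (\<integral>\<^sup>+h. ?I f h / ?w h + ?I g h / ?w h \<partial>lborel)"
    unfolding W_norm_altdef k_def[symmetric]
    by (auto intro!: nn_integral_mono divide_right_mono_ennreal simp: add_divide_distrib_ennreal[symmetric])
  also have "\<dots> = W_norm \<beta> f + W_norm \<beta> g"
    unfolding W_norm_altdef k_def[symmetric] by (rule nn_integral_add) measurable
  finally show ?thesis .
qed

lemma W_norm_0: "W_norm \<beta> (\<lambda>_::'a::euclidean_space. 0) = 0"
proof -
  have "(fdiff h ^^ k) (\<lambda>_. 0) y = 0" for h k and y :: 'a
    by (simp add: funpow_fdiff_expansion)
  then show ?thesis by (simp only: W_norm_altdef) simp
qed

text \<open>The change of variables gives r^n in x and again in h, and the weight gives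
  r^(-n-\<beta>). The resulting degree n - \<beta> is the power of the radius that a ball costs in
  capacity.\<close>

lemma W_norm_scaling:
  fixes f :: "'a::euclidean_space \<Rightarrow> real"
  assumes [measurable]: "f \<in> borel_measurable borel" and r: "r > 0"
  shows "W_norm \<beta> (\<lambda>x. f ((1 / r) *\<^sub>R (x - a))) = ennreal (r powr (real DIM('a) - \<beta>)) * W_norm \<beta> f"
proof -
  define k where "k = 1 + nat \<lfloor>\<beta>\<rfloor>"
  let ?n = "real DIM('a)"
  let ?I = "\<lambda>f h. (\<integral>\<^sup>+x. ennreal \<bar>(fdiff h ^^ k) f x\<bar> \<partial>lborel)"
  have I: "?I (\<lambda>x. f ((1 / r) *\<^sub>R (x - a))) h = ennreal (r ^ DIM('a)) * ?I f ((1 / r) *\<^sub>R h)" for h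
  proof -
    have "?I (\<lambda>x. f ((1 / r) *\<^sub>R (x - a))) h = (\<integral>\<^sup>+x. ennreal \<bar>(fdiff ((1 / r) *\<^sub>R h) ^^ k) f ((1 / r) *\<^sub>R (x - a))\<bar> \<partial>lborel)"
      using r by (subst funpow_fdiff_scaling) auto
    also have "\<dots> = ennreal (\<bar>r\<bar> ^ DIM('a)) * (\<integral>\<^sup>+x. ennreal \<bar>(fdiff ((1 / r) *\<^sub>R h) ^^ k) f ((1 / r) *\<^sub>R ((a + r *\<^sub>R x) - a))\<bar> \<partial>lborel)"
      using r by (intro nn_integral_lborel_affine) auto
    finally show ?thesis using r by simp
  qed
  have "W_norm \<beta> (\<lambda>x. f ((1 / r) *\<^sub>R (x - a))) =
     (\<integral>\<^sup>+h. ennreal (r ^ DIM('a)) * ?I f ((1 / r) *\<^sub>R h) / ennreal (norm h powr (?n + \<beta>)) \<partial>lborel)"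
    unfolding W_norm_altdef k_def[symmetric] I ..
  also have "\<dots> = ennreal (\<bar>r\<bar> ^ DIM('a)) * (\<integral>\<^sup>+h. ennreal (r ^ DIM('a)) * ?I f ((1 / r) *\<^sub>R (0 + r *\<^sub>R h)) / ennreal (norm (0 + r *\<^sub>R h) powr (?n + \<beta>)) \<partial>lborel)"
    using r by (intro nn_integral_lborel_affine) auto
  also have "(\<integral>\<^sup>+(h::'a). ennreal (r ^ DIM('a)) * ?I f ((1 / r) *\<^sub>R (0 + r *\<^sub>R h)) / ennreal (norm (0 + r *\<^sub>R h) powr (?n + \<beta>)) \<partial>lborel)
     = (\<integral>\<^sup>+(h::'a). ennreal (r powr (- \<beta>)) * (?I f h / ennreal (norm h powr (?n + \<beta>))) \<partial>lborel)"
  proof (rule nn_integral_cong_AE)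
    \<comment> \<open>The weight vanishes at h = 0, where splitting the reciprocal of a product is
      unsafe in \<open>ennreal\<close>; a single point is negligible.\<close>
    have "AE h in lborel. h \<noteq> (0::'a)" by (rule AE_lborel_singleton)
    then show "AE h in lborel. ennreal (r ^ DIM('a)) * ?I f ((1 / r) *\<^sub>R (0 + r *\<^sub>R h)) / ennreal (norm (0 + r *\<^sub>R h) powr (?n + \<beta>))
       = ennreal (r powr (- \<beta>)) * (?I f h / ennreal (norm h powr (?n + \<beta>)))"
    proof eventually_elim
      fix h :: 'a assume h: "h \<noteq> 0"
      have 1: "norm (0 + r *\<^sub>R h) powr (?n + \<beta>) = r powr (?n + \<beta>) * norm h powr (?n + \<beta>)"
        using r by (simp add: powr_mult)
      have "r ^ DIM('a) / r powr (?n + \<beta>) = r powr (- \<beta>)"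
        using r by (simp add: powr_realpow[symmetric] powr_diff[symmetric])
      then have 2: "ennreal (r ^ DIM('a)) / ennreal (r powr (?n + \<beta>)) = ennreal (r powr (- \<beta>))"
        using r by (simp add: divide_ennreal)
      have "ennreal (r ^ DIM('a)) * X / ennreal (r powr (?n + \<beta>) * norm h powr (?n + \<beta>)) =
         ennreal (r ^ DIM('a)) / ennreal (r powr (?n + \<beta>)) * (X / ennreal (norm h powr (?n + \<beta>)))" for X
        using h r by (simp add: ennreal_mult divide_ennreal_def ennreal_inverse_mult less_top[symmetric] mult_ac)
      then show "ennreal (r ^ DIM('a)) * ?I f ((1 / r) *\<^sub>R (0 + r *\<^sub>R h)) / ennreal (norm (0 + r *\<^sub>R h) powr (?n + \<beta>))
       = ennreal (r powr (- \<beta>)) * (?I f h / ennreal (norm h powr (?n + \<beta>)))"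
        unfolding 1 2 using r by simp
    qed
  qed
  also have "\<dots> = ennreal (r powr (- \<beta>)) * W_norm \<beta> f"
    unfolding W_norm_altdef k_def[symmetric] by (rule nn_integral_cmult) measurable
  also have "ennreal (\<bar>r\<bar> ^ DIM('a)) * (ennreal (r powr (- \<beta>)) * W_norm \<beta> f) = ennreal (r ^ DIM('a) * r powr (- \<beta>)) * W_norm \<beta> f"
    using r by (simp add: ennreal_mult mult.assoc)
  also have "r ^ DIM('a) * r powr (- \<beta>) = r powr (?n - \<beta>)"
    using r by (simp add: powr_realpow[symmetric] powr_add[symmetric])
  finally show ?thesis .
qed

section \<open>Test functions and the capacity of unions of balls\<close>


lemma Ck_SucI:
  assumes "\<And>x. (f has_derivative D x) (at x)" "\<And>v. Ck k (\<lambda>x. D x v)"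
  shows "Ck (Suc k) f"
proof -
  have "frechet_derivative f (at x) = D x" for x
    using frechet_derivative_at[OF assms(1)] by simp
  then show ?thesis using assms by (auto simp: differentiable_def)
qed

lemma Ck_SucD:
  assumes "Ck (Suc k) f"
  shows "(f has_derivative frechet_derivative f (at x)) (at x)" "Ck k (\<lambda>x. frechet_derivative f (at x) v)"
  using assms by (auto simp: frechet_derivative_works)

lemma Ck_add: "Ck k f \<Longrightarrow> Ck k g \<Longrightarrow> Ck k (\<lambda>x. f x + g x)"
proof (induction k arbitrary: f g)
  case 0 then show ?case by (auto intro: continuous_on_add)
next
  case (Suc k)
  show ?case
    by (rule Ck_SucI[OF has_derivative_add[OF Ck_SucD(1)[OF Suc.prems(1)] Ck_SucD(1)[OF Suc.prems(2)]]])
      (intro Suc.IH Ck_SucD[OF Suc.prems(1)] Ck_SucD[OF Suc.prems(2)])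
qed

lemma Ck_cmult: "Ck k f \<Longrightarrow> Ck k (\<lambda>x. c * f x)"
proof (induction k arbitrary: f)
  case 0 then show ?case by (auto intro: continuous_on_mult_left)
next
  case (Suc k)
  show ?case
    by (rule Ck_SucI[OF has_derivative_mult_right[OF Ck_SucD(1)[OF Suc.prems]]])
      (intro Suc.IH Ck_SucD[OF Suc.prems])
qed

lemma Ck_affine: "Ck k f \<Longrightarrow> Ck k (\<lambda>x. f (c *\<^sub>R (x - a)))"
proof (induction k arbitrary: f)
  case 0
  then have "continuous_on UNIV f" by simp
  then show ?case by (auto intro!: continuous_on_compose2[of UNIV f] continuous_intros)
next
  case (Suc k)
  have "((\<lambda>x. f (c *\<^sub>R (x - a))) has_derivative (\<lambda>v. frechet_derivative f (at (c *\<^sub>R (x - a))) (c *\<^sub>R v))) (at x)" for x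
    by (rule has_derivative_compose[of "\<lambda>x. c *\<^sub>R (x - a)" "\<lambda>v. c *\<^sub>R v", OF _ Ck_SucD(1)[OF Suc.prems]])
      (auto intro!: derivative_eq_intros)
  then show ?case by (rule Ck_SucI) (rule Suc.IH[OF Ck_SucD(2)[OF Suc.prems]])
qed

text \<open>Smoothness through an invariant: a class of functions closed under taking directional
  derivatives consists of smooth functions. It spares explicit formulas for the higher derivatives
  of the bump function.\<close>

lemma Ck_coinduct:
  assumes S: "\<And>f. S f \<Longrightarrow> \<exists>D. (\<forall>x. (f has_derivative D x) (at x)) \<and> (\<forall>v. S (\<lambda>x. D x v))" and "S f"
  shows "Ck k f"
  using \<open>S f\<close>
proof (induction k arbitrary: f)
  case 0
  with S obtain D where "\<forall>x. (f has_derivative D x) (at x)" by blast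
  then show ?case by (auto intro!: continuous_at_imp_continuous_on has_derivative_continuous)
next
  case (Suc k)
  with S obtain D where "\<forall>x. (f has_derivative D x) (at x)" "\<forall>v. S (\<lambda>x. D x v)" by blast
  then show ?case by (intro Ck_SucI[of f D] Suc.IH) auto
qed

lemma test_functions_continuous: "f \<in> test_functions \<Longrightarrow> continuous_on UNIV f"
  unfolding test_functions_def using Ck.simps(1) by blast

lemma test_functions_measurable: "f \<in> test_functions \<Longrightarrow> f \<in> borel_measurable borel"
  by (intro borel_measurable_continuous_onI test_functions_continuous)

lemma test_functions_support:
  fixes f :: "'a::euclidean_space \<Rightarrow> real"
  assumes "f \<in> test_functions" obtains R where "R > 0" "\<And>x. norm x > R \<Longrightarrow> f x = 0"
proof -
  have "bounded {x. f x \<noteq> 0}"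
    using assms by (auto simp: test_functions_def dest: compact_imp_bounded intro: bounded_subset[OF _ closure_subset])
  then obtain R where R: "R > 0" "\<forall>x\<in>{x. f x \<noteq> 0}. norm x \<le> R" unfolding bounded_pos by auto
  then show ?thesis using that[of R] by force
qed

lemma test_functionsI:
  fixes f :: "'a::euclidean_space \<Rightarrow> real"
  assumes "\<And>k. Ck k f" "\<And>x. norm x > R \<Longrightarrow> f x = 0"
  shows "f \<in> test_functions"
proof -
  have "{x. f x \<noteq> 0} \<subseteq> cball 0 R" using assms(2) by (force simp: not_less[symmetric])
  then have "bounded {x. f x \<noteq> 0}" by (rule bounded_subset[OF bounded_cball])
  then show ?thesis using assms(1) by (simp add: test_functions_def)
qed

lemma test_functions_add:
  assumes f: "f \<in> test_functions" and g: "g \<in> test_functions"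
  shows "(\<lambda>x. f x + g x) \<in> test_functions"
proof -
  obtain R where R: "\<And>x. norm x > R \<Longrightarrow> f x = 0" using test_functions_support[OF f] by blast
  obtain R' where R': "\<And>x. norm x > R' \<Longrightarrow> g x = 0" using test_functions_support[OF g] by blast
  show ?thesis
    by (rule test_functionsI[where R = "max R R'"]) (use f g R R' in \<open>auto intro: Ck_add simp: test_functions_def\<close>)
qed

lemma test_functions_cmult:
  assumes f: "f \<in> test_functions"
  shows "(\<lambda>x. c * f x) \<in> test_functions"
proof -
  obtain R where R: "\<And>x. norm x > R \<Longrightarrow> f x = 0" using test_functions_support[OF f] by blast
  show ?thesis
    by (rule test_functionsI[where R = R]) (use f R in \<open>auto intro: Ck_cmult simp: test_functions_def\<close>)
qed

lemma test_functions_0: "(\<lambda>_. 0) \<in> test_functions"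
proof (rule test_functionsI)
  show "Ck k (\<lambda>_. 0)" for k
  proof (induction k)
    case (Suc k)
    show ?case by (rule Ck_SucI[where D = "\<lambda>_ _. 0"]) (use Suc in auto)
  qed simp
qed simp

lemma test_functions_scaling:
  fixes f :: "'a::euclidean_space \<Rightarrow> real"
  assumes f: "f \<in> test_functions" and r: "r > 0"
  shows "(\<lambda>x. f ((1 / r) *\<^sub>R (x - a))) \<in> test_functions"
proof -
  obtain R where R: "\<And>x. norm x > R \<Longrightarrow> f x = 0" using test_functions_support[OF f] by blast
  show ?thesis
  proof (rule test_functionsI[where R = "norm a + r * R"])
    show "Ck k (\<lambda>x. f ((1 / r) *\<^sub>R (x - a)))" for k using f by (intro Ck_affine) (simp add: test_functions_def)
    fix x :: 'a assume "norm x > norm a + r * R"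
    then have "r * R < norm (x - a)" using norm_triangle_ineq2[of x a] by linarith
    moreover have "norm ((1 / r) *\<^sub>R (x - a)) = norm (x - a) / r" using r by (simp only: norm_scaleR) simp
    ultimately have "R < norm ((1 / r) *\<^sub>R (x - a))" using r by (simp only: pos_less_divide_eq mult.commute)
    then show "f ((1 / r) *\<^sub>R (x - a)) = 0" by (rule R)
  qed
qed

lemma test_functions_derivative:
  fixes f :: "'a::euclidean_space \<Rightarrow> real"
  assumes f: "f \<in> test_functions"
  shows "(f has_derivative frechet_derivative f (at x)) (at x)"
    and "(\<lambda>x. frechet_derivative f (at x) v) \<in> test_functions"
proof -
  have C: "Ck (Suc k) f" for k using f by (auto simp: test_functions_def)
  show d: "(f has_derivative frechet_derivative f (at x)) (at x)" for x using Ck_SucD(1)[OF C] .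
  obtain R where R: "\<And>x. norm x > R \<Longrightarrow> f x = 0" using test_functions_support[OF f] by blast
  show "(\<lambda>x. frechet_derivative f (at x) v) \<in> test_functions"
  proof (rule test_functionsI[where R = R])
    show "Ck k (\<lambda>x. frechet_derivative f (at x) v)" for k using Ck_SucD(2)[OF C] .
    fix x :: 'a assume x: "norm x > R"
    have "open {x :: 'a. R < norm x}" by (intro open_Collect_less continuous_intros)
    then have "(f has_derivative (\<lambda>_. 0)) (at x)"
      using x R by (intro has_derivative_transform_within_open[of "\<lambda>_. 0" "\<lambda>_. 0" x UNIV "{x. R < norm x}" f]) auto
    then have "frechet_derivative f (at x) = (\<lambda>_. 0)" using frechet_derivative_at by metis
    then show "frechet_derivative f (at x) v = 0" by simp
  qed
qed

lemma test_functions_bounded: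
  fixes f :: "'a::euclidean_space \<Rightarrow> real"
  assumes f: "f \<in> test_functions"
  obtains C where "C > 0" "\<And>x. \<bar>f x\<bar> \<le> C"
proof -
  obtain R where R: "R > 0" "\<And>x. norm x > R \<Longrightarrow> f x = 0" using test_functions_support[OF f] by blast
  have "bounded (f ` cball 0 R)"
    using test_functions_continuous[OF f] by (intro compact_imp_bounded compact_continuous_image) (auto intro: continuous_on_subset)
  then obtain C where C: "C > 0" "\<forall>y\<in>f ` cball 0 R. norm y \<le> C" unfolding bounded_pos by auto
  have "\<bar>f x\<bar> \<le> C" for x using C R(2)[of x] by (cases "norm x > R") auto
  then show ?thesis using that C(1) by blast
qed

section \<open>Test functions have finite seminorm\<close>

lemma funpow_fdiff_sum:
  "finite I \<Longrightarrow> (fdiff h ^^ k) (\<lambda>x. \<Sum>i\<in>I. a i * f i x) y = (\<Sum>i\<in>I. a i * (fdiff h ^^ k) (f i) y)"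
proof (induction I rule: finite_induct)
  case empty show ?case by (simp add: funpow_fdiff_expansion)
next
  case (insert j I)
  then show ?case using funpow_fdiff_lincomb[of k h "a j" "f j" 1 "\<lambda>x. \<Sum>i\<in>I. a i * f i x" y] by simp
qed

text \<open>By the mean value theorem, a difference with step h equals the directional derivative
  along h at an intermediate point; the remaining k differences fall on that derivative. Its
  direction changes with h, so it is expanded in the basis, where finitely many induction constants
  are uniform in h.\<close>

lemma funpow_fdiff_test_bound:
  fixes f :: "'a::euclidean_space \<Rightarrow> real"
  assumes "f \<in> test_functions"
  shows "\<exists>C\<ge>0. \<forall>h x. \<bar>(fdiff h ^^ k) f x\<bar> \<le> C * norm h ^ k"
  using assms
proof (induction k arbitrary: f)
  case 0
  then obtain C where "C > 0" "\<And>x. \<bar>f x\<bar> \<le> C" using test_functions_bounded by blast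
  then show ?case by (auto intro!: exI[of _ C])
next
  case (Suc k)
  let ?D = "\<lambda>x v. frechet_derivative f (at x) v"
  have "\<forall>b. \<exists>C\<ge>0. \<forall>h x. \<bar>(fdiff h ^^ k) (\<lambda>x. ?D x b) x\<bar> \<le> C * norm h ^ k"
    using Suc.IH[OF test_functions_derivative(2)[OF Suc.prems]] by blast
  then obtain C where C: "\<And>b. C b \<ge> 0" "\<And>b h x. \<bar>(fdiff h ^^ k) (\<lambda>x. ?D x b) x\<bar> \<le> C b * norm h ^ k" by metis
  have lin: "linear (?D x)" for x
    using test_functions_derivative(1)[OF Suc.prems] by (rule has_derivative_linear)
  have "\<bar>(fdiff h ^^ Suc k) f x\<bar> \<le> (\<Sum>b\<in>Basis. C b) * norm h ^ Suc k" for h x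
  proof -
    have ddec: "?D y h = (\<Sum>b\<in>Basis. (h \<bullet> b) * ?D y b)" for y
    proof -
      have "?D y (\<Sum>b\<in>Basis. (h \<bullet> b) *\<^sub>R b) = (\<Sum>b\<in>Basis. (h \<bullet> b) * ?D y b)"
        by (simp add: linear_sum[OF lin] linear_scale[OF lin] del: euclidean_representation)
      then show ?thesis by (simp only: euclidean_representation)
    qed
    define g where "g t = (fdiff h ^^ k) f (x + t *\<^sub>R h)" for t
    have gd: "(g has_real_derivative (fdiff h ^^ k) (\<lambda>x. ?D x h) (x + t *\<^sub>R h)) (at t)" for t
    proof -
      have "((\<lambda>t. f (x + t *\<^sub>R h + real i *\<^sub>R h)) has_real_derivative ?D (x + t *\<^sub>R h + real i *\<^sub>R h) h) (at t)" for i
      proof -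
        have "((\<lambda>t. f (x + t *\<^sub>R h + real i *\<^sub>R h)) has_derivative (\<lambda>s. ?D (x + t *\<^sub>R h + real i *\<^sub>R h) (s *\<^sub>R h))) (at t)"
          by (rule has_derivative_compose[of "\<lambda>t. x + t *\<^sub>R h + real i *\<^sub>R h" "\<lambda>s. s *\<^sub>R h", OF _ test_functions_derivative(1)[OF Suc.prems]])
            (auto intro!: derivative_eq_intros)
        then show ?thesis
          by (simp add: has_field_derivative_def linear_scale[OF lin] mult_commute_abs)
      qed
      then show ?thesis
        unfolding g_def funpow_fdiff_expansion by (intro DERIV_sum DERIV_cmult)
    qed
    obtain z where "g 1 - g 0 = (1 - 0) * (fdiff h ^^ k) (\<lambda>x. ?D x h) (x + z *\<^sub>R h)"
      using MVT2[of 0 1 g "\<lambda>t. (fdiff h ^^ k) (\<lambda>x. ?D x h) (x + t *\<^sub>R h)", OF zero_less_one gd] by blast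
    then have "(fdiff h ^^ Suc k) f x = (fdiff h ^^ k) (\<lambda>x. ?D x h) (x + z *\<^sub>R h)"
      by (simp add: g_def fdiff_def)
    also have "\<dots> = (\<Sum>b\<in>Basis. (h \<bullet> b) * (fdiff h ^^ k) (\<lambda>x. ?D x b) (x + z *\<^sub>R h))"
      unfolding ddec by (rule funpow_fdiff_sum) simp
    also have "\<bar>\<dots>\<bar> \<le> (\<Sum>b\<in>Basis. \<bar>(h \<bullet> b) * (fdiff h ^^ k) (\<lambda>x. ?D x b) (x + z *\<^sub>R h)\<bar>)"
      by (rule sum_abs)
    also have "\<dots> \<le> (\<Sum>b\<in>Basis. norm h * (C b * norm h ^ k))"
    proof (rule sum_mono)
      fix b :: 'a assume "b \<in> Basis"
      then have "\<bar>h \<bullet> b\<bar> \<le> norm h" by (rule Basis_le_norm)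
      from mult_mono[OF this C(2)[of h b "x + z *\<^sub>R h"]]
      show "\<bar>(h \<bullet> b) * (fdiff h ^^ k) (\<lambda>x. ?D x b) (x + z *\<^sub>R h)\<bar> \<le> norm h * (C b * norm h ^ k)"
        unfolding abs_mult by simp
    qed
    also have "\<dots> = (\<Sum>b\<in>Basis. C b) * norm h ^ Suc k"
      unfolding sum_distrib_right by (simp add: mult_ac)
    finally show ?thesis .
  qed
  moreover have "(\<Sum>b\<in>Basis. C b) \<ge> 0" using C by (intro sum_nonneg) auto
  ultimately show ?case by blast
qed

text \<open>Near h = 0 the k-th difference is O(|h|^k) with bounded support, and |h|^(k-\<beta>-n)
  is integrable there since k > \<beta>. Away from 0 its integral is at most 2^k times that of |f|,
  and |h|^(-n-\<beta>) is integrable at infinity.\<close>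

lemma W_norm_test_lt_top:
  fixes f :: "'a::euclidean_space \<Rightarrow> real"
  assumes f: "f \<in> test_functions" and \<beta>: "\<beta> > 0"
  shows "W_norm \<beta> f < \<infinity>"
proof -
  define k where "k = 1 + nat \<lfloor>\<beta>\<rfloor>"
  have k\<beta>: "real k > \<beta>" using \<beta> unfolding k_def by linarith
  let ?n = "real DIM('a)"
  have [measurable]: "f \<in> borel_measurable borel" using f by (rule test_functions_measurable)
  let ?I = "\<lambda>h. (\<integral>\<^sup>+x. ennreal \<bar>(fdiff h ^^ k) f x\<bar> \<partial>lborel)"
  obtain R where R: "R > 0" "\<And>x. norm x > R \<Longrightarrow> f x = 0" using test_functions_support[OF f] by blast
  obtain C where C: "C \<ge> 0" "\<And>h x. \<bar>(fdiff h ^^ k) f x\<bar> \<le> C * norm h ^ k"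
    using funpow_fdiff_test_bound[OF f] by blast
  obtain A where A: "A > 0" "\<And>x. \<bar>f x\<bar> \<le> A" using test_functions_bounded[OF f] by blast
  define V where "V = unit_ball_vol ?n * (2 * R) ^ DIM('a)"
  \<comment> \<open>For |h| < 1 the k-th difference vanishes once |x| is at least R + k + 1, since
    each x + i h then lies outside the ball of radius R. For large h the support moves away with h,
    so that case uses translation invariance and the volume \<open>V\<close> instead.\<close>
  define U where "U = unit_ball_vol ?n * (R + real k + 1) ^ DIM('a)"
  have VU: "V \<ge> 0" "U \<ge> 0" using R by (auto simp: V_def U_def)
  have far: "?I h \<le> ennreal (2 ^ k * (A * V))" for h
  proof -
    have 1: "(\<integral>\<^sup>+x. ennreal \<bar>f (x + y)\<bar> \<partial>lborel) \<le> ennreal (A * V)" for y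
    proof -
      have "(\<integral>\<^sup>+x. ennreal \<bar>f (x + y)\<bar> \<partial>lborel) = (\<integral>\<^sup>+x. ennreal \<bar>f x\<bar> \<partial>lborel)"
        using nn_integral_lborel_translate[of "\<lambda>x. ennreal \<bar>f x\<bar>" y] by (simp add: add.commute)
      also have "\<dots> \<le> (\<integral>\<^sup>+(x::'a). ennreal A * indicator (ball 0 (2 * R)) x \<partial>lborel)"
      proof (rule nn_integral_mono)
        fix x
        show "ennreal \<bar>f x\<bar> \<le> ennreal A * indicator (ball 0 (2 * R)) x"
          using A(2)[of x] R(1) R(2)[of x] by (cases "norm x > R") (auto simp: indicator_def ennreal_leI)
      qed
      also have "\<dots> = ennreal (A * V)"
        using R A by (simp add: nn_integral_cmult_indicator emeasure_lborel_ball ennreal_mult[symmetric] V_def)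
      finally show ?thesis .
    qed
    have "?I h \<le> (\<integral>\<^sup>+x. (\<Sum>i\<le>k. ennreal (real (k choose i)) * ennreal \<bar>f (x + real i *\<^sub>R h)\<bar>) \<partial>lborel)"
    proof (rule nn_integral_mono)
      fix x
      have "\<bar>(fdiff h ^^ k) f x\<bar> \<le> (\<Sum>i\<le>k. real (k choose i) * \<bar>f (x + real i *\<^sub>R h)\<bar>)"
        unfolding funpow_fdiff_expansion by (rule order_trans[OF sum_abs]) (simp add: abs_mult power_abs)
      then show "ennreal \<bar>(fdiff h ^^ k) f x\<bar> \<le> (\<Sum>i\<le>k. ennreal (real (k choose i)) * ennreal \<bar>f (x + real i *\<^sub>R h)\<bar>)"
        by (simp add: ennreal_mult[symmetric] ennreal_leI)
    qed
    also have "\<dots> = (\<Sum>i\<le>k. ennreal (real (k choose i)) * (\<integral>\<^sup>+x. ennreal \<bar>f (x + real i *\<^sub>R h)\<bar> \<partial>lborel))"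
      by (simp add: nn_integral_sum nn_integral_cmult)
    also have "\<dots> \<le> (\<Sum>i\<le>k. ennreal (real (k choose i)) * ennreal (A * V))"
      by (intro sum_mono mult_left_mono 1) simp
    also have "\<dots> = ennreal (\<Sum>i\<le>k. real (k choose i) * (A * V))"
      using A VU by (simp add: ennreal_mult[symmetric])
    also have "(\<Sum>i\<le>k. real (k choose i) * (A * V)) = 2 ^ k * (A * V)"
    proof -
      have "(\<Sum>i\<le>k. real (k choose i)) = 2 ^ k"
        using choose_row_sum[of k] by (metis of_nat_sum of_nat_power of_nat_numeral)
      then show ?thesis by (simp add: sum_distrib_right[symmetric])
    qed
    finally show ?thesis .
  qed
  have near: "?I h \<le> ennreal (C * U * norm h ^ k)" if h: "norm h < 1" for h
  proof -
    have "?I h \<le> (\<integral>\<^sup>+(x::'a). ennreal (C * norm h ^ k) * indicator (ball 0 (R + real k + 1)) x \<partial>lborel)"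
    proof (rule nn_integral_mono)
      fix x :: 'a
      show "ennreal \<bar>(fdiff h ^^ k) f x\<bar> \<le> ennreal (C * norm h ^ k) * indicator (ball 0 (R + real k + 1)) x"
      proof (cases "norm x < R + real k + 1")
        case True then show ?thesis using C by (simp add: ennreal_leI)
      next
        case False
        have "f (x + real i *\<^sub>R h) = 0" if "i \<le> k" for i
        proof (rule R)
          have "real i * norm h \<le> real k * 1" using that h by (intro mult_mono) auto
          then have "norm (real i *\<^sub>R h) \<le> real k * 1" by simp
          then show "R < norm (x + real i *\<^sub>R h)"
            using False norm_diff_ineq[of x "real i *\<^sub>R h"] by linarith
        qed
        then have "(fdiff h ^^ k) f x = 0" unfolding funpow_fdiff_expansion by simp
        then show ?thesis by simp
      qed
    qed
    also have "\<dots> = ennreal (C * U * norm h ^ k)"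
      using R C VU by (simp add: nn_integral_cmult_indicator emeasure_lborel_ball ennreal_mult[symmetric] U_def mult_ac)
    finally show ?thesis .
  qed
  have "W_norm \<beta> f \<le> (\<integral>\<^sup>+(h::'a). ennreal (C * U) * (indicator (ball 0 1) h * ennreal (norm h powr ((real k - \<beta>) - ?n)))
     + ennreal (2 ^ k * (A * V)) * (indicator {h. 1 \<le> norm h} h * ennreal (norm h powr (- (?n + \<beta>)))) \<partial>lborel)"
    unfolding W_norm_altdef k_def[symmetric]
  proof (rule nn_integral_mono_AE)
    have "AE h in lborel. h \<noteq> (0::'a)" by (rule AE_lborel_singleton)
    then show "AE h in lborel. ?I h / ennreal (norm h powr (?n + \<beta>)) \<le>
       ennreal (C * U) * (indicator (ball 0 1) h * ennreal (norm h powr ((real k - \<beta>) - ?n)))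
     + ennreal (2 ^ k * (A * V)) * (indicator {h. 1 \<le> norm h} h * ennreal (norm h powr (- (?n + \<beta>))))"
    proof eventually_elim
      fix h :: 'a assume h: "h \<noteq> 0"
      show "?I h / ennreal (norm h powr (?n + \<beta>)) \<le>
       ennreal (C * U) * (indicator (ball 0 1) h * ennreal (norm h powr ((real k - \<beta>) - ?n)))
     + ennreal (2 ^ k * (A * V)) * (indicator {h. 1 \<le> norm h} h * ennreal (norm h powr (- (?n + \<beta>))))"
      proof (cases "norm h < 1")
        case True
        have "?I h / ennreal (norm h powr (?n + \<beta>)) \<le> ennreal (C * U * norm h ^ k) / ennreal (norm h powr (?n + \<beta>))"
          by (intro divide_right_mono_ennreal near True)
        also have "\<dots> = ennreal (C * U * (norm h powr ((real k - \<beta>) - ?n)))"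
        proof -
          have "(real k - \<beta>) - ?n = real k - (?n + \<beta>)" by simp
          then have "norm h powr ((real k - \<beta>) - ?n) = norm h ^ k / norm h powr (?n + \<beta>)"
            using h by (simp only: powr_diff) (simp add: powr_realpow)
          then show ?thesis using h C VU by (simp add: divide_ennreal)
        qed
        finally show ?thesis using True C VU by (simp add: ennreal_mult)
      next
        case False
        have "?I h / ennreal (norm h powr (?n + \<beta>)) \<le> ennreal (2 ^ k * (A * V)) / ennreal (norm h powr (?n + \<beta>))"
          by (intro divide_right_mono_ennreal far)
        also have "\<dots> = ennreal (2 ^ k * (A * V) * (norm h powr (- (?n + \<beta>))))"
        proof -
          have "norm h powr (- (?n + \<beta>)) = 1 / norm h powr (?n + \<beta>)" by (rule powr_minus_divide)
          then show ?thesis using h A VU by (simp only: divide_ennreal) (simp add: divide_ennreal)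
        qed
        finally show ?thesis using False A VU by (simp add: ennreal_mult)
      qed
    qed
  qed
  also have "\<dots> = ennreal (C * U) * (\<integral>\<^sup>+(h::'a). indicator (ball 0 1) h * ennreal (norm h powr ((real k - \<beta>) - ?n)) \<partial>lborel)
     + ennreal (2 ^ k * (A * V)) * (\<integral>\<^sup>+(h::'a). indicator {h. 1 \<le> norm h} h * ennreal (norm h powr (- (?n + \<beta>))) \<partial>lborel)"
    by (subst nn_integral_add) (simp_all add: nn_integral_cmult)
  also have "\<dots> < \<infinity>"
    using nn_integral_unit_ball_lt_top[of "real k - \<beta>", where 'a='a] nn_integral_outside_unit_ball_lt_top[OF \<beta>, where 'a='a] k\<beta>
    by (simp add: ennreal_mult_less_top)
  finally show ?thesis .
qed


section \<open>A smooth bump function\<close>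

text \<open>The classical flat function exp(-1/s) with additional powers of 1/s. With these powers
  the family is closed under differentiation up to linear combinations.\<close>

definition flat_exp :: "nat \<Rightarrow> real \<Rightarrow> real" where
  "flat_exp m s = (if s > 0 then (1 / s) ^ m * exp (- (1 / s)) else 0)"

text \<open>The term of order m + 2 of the exponential series absorbs s^(-m) and leaves s^2. The
  square makes the difference quotient at 0 tend to 0 for every \<open>m\<close>.\<close>

lemma flat_exp_le_square: "\<bar>flat_exp m s\<bar> \<le> fact (m + 2) * s\<^sup>2"
proof (cases "s > 0")
  case True
  have "(1 / s) ^ (m + 2) \<le> fact (m + 2) * exp (1 / s)"
    using True by (intro power_le_fact_exp) simp
  then have "(1 / s) ^ (m + 2) / exp (1 / s) \<le> fact (m + 2)"
    by (subst pos_divide_le_eq) auto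
  then have "s\<^sup>2 * ((1 / s) ^ (m + 2) / exp (1 / s)) \<le> s\<^sup>2 * fact (m + 2)"
    by (intro mult_left_mono) auto
  moreover have "s\<^sup>2 * ((1 / s) ^ (m + 2) / exp (1 / s)) = (1 / s) ^ m * exp (- (1 / s))"
    using True by (simp add: power_add exp_minus field_simps power2_eq_square)
  ultimately show ?thesis using True by (simp add: flat_exp_def mult.commute)
qed (simp add: flat_exp_def)

lemma flat_exp_deriv: "(flat_exp m has_real_derivative (flat_exp (m + 2) s - real m * flat_exp (m + 1) s)) (at s)"
proof -
  consider "s > 0" | "s < 0" | "s = 0" by linarith
  then show ?thesis
  proof cases
    case 1
    have du: "((\<lambda>s. 1 / s) has_real_derivative - ((1 / s)\<^sup>2)) (at s)"
      using 1 by (auto intro!: derivative_eq_intros simp: power2_eq_square)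
    have "((\<lambda>s. (1 / s) ^ m * exp (- (1 / s))) has_real_derivative
        real m * (- ((1 / s)\<^sup>2) * (1 / s) ^ (m - Suc 0)) * exp (- (1 / s)) + exp (- (1 / s)) * - (- ((1 / s)\<^sup>2)) * (1 / s) ^ m) (at s)"
      by (intro DERIV_mult DERIV_power DERIV_fun_exp DERIV_minus du)
    moreover have "real m * (- ((1 / s)\<^sup>2) * (1 / s) ^ (m - Suc 0)) * exp (- (1 / s)) + exp (- (1 / s)) * - (- ((1 / s)\<^sup>2)) * (1 / s) ^ m
       = flat_exp (m + 2) s - real m * flat_exp (m + 1) s"
      using 1 unfolding flat_exp_def by (cases m) (simp_all add: power_add power2_eq_square algebra_simps)
    ultimately have "((\<lambda>s. (1 / s) ^ m * exp (- (1 / s))) has_real_derivative (flat_exp (m + 2) s - real m * flat_exp (m + 1) s)) (at s)"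
      by (simp only:)
    then show ?thesis
      by (rule has_field_derivative_transform_within_open[where S = "{0<..}"]) (use 1 in \<open>auto simp: flat_exp_def\<close>)
  next
    case 2
    have "((\<lambda>_. 0) has_real_derivative (flat_exp (m + 2) s - real m * flat_exp (m + 1) s)) (at s)"
      using 2 by (auto simp: flat_exp_def)
    then show ?thesis
      by (rule has_field_derivative_transform_within_open[where S = "{..<0}"]) (use 2 in \<open>auto simp: flat_exp_def\<close>)
  next
    case 3
    have "((\<lambda>h. flat_exp m h / h) \<longlongrightarrow> 0) (at 0)"
    proof (rule Lim_null_comparison)
      show "\<forall>\<^sub>F h in at 0. norm (flat_exp m h / h) \<le> fact (m + 2) * \<bar>h\<bar>"
      proof (rule eventually_at_filter[THEN iffD2], rule always_eventually, intro allI impI)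
        fix h :: real assume "h \<noteq> 0"
        then show "norm (flat_exp m h / h) \<le> fact (m + 2) * \<bar>h\<bar>"
          using flat_exp_le_square[of m h] by (simp add: pos_divide_le_eq power2_eq_square abs_mult[symmetric] mult.assoc)
      qed
      show "((\<lambda>h::real. fact (m + 2) * \<bar>h\<bar>) \<longlongrightarrow> 0) (at 0)" by (auto intro!: tendsto_eq_intros)
    qed
    then show ?thesis using 3 by (simp add: DERIV_def flat_exp_def)
  qed
qed

text \<open>The algebra generated by the flat functions of 1 - |x|^2, the constants and the linear
  forms. By the chain rule it is closed under directional derivatives, so it can serve as the
  invariant in \<open>Ck_coinduct\<close>.\<close>

inductive smooth_alg :: "('a::euclidean_space \<Rightarrow> real) \<Rightarrow> bool" where
  flat: "smooth_alg (\<lambda>x. flat_exp m (1 - x \<bullet> x))"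
| const: "smooth_alg (\<lambda>_. c)"
| inner: "smooth_alg (\<lambda>x. x \<bullet> v)"
| add: "smooth_alg f \<Longrightarrow> smooth_alg g \<Longrightarrow> smooth_alg (\<lambda>x. f x + g x)"
| mult: "smooth_alg f \<Longrightarrow> smooth_alg g \<Longrightarrow> smooth_alg (\<lambda>x. f x * g x)"

lemma smooth_alg_derivative:
  assumes "smooth_alg f"
  shows "\<exists>D. (\<forall>x. (f has_derivative D x) (at x)) \<and> (\<forall>v. smooth_alg (\<lambda>x. D x v))"
  using assms
proof (induction rule: smooth_alg.induct)
  case (flat m)
  let ?D = "\<lambda>x v::'a. (flat_exp (m + 2) (1 - x \<bullet> x) + (- real m) * flat_exp (m + 1) (1 - x \<bullet> x)) * (- 2 * (x \<bullet> v))"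
  have "((\<lambda>x. flat_exp m (1 - x \<bullet> x)) has_derivative ?D x) (at x)" for x :: 'a
  proof -
    have "((\<lambda>x::'a. 1 - x \<bullet> x) has_derivative (\<lambda>v. - 2 * (x \<bullet> v))) (at x)"
      by (auto intro!: derivative_eq_intros simp: inner_commute)
    from has_derivative_compose[OF this flat_exp_deriv[of m "1 - x \<bullet> x", unfolded has_field_derivative_def]]
    show ?thesis by simp
  qed
  moreover have "smooth_alg (\<lambda>x. ?D x v)" for v
    by (intro smooth_alg.add smooth_alg.mult smooth_alg.flat smooth_alg.const smooth_alg.inner)
  ultimately show ?case by (intro exI[of _ ?D] conjI allI)
next
  case (const c)
  show ?case by (rule exI[of _ "\<lambda>_ _. 0"]) (auto intro: smooth_alg.const)
next
  case (inner v)
  show ?case by (rule exI[of _ "\<lambda>_ u. u \<bullet> v"]) (auto intro: smooth_alg.const intro!: derivative_eq_intros)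
next
  case (add f g)
  then obtain D E where "\<And>x. (f has_derivative D x) (at x)" "\<And>v. smooth_alg (\<lambda>x. D x v)"
    "\<And>x. (g has_derivative E x) (at x)" "\<And>v. smooth_alg (\<lambda>x. E x v)" by metis
  then have "(\<forall>x. ((\<lambda>x. f x + g x) has_derivative (\<lambda>v. D x v + E x v)) (at x)) \<and> (\<forall>v. smooth_alg (\<lambda>x. D x v + E x v))"
    using has_derivative_add smooth_alg.add by blast
  then show ?case by (rule exI[of _ "\<lambda>x v. D x v + E x v"])
next
  case (mult f g)
  then obtain D E where D: "\<And>x. (f has_derivative D x) (at x)" "\<And>v. smooth_alg (\<lambda>x. D x v)"
    and E: "\<And>x. (g has_derivative E x) (at x)" "\<And>v. smooth_alg (\<lambda>x. E x v)" by metis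
  have "(\<forall>x. ((\<lambda>x. f x * g x) has_derivative (\<lambda>v. f x * E x v + D x v * g x)) (at x))"
    using has_derivative_mult[OF D(1) E(1)] by blast
  moreover have "\<forall>v. smooth_alg (\<lambda>x. f x * E x v + D x v * g x)"
    using smooth_alg.add[OF smooth_alg.mult[OF mult.hyps(1) E(2)] smooth_alg.mult[OF D(2) mult.hyps(2)]] by blast
  ultimately show ?case by (intro exI[of _ "\<lambda>x v. f x * E x v + D x v * g x"] conjI)
qed

lemma test_function_above_ball:
  obtains \<psi> :: "'a::euclidean_space \<Rightarrow> real" where "\<psi> \<in> test_functions" "\<And>x. \<psi> x \<ge> 0" "\<And>x. norm x < 1 \<Longrightarrow> \<psi> x \<ge> 1"
proof -
  let ?f = "\<lambda>x::'a. flat_exp 0 (1 - x \<bullet> x)"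
  have "?f \<in> test_functions"
  proof (rule test_functionsI)
    show "Ck k ?f" for k proof (rule Ck_coinduct[where S = smooth_alg])
      show "smooth_alg (\<lambda>x. flat_exp 0 (1 - x \<bullet> x))" by (rule smooth_alg.flat)
    qed (rule smooth_alg_derivative)
    show "?f x = 0" if "norm x > 1" for x
      using that power_strict_mono[of 1 "norm x" 2] by (simp add: flat_exp_def power2_norm_eq_inner)
  qed
  \<comment> \<open>Dilation by 2 keeps s = 1 - |x/2|^2 at least 3/4 on the unit ball, so 1/s \<le>
    2 there and the factor \<open>exp 2\<close> lifts exp(-1/s) above 1.\<close>
  from test_functions_cmult[OF test_functions_scaling[OF this, of 2 0], of "exp 2"]
  have "(\<lambda>x. exp 2 * ?f ((1 / 2) *\<^sub>R (x - 0))) \<in> test_functions" by simp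
  moreover have "exp 2 * ?f ((1 / 2) *\<^sub>R (x - 0)) \<ge> 0" for x by (simp add: flat_exp_def)
  moreover have "exp 2 * ?f ((1 / 2) *\<^sub>R (x - 0)) \<ge> 1" if "norm x < 1" for x :: 'a
  proof -
    define s where "s = 1 - ((1 / 2) *\<^sub>R (x - 0)) \<bullet> ((1 / 2) *\<^sub>R (x - 0))"
    have "x \<bullet> x \<le> 1" using that power_mono[of "norm x" 1 2] by (simp add: power2_norm_eq_inner)
    then have s: "s \<ge> 3 / 4" by (simp add: s_def)
    then have "1 / s \<le> 2" by (simp add: field_simps)
    then have "exp (2 - 1 / s) \<ge> 1" by simp
    then show ?thesis unfolding s_def[symmetric] using s by (simp add: flat_exp_def exp_diff exp_minus field_simps)
  qed
  ultimately show ?thesis using that by blast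
qed

lemma test_functions_subset_W_space:
  assumes "\<phi> \<in> test_functions" shows "\<phi> \<in> W_space \<beta>"
proof -
  have "(\<lambda>j::nat. \<integral>\<^sup>+ x\<in>K. ennreal \<bar>\<phi> x - \<phi> x\<bar> \<partial>lborel) \<longlonglongrightarrow> 0" for K by simp
  then show ?thesis unfolding W_space_def
    by (auto intro!: exI[of _ "\<lambda>_. \<phi>"] simp: assms test_functions_measurable W_norm_0)
qed

text \<open>The sum of the bumps dilated to the individual balls is admissible, and the seminorm is
  subadditive and homogeneous of degree n - \<beta>. For a finite union this sum is again a test
  function, so no limit has to be taken in the completion; countable unions are treated later on the
  side of the measure.\<close>

lemma W_cap_union_balls_le:
  assumes \<beta>: "\<beta> > 0"
  obtains C :: real where "C > 0" "\<And>(I :: 'i set) (a :: 'i \<Rightarrow> 'a::euclidean_space) (r :: 'i \<Rightarrow> real). finite I \<Longrightarrow> (\<And>i. i \<in> I \<Longrightarrow> r i > 0) \<Longrightarrow>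
     W_cap \<beta> (\<Union>i\<in>I. ball (a i) (r i)) \<le> ennreal (C * (\<Sum>i\<in>I. r i powr (real DIM('a) - \<beta>)))"
proof -
  obtain \<psi> :: "'a \<Rightarrow> real" where \<psi>: "\<psi> \<in> test_functions" "\<And>x. \<psi> x \<ge> 0" "\<And>x. norm x < 1 \<Longrightarrow> \<psi> x \<ge> 1"
    using test_function_above_ball by blast
  have [measurable]: "\<psi> \<in> borel_measurable borel" using \<psi>(1) by (rule test_functions_measurable)
  obtain C where C: "C \<ge> 0" "W_norm \<beta> \<psi> = ennreal C"
    using W_norm_test_lt_top[OF \<psi>(1) \<beta>] by (cases "W_norm \<beta> \<psi>") auto
  show ?thesis
  \<comment> \<open>The increment by 1 only ensures a strictly positive constant.\<close>
  proof (rule that[of "C + 1"])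
    show "C + 1 > 0" using C by simp
    fix I :: "'i set" and a :: "'i \<Rightarrow> 'a" and r :: "'i \<Rightarrow> real"
    assume fin: "finite I" and r: "\<And>i. i \<in> I \<Longrightarrow> r i > 0"
    define g where "g = (\<lambda>i x. \<psi> ((1 / r i) *\<^sub>R (x - a i)))"
    define F where "F = (\<lambda>J x. \<Sum>i\<in>J. g i x)"
    have g: "g i \<in> test_functions" "W_norm \<beta> (g i) = ennreal (C * r i powr (real DIM('a) - \<beta>))" if "i \<in> I" for i
      unfolding g_def using r[OF that] \<psi>(1) C
      by (auto simp: test_functions_scaling W_norm_scaling ennreal_mult[symmetric] mult.commute)
    have F: "F J \<in> test_functions \<and> W_norm \<beta> (F J) \<le> ennreal (C * (\<Sum>i\<in>J. r i powr (real DIM('a) - \<beta>)))" if "J \<subseteq> I" for J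
      using finite_subset[OF that fin] that
    proof (induction J rule: finite_induct)
      case empty then show ?case by (simp add: F_def test_functions_0 W_norm_0)
    next
      case (insert j J)
      then have IH: "F J \<in> test_functions" "W_norm \<beta> (F J) \<le> ennreal (C * (\<Sum>i\<in>J. r i powr (real DIM('a) - \<beta>)))" and j: "j \<in> I" by auto
      have eq: "F (insert j J) = (\<lambda>x. g j x + F J x)" using insert by (simp add: F_def)
      have "W_norm \<beta> (F (insert j J)) \<le> W_norm \<beta> (g j) + W_norm \<beta> (F J)"
        unfolding eq by (intro W_norm_add_le test_functions_measurable IH g j)
      also have "\<dots> \<le> ennreal (C * r j powr (real DIM('a) - \<beta>)) + ennreal (C * (\<Sum>i\<in>J. r i powr (real DIM('a) - \<beta>)))"
        using g(2)[OF j] IH(2) by (intro add_mono) auto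
      also have "\<dots> = ennreal (C * (\<Sum>i\<in>insert j J. r i powr (real DIM('a) - \<beta>)))"
        using insert C by (simp add: ennreal_plus[symmetric] sum_nonneg distrib_left del: ennreal_plus)
      finally show ?case unfolding eq using test_functions_add[OF g(1)[OF j] IH(1)] by simp
    qed
    have gnn: "g i x \<ge> 0" for i x by (simp add: g_def \<psi>)
    have "(\<Union>i\<in>I. ball (a i) (r i)) \<subseteq> {x. F I x \<ge> 1}"
    proof clarify
      fix i x assume i: "i \<in> I" and x: "x \<in> ball (a i) (r i)"
      have "norm ((1 / r i) *\<^sub>R (x - a i)) = norm (x - a i) / r i" using r[OF i] by (simp only: norm_scaleR) simp
      also have "\<dots> < 1" using x r[OF i] by (simp add: dist_norm norm_minus_commute)
      finally have "1 \<le> g i x" unfolding g_def by (rule \<psi>(3))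
      also have "\<dots> \<le> F I x" unfolding F_def using i fin gnn by (intro member_le_sum) auto
      finally show "1 \<le> F I x" .
    qed
    then have "(\<Union>i\<in>I. ball (a i) (r i)) \<subseteq> interior {x. F I x \<ge> 1}"
      by (intro interior_maximal) auto
    moreover have "F I \<in> W_space \<beta>" using F[of I] by (intro test_functions_subset_W_space) auto
    moreover have "F I x \<ge> 0" for x unfolding F_def by (intro sum_nonneg gnn)
    ultimately have "W_cap \<beta> (\<Union>i\<in>I. ball (a i) (r i)) \<le> W_norm \<beta> (F I)"
      unfolding W_cap_def by (intro Inf_lower) auto
    also have "\<dots> \<le> ennreal (C * (\<Sum>i\<in>I. r i powr (real DIM('a) - \<beta>)))" using F[of I] by simp
    also have "\<dots> \<le> ennreal ((C + 1) * (\<Sum>i\<in>I. r i powr (real DIM('a) - \<beta>)))"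
      by (intro ennreal_leI mult_right_mono sum_nonneg) auto
    finally show "W_cap \<beta> (\<Union>i\<in>I. ball (a i) (r i)) \<le> ennreal ((C + 1) * (\<Sum>i\<in>I. r i powr (real DIM('a) - \<beta>)))" .
  qed
qed

section \<open>Averages and oscillation\<close>


text \<open>The divisor is s^n whatever \<rho> is, not the volume of the ball. Hence enlarging
  \<rho> alone can only increase the value, which is how centres are moved.\<close>

definition scaled_mean :: "real \<Rightarrow> real \<Rightarrow> ('a::euclidean_space \<Rightarrow> ennreal) \<Rightarrow> 'a \<Rightarrow> ennreal" where
  "scaled_mean \<rho> s g z = ennreal (1 / s ^ DIM('a)) * (\<integral>\<^sup>+y. (if dist z y < \<rho> * s then g y else 0) \<partial>lborel)"

lemma borel_measurable_scaled_mean[measurable (raw)]: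
  fixes g :: "'b \<Rightarrow> 'a::euclidean_space \<Rightarrow> ennreal"
  assumes [measurable]: "(\<lambda>(x, y). g x y) \<in> borel_measurable (M \<Otimes>\<^sub>M borel)" "h \<in> borel_measurable M"
  shows "(\<lambda>x. scaled_mean \<rho> s (g x) (h x)) \<in> borel_measurable M"
  unfolding scaled_mean_def by measurable

lemma nn_integral_ball_eq_scaled_mean:
  fixes g :: "'a::euclidean_space \<Rightarrow> ennreal"
  assumes [measurable]: "g \<in> borel_measurable borel" and s: "s > 0"
  shows "(\<integral>\<^sup>+w. indicator (ball 0 \<rho>) w * g (z + s *\<^sub>R w) \<partial>lborel) = scaled_mean \<rho> s g z"
proof -
  have "(\<integral>\<^sup>+y. (if dist z y < \<rho> * s then g y else 0) \<partial>lborel)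
     = ennreal (\<bar>s\<bar> ^ DIM('a)) * (\<integral>\<^sup>+w. (if dist z (z + s *\<^sub>R w) < \<rho> * s then g (z + s *\<^sub>R w) else 0) \<partial>lborel)"
    using s by (intro nn_integral_lborel_affine) auto
  also have "(\<lambda>w. if dist z (z + s *\<^sub>R w) < \<rho> * s then g (z + s *\<^sub>R w) else 0) = (\<lambda>w. indicator (ball 0 \<rho>) w * g (z + s *\<^sub>R w))"
    using s by (auto simp: fun_eq_iff dist_norm mult.commute)
  finally show ?thesis
    using s unfolding scaled_mean_def
    by (simp add: mult.assoc[symmetric] ennreal_mult[symmetric])
qed

lemma scaled_mean_mono: "(\<And>y. g y \<le> g' y) \<Longrightarrow> scaled_mean \<rho> s g z \<le> scaled_mean \<rho> s g' z"
  unfolding scaled_mean_def by (intro mult_left_mono nn_integral_mono) auto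

lemma scaled_mean_cmult:
  fixes g :: "'a::euclidean_space \<Rightarrow> ennreal"
  assumes [measurable]: "g \<in> borel_measurable borel"
  shows "scaled_mean \<rho> s (\<lambda>y. c * g y) z = c * scaled_mean \<rho> s g z"
proof -
  have "(\<integral>\<^sup>+y. (if dist z y < \<rho> * s then c * g y else 0) \<partial>lborel) = (\<integral>\<^sup>+y. c * (if dist z y < \<rho> * s then g y else 0) \<partial>lborel)"
    by (intro nn_integral_cong) auto
  also have "\<dots> = c * (\<integral>\<^sup>+y. (if dist z y < \<rho> * s then g y else 0) \<partial>lborel)"
    by (rule nn_integral_cmult) measurable
  finally show ?thesis unfolding scaled_mean_def by (simp add: mult_ac)
qed

lemma scaled_mean_doubling:
  fixes g :: "'a::euclidean_space \<Rightarrow> ennreal"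
  assumes "s > 0" "\<rho> \<ge> 0"
  shows "scaled_mean \<rho> s g z \<le> ennreal (2 ^ DIM('a)) * scaled_mean \<rho> (2 * s) g z"
proof -
  have "ennreal (2 ^ DIM('a)) * ennreal (1 / (2 * s) ^ DIM('a)) = ennreal (1 / s ^ DIM('a))"
    using assms by (simp add: ennreal_mult[symmetric] power_mult_distrib)
  moreover have "\<rho> * s \<le> \<rho> * (2 * s)" using assms by (intro mult_left_mono) auto
  then have "(\<integral>\<^sup>+y. (if dist z y < \<rho> * s then g y else 0) \<partial>lborel) \<le> (\<integral>\<^sup>+y. (if dist z y < \<rho> * (2 * s) then g y else 0) \<partial>lborel)"
    by (intro nn_integral_mono) auto
  ultimately show ?thesis unfolding scaled_mean_def by (simp add: mult.assoc[symmetric] mult_left_mono)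
qed

lemma scaled_mean_le_total:
  fixes g :: "'a::euclidean_space \<Rightarrow> ennreal"
  shows "scaled_mean \<rho> s g z \<le> ennreal (1 / s ^ DIM('a)) * (\<integral>\<^sup>+y. g y \<partial>lborel)"
  unfolding scaled_mean_def by (intro mult_left_mono nn_integral_mono) auto

text \<open>An averaged modulus of smoothness of order \<open>k\<close>: the mean runs over the
  steps |h| < s while the position \<open>y\<close> stays fixed. The position is averaged by a
  further \<open>scaled_mean\<close> where needed.\<close>

definition osc :: "nat \<Rightarrow> ('a::euclidean_space \<Rightarrow> real) \<Rightarrow> real \<Rightarrow> 'a \<Rightarrow> ennreal" where
  "osc k f s y = scaled_mean 1 s (\<lambda>h. ennreal \<bar>(fdiff h ^^ k) f y\<bar>) 0"

lemma borel_measurable_osc[measurable]: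
  assumes [measurable]: "f \<in> borel_measurable borel"
  shows "osc k f s \<in> borel_measurable borel"
  unfolding osc_def[abs_def] by measurable

lemma osc_doubling: "s > 0 \<Longrightarrow> osc k f s (y::'a::euclidean_space) \<le> ennreal (2 ^ DIM('a)) * osc k f (2 * s) y"
  unfolding osc_def by (rule scaled_mean_doubling) auto

definition loc_int :: "('a::euclidean_space \<Rightarrow> real) \<Rightarrow> bool" where
  "loc_int f \<longleftrightarrow> f \<in> borel_measurable borel \<and> (\<forall>R. (\<integral>\<^sup>+x. (if norm x < R then ennreal \<bar>f x\<bar> else 0) \<partial>lborel) < \<infinity>)"

lemma loc_int_measurable: "loc_int f \<Longrightarrow> f \<in> borel_measurable borel"
  by (simp add: loc_int_def)

lemma loc_int_ball:
  assumes "loc_int (f :: 'a::euclidean_space \<Rightarrow> real)"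
  shows "(\<integral>\<^sup>+x. (if dist z x < R then ennreal \<bar>f x\<bar> else 0) \<partial>lborel) < \<infinity>"
proof -
  have "norm x < norm z + R" if "dist z x < R" for x
    using that norm_triangle_ineq2[of x z] by (simp add: dist_norm norm_minus_commute)
  then have "(\<integral>\<^sup>+x. (if dist z x < R then ennreal \<bar>f x\<bar> else 0) \<partial>lborel) \<le> (\<integral>\<^sup>+x. (if norm x < norm z + R then ennreal \<bar>f x\<bar> else 0) \<partial>lborel)"
    by (intro nn_integral_mono) auto
  also have "\<dots> < \<infinity>" using assms by (auto simp: loc_int_def)
  finally show ?thesis .
qed

lemma loc_int_scaled_mean:
  assumes "loc_int f" shows "scaled_mean \<rho> s (\<lambda>y. ennreal \<bar>f y\<bar>) z < \<infinity>"
  unfolding scaled_mean_def using loc_int_ball[OF assms] by (simp add: ennreal_mult_less_top)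

lemma ennreal_abs_diff_le: "ennreal \<bar>a - b\<bar> \<le> ennreal \<bar>a\<bar> + ennreal \<bar>b\<bar>"
  by (simp add: ennreal_plus[symmetric] ennreal_leI del: ennreal_plus)

lemma ennreal_abs_add_le: "ennreal \<bar>a + b\<bar> \<le> ennreal \<bar>a\<bar> + ennreal \<bar>b\<bar>"
  by (simp add: ennreal_plus[symmetric] ennreal_leI del: ennreal_plus)

text \<open>If \<open>f\<close> is not integrable, the Bochner integral is 0 by convention, so the
  inequality holds unconditionally.\<close>

lemma ennreal_abs_integral_le: "ennreal \<bar>LINT x|M. f x\<bar> \<le> (\<integral>\<^sup>+x. ennreal \<bar>f x\<bar> \<partial>M)"
proof (cases "integrable M f")
  case True then show ?thesis using integral_norm_bound_ennreal[OF True] by simp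
qed (simp add: not_integrable_integral_eq)

section \<open>Averages against a bounded kernel of bounded support\<close>

text \<open>The kernel may change sign and has no prescribed integral. Apart from the kernel built
  from k-th differences, indicators of balls are an instance, used for the individual terms of that
  kernel.\<close>

locale averaging_kernel =
  fixes \<Phi> :: "'a::euclidean_space \<Rightarrow> real" and B \<rho> :: real
  assumes kernel_measurable[measurable]: "\<Phi> \<in> borel_measurable borel"
    and kernel_le: "\<bar>\<Phi> w\<bar> \<le> B * indicator (ball 0 \<rho>) w" and B: "B \<ge> 0" and \<rho>: "\<rho> > 0"
begin

definition av :: "real \<Rightarrow> ('a \<Rightarrow> real) \<Rightarrow> 'a \<Rightarrow> real" where
  "av s f z = (LINT w|lborel. \<Phi> w * f (z + s *\<^sub>R w))"

lemma nn_integral_av_le: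
  assumes [measurable]: "f \<in> borel_measurable borel" and s: "s > 0"
  shows "(\<integral>\<^sup>+w. ennreal \<bar>\<Phi> w * f (z + s *\<^sub>R w)\<bar> \<partial>lborel) \<le> ennreal B * scaled_mean \<rho> s (\<lambda>y. ennreal \<bar>f y\<bar>) z"
proof -
  have "(\<integral>\<^sup>+w. ennreal \<bar>\<Phi> w * f (z + s *\<^sub>R w)\<bar> \<partial>lborel) \<le> (\<integral>\<^sup>+w. ennreal B * (indicator (ball 0 \<rho>) w * ennreal \<bar>f (z + s *\<^sub>R w)\<bar>) \<partial>lborel)"
  proof (rule nn_integral_mono)
    fix w
    have "\<bar>\<Phi> w * f (z + s *\<^sub>R w)\<bar> \<le> B * indicator (ball 0 \<rho>) w * \<bar>f (z + s *\<^sub>R w)\<bar>"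
      unfolding abs_mult by (intro mult_right_mono kernel_le) simp
    then have "ennreal \<bar>\<Phi> w * f (z + s *\<^sub>R w)\<bar> \<le> ennreal (B * indicator (ball 0 \<rho>) w * \<bar>f (z + s *\<^sub>R w)\<bar>)"
      by (rule ennreal_leI)
    also have "\<dots> = ennreal B * (indicator (ball 0 \<rho>) w * ennreal \<bar>f (z + s *\<^sub>R w)\<bar>)"
      using B by (auto simp: indicator_def ennreal_mult)
    finally show "ennreal \<bar>\<Phi> w * f (z + s *\<^sub>R w)\<bar> \<le> ennreal B * (indicator (ball 0 \<rho>) w * ennreal \<bar>f (z + s *\<^sub>R w)\<bar>)" .
  qed
  also have "\<dots> = ennreal B * (\<integral>\<^sup>+w. indicator (ball 0 \<rho>) w * ennreal \<bar>f (z + s *\<^sub>R w)\<bar> \<partial>lborel)"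
    by (rule nn_integral_cmult) measurable
  also have "(\<integral>\<^sup>+w. indicator (ball 0 \<rho>) w * ennreal \<bar>f (z + s *\<^sub>R w)\<bar> \<partial>lborel) = scaled_mean \<rho> s (\<lambda>y. ennreal \<bar>f y\<bar>) z"
    using s by (intro nn_integral_ball_eq_scaled_mean) auto
  finally show ?thesis .
qed

lemma av_le:
  assumes "f \<in> borel_measurable borel" and s: "s > 0"
  shows "ennreal \<bar>av s f z\<bar> \<le> ennreal B * scaled_mean \<rho> s (\<lambda>y. ennreal \<bar>f y\<bar>) z"
  unfolding av_def using ennreal_abs_integral_le nn_integral_av_le[OF assms] by (rule order_trans)

lemma integrable_av:
  assumes f: "loc_int f" and s: "s > 0"
  shows "integrable lborel (\<lambda>w. \<Phi> w * f (z + s *\<^sub>R w))"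
proof -
  have [measurable]: "f \<in> borel_measurable borel" using f by (rule loc_int_measurable)
  have "(\<integral>\<^sup>+w. ennreal \<bar>\<Phi> w * f (z + s *\<^sub>R w)\<bar> \<partial>lborel) < \<infinity>"
    using nn_integral_av_le[of f s z] loc_int_scaled_mean[OF f, of \<rho> s z] s
    by (auto simp: ennreal_mult_less_top intro: le_less_trans)
  then show ?thesis by (intro integrableI_bounded) auto
qed

lemma borel_measurable_av[measurable (raw)]:
  assumes [measurable]: "f \<in> borel_measurable borel" shows "av s f \<in> borel_measurable borel"
  unfolding av_def[abs_def] by measurable

lemma scaled_mean_iterate_le:
  fixes z :: 'a
  assumes [measurable]: "g \<in> borel_measurable borel" and s: "s > 0" and t: "t > 0"
  shows "scaled_mean \<rho> s (scaled_mean \<rho> t g) z \<le>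
     ennreal (unit_ball_vol DIM('a) * \<rho> ^ DIM('a) / t ^ DIM('a)) * (\<integral>\<^sup>+y. (if dist z y < \<rho> * (s + t) then g y else 0) \<partial>lborel)"
proof -
  let ?X = "\<integral>\<^sup>+y. (if dist z y < \<rho> * (s + t) then g y else 0) \<partial>lborel"
  have "scaled_mean \<rho> s (scaled_mean \<rho> t g) z \<le> ennreal (1 / s ^ DIM('a)) * (\<integral>\<^sup>+(x::'a). ennreal (1 / t ^ DIM('a)) * ?X * indicator (ball z (\<rho> * s)) x \<partial>lborel)"
    unfolding scaled_mean_def[of \<rho> s]
  proof (intro mult_left_mono nn_integral_mono)
    fix x
    show "(if dist z x < \<rho> * s then scaled_mean \<rho> t g x else 0) \<le> ennreal (1 / t ^ DIM('a)) * ?X * indicator (ball z (\<rho> * s)) x"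
    proof (cases "dist z x < \<rho> * s")
      case True
      have "dist z y < \<rho> * (s + t)" if "dist x y < \<rho> * t" for y
        using True that dist_triangle[of z y x] by (simp add: distrib_left)
      then have "scaled_mean \<rho> t g x \<le> ennreal (1 / t ^ DIM('a)) * ?X"
        unfolding scaled_mean_def by (intro mult_left_mono nn_integral_mono) auto
      then show ?thesis using True by simp
    qed simp
  qed simp
  also have "\<dots> = ennreal (1 / s ^ DIM('a)) * (ennreal (1 / t ^ DIM('a)) * ?X * ennreal (unit_ball_vol DIM('a) * (\<rho> * s) ^ DIM('a)))"
    using s \<rho> by (subst nn_integral_cmult_indicator) (auto simp: emeasure_lborel_ball)
  also have "\<dots> = (ennreal (1 / s ^ DIM('a)) * ennreal (1 / t ^ DIM('a)) * ennreal (unit_ball_vol DIM('a) * (\<rho> * s) ^ DIM('a))) * ?X"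
    by (simp add: mult_ac)
  also have "ennreal (1 / s ^ DIM('a)) * ennreal (1 / t ^ DIM('a)) * ennreal (unit_ball_vol DIM('a) * (\<rho> * s) ^ DIM('a))
     = ennreal (unit_ball_vol DIM('a) * \<rho> ^ DIM('a) / t ^ DIM('a))"
    using s t \<rho> by (simp add: ennreal_mult[symmetric] power_mult_distrib)
  finally show ?thesis .
qed

lemma av_av_le:
  assumes [measurable]: "f \<in> borel_measurable borel" and s: "s > 0" and t: "t > 0"
  shows "ennreal \<bar>av s (av t f) z\<bar> \<le> ennreal (B * B * (unit_ball_vol DIM('a) * \<rho> ^ DIM('a) / t ^ DIM('a))) *
     (\<integral>\<^sup>+y. (if dist z y < \<rho> * (s + t) then ennreal \<bar>f y\<bar> else 0) \<partial>lborel)"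
proof -
  let ?N = "scaled_mean \<rho> s (scaled_mean \<rho> t (\<lambda>y. ennreal \<bar>f y\<bar>)) z"
  have "ennreal \<bar>av s (av t f) z\<bar> \<le> ennreal B * scaled_mean \<rho> s (\<lambda>y. ennreal \<bar>av t f y\<bar>) z"
    by (rule av_le) (use s in measurable)
  also have "\<dots> \<le> ennreal B * scaled_mean \<rho> s (\<lambda>y. ennreal B * scaled_mean \<rho> t (\<lambda>y. ennreal \<bar>f y\<bar>) y) z"
    by (intro mult_left_mono scaled_mean_mono av_le t) auto
  also have "\<dots> = ennreal B * (ennreal B * ?N)"
    by (subst scaled_mean_cmult) (auto intro!: borel_measurable_scaled_mean)
  also have "\<dots> \<le> ennreal B * (ennreal B * (ennreal (unit_ball_vol DIM('a) * \<rho> ^ DIM('a) / t ^ DIM('a)) *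
     (\<integral>\<^sup>+y. (if dist z y < \<rho> * (s + t) then ennreal \<bar>f y\<bar> else 0) \<partial>lborel)))"
    by (intro mult_left_mono scaled_mean_iterate_le s t) auto
  also have "\<dots> = ennreal (B * B * (unit_ball_vol DIM('a) * \<rho> ^ DIM('a) / t ^ DIM('a))) *
     (\<integral>\<^sup>+y. (if dist z y < \<rho> * (s + t) then ennreal \<bar>f y\<bar> else 0) \<partial>lborel)"
  proof -
    have "ennreal (B * B * Q) = ennreal B * (ennreal B * ennreal Q)" if "Q \<ge> 0" for Q
      using B that by (simp add: ennreal_mult mult.assoc)
    then show ?thesis using \<rho> t by (simp only: mult.assoc divide_nonneg_nonneg mult_nonneg_nonneg unit_ball_vol_nonneg zero_le_power of_nat_0_le_iff less_imp_le)
  qed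
  finally show ?thesis .
qed

lemma loc_int_av:
  assumes f: "loc_int f" and s: "s > 0"
  shows "loc_int (av s f)"
proof -
  have [measurable]: "f \<in> borel_measurable borel" using f by (rule loc_int_measurable)
  have "(\<integral>\<^sup>+z. (if norm z < R then ennreal \<bar>av s f z\<bar> else 0) \<partial>lborel) < \<infinity>" for R
  proof -
    let ?X = "\<integral>\<^sup>+y. (if norm y < R + \<rho> * s then ennreal \<bar>f y\<bar> else 0) \<partial>lborel"
    have "(\<integral>\<^sup>+z. (if norm z < R then ennreal \<bar>av s f z\<bar> else 0) \<partial>lborel)
       \<le> (\<integral>\<^sup>+(z::'a). ennreal B * (ennreal (1 / s ^ DIM('a)) * ?X) * indicator (ball 0 R) z \<partial>lborel)"
    proof (rule nn_integral_mono)
      fix z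
      show "(if norm z < R then ennreal \<bar>av s f z\<bar> else 0) \<le> ennreal B * (ennreal (1 / s ^ DIM('a)) * ?X) * indicator (ball 0 R) z"
      proof (cases "norm z < R")
        case True
        have "norm y < R + \<rho> * s" if "dist z y < \<rho> * s" for y
          using True that norm_triangle_ineq2[of y z] by (simp add: dist_norm norm_minus_commute)
        then have "scaled_mean \<rho> s (\<lambda>y. ennreal \<bar>f y\<bar>) z \<le> ennreal (1 / s ^ DIM('a)) * ?X"
          unfolding scaled_mean_def by (intro mult_left_mono nn_integral_mono) auto
        then have "ennreal \<bar>av s f z\<bar> \<le> ennreal B * (ennreal (1 / s ^ DIM('a)) * ?X)"
          using s by (intro order_trans[OF av_le[of f s z]] mult_left_mono) auto
        then show ?thesis using True by simp
      qed simp
    qed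
    also have "\<dots> = ennreal B * (ennreal (1 / s ^ DIM('a)) * ?X) * emeasure lborel (ball (0::'a) R)"
      by (rule nn_integral_cmult_indicator) simp
    also have "\<dots> < \<infinity>"
      using f emeasure_bounded_finite[OF bounded_ball, of "0::'a" R] by (simp add: ennreal_mult_less_top loc_int_def)
    finally show ?thesis .
  qed
  then show ?thesis by (simp add: loc_int_def)
qed

lemma av_diff:
  assumes "loc_int f" "loc_int g" "s > 0"
  shows "av s (\<lambda>x. f x - g x) z = av s f z - av s g z"
  unfolding av_def using integrable_av[OF assms(1,3)] integrable_av[OF assms(2,3)]
  by (subst Bochner_Integration.integral_diff[symmetric]) (auto simp: right_diff_distrib)

text \<open>Both sides are the double integral of \<Phi>(w) \<Phi>(u) f(z + s w + t u) in either
  order. It converges absolutely, since it is dominated by an iterated mean of |f|, which is a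
  bounded multiple of the integral of |f| over a ball.\<close>

lemma av_commute:
  assumes f: "loc_int f" and s: "s > 0" and t: "t > 0"
  shows "av s (av t f) z = av t (av s f) z"
proof -
  have [measurable]: "f \<in> borel_measurable borel" using f by (rule loc_int_measurable)
  let ?F = "\<lambda>w u. \<Phi> w * (\<Phi> u * f (z + s *\<^sub>R w + t *\<^sub>R u))"
  have "(\<integral>\<^sup>+w. \<integral>\<^sup>+u. ennreal \<bar>?F w u\<bar> \<partial>lborel \<partial>lborel) < \<infinity>"
  proof -
    let ?N = "scaled_mean \<rho> s (scaled_mean \<rho> t (\<lambda>y. ennreal \<bar>f y\<bar>)) z"
    have "(\<integral>\<^sup>+w. \<integral>\<^sup>+u. ennreal \<bar>?F w u\<bar> \<partial>lborel \<partial>lborel)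
      \<le> (\<integral>\<^sup>+w. (ennreal B * ennreal B) * (indicator (ball 0 \<rho>) w * scaled_mean \<rho> t (\<lambda>y. ennreal \<bar>f y\<bar>) (z + s *\<^sub>R w)) \<partial>lborel)"
    proof (rule nn_integral_mono)
      fix w
      have "(\<integral>\<^sup>+u. ennreal \<bar>?F w u\<bar> \<partial>lborel) = ennreal \<bar>\<Phi> w\<bar> * (\<integral>\<^sup>+u. ennreal \<bar>\<Phi> u * f (z + s *\<^sub>R w + t *\<^sub>R u)\<bar> \<partial>lborel)"
        by (subst nn_integral_cmult[symmetric]) (auto simp: abs_mult ennreal_mult)
      also have "\<dots> \<le> (ennreal B * indicator (ball 0 \<rho>) w) * (ennreal B * scaled_mean \<rho> t (\<lambda>y. ennreal \<bar>f y\<bar>) (z + s *\<^sub>R w))"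
      proof (intro mult_mono)
        show "ennreal \<bar>\<Phi> w\<bar> \<le> ennreal B * indicator (ball 0 \<rho>) w"
          using kernel_le[of w] by (auto simp: indicator_def ennreal_leI split: if_splits)
      qed (use t in \<open>auto intro: nn_integral_av_le\<close>)
      finally show "(\<integral>\<^sup>+u. ennreal \<bar>?F w u\<bar> \<partial>lborel) \<le> (ennreal B * ennreal B) * (indicator (ball 0 \<rho>) w * scaled_mean \<rho> t (\<lambda>y. ennreal \<bar>f y\<bar>) (z + s *\<^sub>R w))"
        by (simp add: mult_ac)
    qed
    also have "\<dots> = ennreal B * ennreal B * (\<integral>\<^sup>+w. indicator (ball 0 \<rho>) w * scaled_mean \<rho> t (\<lambda>y. ennreal \<bar>f y\<bar>) (z + s *\<^sub>R w) \<partial>lborel)"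
      by (rule nn_integral_cmult) measurable
    also have "(\<integral>\<^sup>+w. indicator (ball 0 \<rho>) w * scaled_mean \<rho> t (\<lambda>y. ennreal \<bar>f y\<bar>) (z + s *\<^sub>R w) \<partial>lborel) = ?N"
      by (rule nn_integral_ball_eq_scaled_mean[OF _ s]) measurable
    also have "ennreal B * ennreal B * ?N \<le> ennreal B * ennreal B * (ennreal (unit_ball_vol DIM('a) * \<rho> ^ DIM('a) / t ^ DIM('a)) *
     (\<integral>\<^sup>+y. (if dist z y < \<rho> * (s + t) then ennreal \<bar>f y\<bar> else 0) \<partial>lborel))"
      by (intro mult_left_mono scaled_mean_iterate_le s t) auto
    also have "\<dots> < \<infinity>"
      using loc_int_ball[OF f, of z "\<rho> * (s + t)"] by (simp add: ennreal_mult_less_top)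
    finally show ?thesis .
  qed
  then have int: "integrable (lborel \<Otimes>\<^sub>M lborel) (\<lambda>(w, u). ?F w u)"
    by (intro integrableI_bounded) (auto simp: lborel.nn_integral_fst[symmetric])
  have "av s (av t f) z = (LINT w|lborel. LINT u|lborel. ?F w u)"
    unfolding av_def by simp
  also have "\<dots> = (LINT u|lborel. LINT w|lborel. ?F w u)"
    using lborel_pair.Fubini_integral[OF int] by simp
  also have "(\<lambda>u. LINT w|lborel. ?F w u) = (\<lambda>u. LINT w|lborel. \<Phi> u * (\<Phi> w * f (z + t *\<^sub>R u + s *\<^sub>R w)))"
    by (simp add: mult_ac add_ac)
  also have "(LINT u|lborel. LINT w|lborel. \<Phi> u * (\<Phi> w * f (z + t *\<^sub>R u + s *\<^sub>R w))) = av t (av s f) z"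
    unfolding av_def by simp
  finally show ?thesis .
qed

end


section \<open>Averages adapted to k-th differences\<close>

text \<open>Averaging the expansion of the k-th difference with step s u over |u| < 1 gives f(z)
  itself from i = 0 and, after the substitution w = i u, ball means of radius i from the other
  terms. This kernel collects these with signs such that f minus its average is exactly, up to sign,
  a mean of k-th differences.\<close>

definition diff_kernel :: "nat \<Rightarrow> 'a::euclidean_space \<Rightarrow> real" where
  "diff_kernel k w = (\<Sum>i=1..k. (-1) ^ (i + 1) * real (k choose i) / (unit_ball_vol DIM('a) * real i ^ DIM('a)) * indicator (ball 0 (real i)) w)"

definition diff_kernel_bound :: "'a::euclidean_space itself \<Rightarrow> nat \<Rightarrow> real" where
  "diff_kernel_bound _ k = (\<Sum>i=1..k. real (k choose i) / (unit_ball_vol DIM('a) * real i ^ DIM('a)))"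

lemma averaging_kernel_diff_kernel:
  assumes "k > 0"
  shows "averaging_kernel (diff_kernel k :: 'a::euclidean_space \<Rightarrow> real) (diff_kernel_bound TYPE('a) k) (real k)"
proof
  show "(diff_kernel k :: 'a \<Rightarrow> real) \<in> borel_measurable borel"
    unfolding diff_kernel_def[abs_def] by measurable
  show "diff_kernel_bound TYPE('a) k \<ge> 0" unfolding diff_kernel_bound_def by (intro sum_nonneg) auto
  show "\<bar>diff_kernel k w\<bar> \<le> diff_kernel_bound TYPE('a) k * indicator (ball 0 (real k)) w" for w :: 'a
  proof -
    have "\<bar>diff_kernel k w\<bar> \<le> (\<Sum>i=1..k. \<bar>(-1) ^ (i + 1) * real (k choose i) / (unit_ball_vol DIM('a) * real i ^ DIM('a)) * indicator (ball 0 (real i)) w\<bar>)"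
      unfolding diff_kernel_def by (rule sum_abs)
    also have "\<dots> \<le> (\<Sum>i=1..k. real (k choose i) / (unit_ball_vol DIM('a) * real i ^ DIM('a)) * indicator (ball 0 (real k)) w)"
    proof (rule sum_mono)
      fix i assume i: "i \<in> {1..k}"
      have le: "\<bar>indicator (ball 0 (real i)) w\<bar> \<le> (indicator (ball 0 (real k)) w :: real)"
        using i by (auto simp: indicator_def)
      have c: "\<bar>(-1) ^ (i + 1) * real (k choose i) / (unit_ball_vol DIM('a) * real i ^ DIM('a))\<bar> = real (k choose i) / (unit_ball_vol DIM('a) * real i ^ DIM('a))"
        by (simp add: abs_mult power_abs abs_divide)
      show "\<bar>(-1) ^ (i + 1) * real (k choose i) / (unit_ball_vol DIM('a) * real i ^ DIM('a)) * indicator (ball 0 (real i)) w\<bar>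
         \<le> real (k choose i) / (unit_ball_vol DIM('a) * real i ^ DIM('a)) * indicator (ball 0 (real k)) w"
        unfolding abs_mult[of _ "indicator (ball 0 (real i)) w"] c by (intro mult_left_mono le) auto
    qed
    finally show ?thesis by (simp add: diff_kernel_bound_def sum_distrib_right)
  qed
  show "real k > 0" using assms by simp
qed

lemma averaging_kernel_indicator: "r > 0 \<Longrightarrow> averaging_kernel (indicator (ball (0::'a::euclidean_space) r)) 1 r"
  by standard auto

context
  fixes k :: nat and f :: "'a::euclidean_space \<Rightarrow> real"
  assumes k: "k > 0" and f: "loc_int f"
begin

interpretation averaging_kernel "diff_kernel k :: 'a \<Rightarrow> real" "diff_kernel_bound TYPE('a) k" "real k"
  by (rule averaging_kernel_diff_kernel[OF k])

lemma integrable_indicator_ball: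
  "r > 0 \<Longrightarrow> s > 0 \<Longrightarrow> integrable lborel (\<lambda>w. indicator (ball 0 r) w * f (z + s *\<^sub>R w))"
  using averaging_kernel.integrable_av[OF averaging_kernel_indicator f] by blast

lemma minus_av_eq_funpow_fdiff:
  assumes s: "s > 0"
  shows "f z - av s f z = (-1) ^ k / unit_ball_vol DIM('a) * (LINT u|lborel. indicator (ball 0 1) u * (fdiff (s *\<^sub>R u) ^^ k) f z)"
proof -
  note [measurable] = loc_int_measurable[OF f]
  let ?v = "unit_ball_vol DIM('a)"
  let ?J = "\<lambda>i. LINT w|lborel. indicator (ball 0 (real i)) w * f (z + s *\<^sub>R w)"
  let ?I = "\<lambda>i. LINT u|lborel. indicator (ball 0 1) u * f (z + (real i * s) *\<^sub>R u)"
  have v: "?v > 0" by simp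
  then have v0: "?v \<noteq> 0" by linarith
  define c where "c i = (-1) ^ (i + 1) * real (k choose i) / (?v * real i ^ DIM('a))" for i
  have av: "av s f z = (\<Sum>i=1..k. c i * ?J i)"
  proof -
    have "(\<lambda>w. diff_kernel k w * f (z + s *\<^sub>R w)) = (\<lambda>w. \<Sum>i=1..k. c i * (indicator (ball 0 (real i)) w * f (z + s *\<^sub>R w)))"
      unfolding diff_kernel_def c_def[symmetric] by (simp only: sum_distrib_right mult.assoc)
    moreover have "integrable lborel (\<lambda>w. c i * (indicator (ball 0 (real i)) w * f (z + s *\<^sub>R w)))" if "i \<in> {1..k}" for i
      using that s by (intro integrable_mult_right integrable_indicator_ball) auto
    ultimately show ?thesis unfolding av_def by (simp add: Bochner_Integration.integral_sum)
  qed
  have I: "?I i = ?J i / real i ^ DIM('a)" if "i > 0" for i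
  proof -
    have "?J i = (\<bar>real i\<bar> ^ DIM('a)) *\<^sub>R (LINT u|lborel. indicator (ball 0 (real i)) (real i *\<^sub>R u) * f (z + s *\<^sub>R (real i *\<^sub>R u)))"
      by (rule integral_lborel_scale) (use that in auto)
    also have "(\<lambda>u::'a. indicator (ball 0 (real i)) (real i *\<^sub>R u) * f (z + s *\<^sub>R (real i *\<^sub>R u))) = (\<lambda>u. indicator (ball 0 1) u * f (z + (real i * s) *\<^sub>R u))"
      using that by (auto simp: fun_eq_iff indicator_def mult.commute)
    finally show ?thesis using that by simp
  qed
  have "emeasure lborel (ball (0::'a) 1) = ennreal ?v" by (simp add: emeasure_lborel_ball)
  then have "measure lborel (ball (0::'a) 1) = ?v" by (simp add: measure_def)
  then have I0: "?I 0 = ?v * f z" by simp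
  have Ii: "integrable lborel (\<lambda>u. indicator (ball 0 1) u * f (z + (real i * s) *\<^sub>R u))" for i
  proof (cases "i = 0")
    case True
    then show ?thesis by (auto intro!: integrable_mult_left simp: emeasure_lborel_ball)
  next
    case False
    then show ?thesis using s by (intro integrable_indicator_ball) auto
  qed
  have "(LINT u|lborel. indicator (ball 0 1) u * (fdiff (s *\<^sub>R u) ^^ k) f z)
     = (LINT u|lborel. (\<Sum>i\<le>k. (-1) ^ (k - i) * real (k choose i) * (indicator (ball 0 1) u * f (z + (real i * s) *\<^sub>R u))))"
    unfolding funpow_fdiff_expansion sum_distrib_left by (simp add: mult_ac)
  also have "\<dots> = (\<Sum>i\<le>k. (-1) ^ (k - i) * real (k choose i) * ?I i)"
    by (subst Bochner_Integration.integral_sum) (auto intro!: Ii)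
  also have "\<dots> = (-1) ^ k * (?v * f z) + (\<Sum>i=1..k. (-1) ^ (k - i) * real (k choose i) * ?I i)"
    unfolding atMost_atLeast0 by (subst sum.atLeast_Suc_atMost) (simp_all only: I0 atLeast0AtMost One_nat_def, simp_all)
  also have "(\<Sum>i=1..k. (-1) ^ (k - i) * real (k choose i) * ?I i) =
     - ((-1) ^ k * ?v) * (\<Sum>i=1..k. c i * ?J i)"
    unfolding sum_distrib_left
  proof (rule sum.cong[OF refl])
    fix i assume i: "i \<in> {1..k}"
    have "(-1) ^ (k - i) = ((-1) ^ k * (-1) ^ i :: real)"
      using i by (metis atLeastAtMost_iff le_add_diff_inverse2 minus_one_power_iff mult.right_neutral mult_minus1_right power_add power_minus1_even mult.assoc mult_minus_left even_add)
    then show "(-1) ^ (k - i) * real (k choose i) * ?I i = - ((-1) ^ k * ?v) * (c i * ?J i)"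
      using v0 i by (simp add: I c_def)
  qed
  finally have "(LINT u|lborel. indicator (ball 0 1) u * (fdiff (s *\<^sub>R u) ^^ k) f z) = (-1) ^ k * ?v * (f z - av s f z)"
    unfolding av[symmetric] by (simp add: algebra_simps)
  moreover have "(-1) ^ k * (-1) ^ k = (1::real)" by (simp add: power_mult_distrib[symmetric])
  ultimately show ?thesis using v0 by (simp add: mult.assoc[symmetric])
qed

lemma minus_av_le:
  assumes s: "s > 0"
  shows "ennreal \<bar>f y - av s f y\<bar> \<le> ennreal (1 / unit_ball_vol DIM('a)) * osc k f s y"
proof -
  note [measurable] = loc_int_measurable[OF f]
  have "\<bar>f y - av s f y\<bar> = 1 / unit_ball_vol DIM('a) * \<bar>LINT u|lborel. indicator (ball 0 1) u * (fdiff (s *\<^sub>R u) ^^ k) f y\<bar>"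
    unfolding minus_av_eq_funpow_fdiff[OF s] by (simp add: abs_mult power_abs abs_divide)
  then have "ennreal \<bar>f y - av s f y\<bar> = ennreal (1 / unit_ball_vol DIM('a)) * ennreal \<bar>LINT u|lborel. indicator (ball 0 1) u * (fdiff (s *\<^sub>R u) ^^ k) f y\<bar>"
    by (simp only: ennreal_mult'[symmetric] divide_nonneg_nonneg unit_ball_vol_nonneg zero_le_one of_nat_0_le_iff) 
  also have "ennreal \<bar>LINT u|lborel. indicator (ball 0 1) u * (fdiff (s *\<^sub>R u) ^^ k) f y\<bar>
     \<le> (\<integral>\<^sup>+(u::'a). ennreal \<bar>indicator (ball 0 1) u * (fdiff (s *\<^sub>R u) ^^ k) f y\<bar> \<partial>lborel)"
    by (rule ennreal_abs_integral_le)
  also have "\<dots> = (\<integral>\<^sup>+(u::'a). indicator (ball 0 1) u * ennreal \<bar>(fdiff (0 + s *\<^sub>R u) ^^ k) f y\<bar> \<partial>lborel)"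
    by (intro nn_integral_cong) (auto simp: indicator_def)
  also have "\<dots> = osc k f s y"
    unfolding osc_def by (rule nn_integral_ball_eq_scaled_mean[OF _ s]) measurable
  finally show ?thesis by (simp add: mult_left_mono)
qed

text \<open>Both averages are compared with \<open>f y\<close>; the oscillation at scale
  \<open>s\<close> is absorbed into that at scale \<open>2 * s\<close> by doubling.\<close>

lemma av_diff_le:
  assumes s: "s > 0"
  shows "ennreal \<bar>av s f y - av (2 * s) f y\<bar> \<le> ennreal (1 / unit_ball_vol DIM('a)) * (ennreal (2 ^ DIM('a)) + 1) * osc k f (2 * s) y"
proof -
  note [measurable] = loc_int_measurable[OF f]
  let ?c = "ennreal (1 / unit_ball_vol DIM('a))"
  have "ennreal \<bar>av s f y - av (2 * s) f y\<bar> = ennreal \<bar>(f y - av (2 * s) f y) - (f y - av s f y)\<bar>"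
    by simp
  also have "\<dots> \<le> ennreal \<bar>f y - av (2 * s) f y\<bar> + ennreal \<bar>f y - av s f y\<bar>" by (rule ennreal_abs_diff_le)
  also have "\<dots> \<le> ?c * osc k f (2 * s) y + ?c * osc k f s y"
    using s by (intro add_mono minus_av_le) auto
  also have "\<dots> \<le> ?c * osc k f (2 * s) y + ?c * (ennreal (2 ^ DIM('a)) * osc k f (2 * s) y)"
    using s by (intro add_mono mult_left_mono osc_doubling) auto
  finally show ?thesis by (simp add: distrib_left distrib_right mult_ac add_ac)
qed

text \<open>The difference of squares is factored using \<open>av_commute\<close>. The inner
  difference is bounded pointwise by \<open>osc\<close>; the outer averages, at scales
  \<open>s\<close> and \<open>2 * s\<close>, turn this into a mean over positions, which the
  seminorm does control.\<close>

lemma av_av_diff_le: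
  assumes s: "s > 0"
  shows "ennreal \<bar>av s (av s f) z - av (2 * s) (av (2 * s) f) z\<bar> \<le>
    ennreal (diff_kernel_bound TYPE('a) k) * (ennreal (1 / unit_ball_vol DIM('a)) * (ennreal (2 ^ DIM('a)) + 1)) * (ennreal (2 ^ DIM('a)) + 1)
      * scaled_mean (real k) (2 * s) (osc k f (2 * s)) z"
proof -
  note [measurable] = loc_int_measurable[OF f]
  let ?c = "ennreal (1 / unit_ball_vol DIM('a)) * (ennreal (2 ^ DIM('a)) + 1)" and ?B = "ennreal (diff_kernel_bound TYPE('a) k)"
  let ?g = "\<lambda>x. av s f x - av (2 * s) f x" and ?N = "scaled_mean (real k) (2 * s) (osc k f (2 * s)) z"
  have li: "loc_int (av s f)" "loc_int (av (2 * s) f)" using f s by (auto intro: loc_int_av)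
  have g[measurable]: "?g \<in> borel_measurable borel" by measurable
  have a: "ennreal \<bar>av t ?g z\<bar> \<le> ?B * (?c * scaled_mean (real k) t (osc k f (2 * s)) z)" if "t > 0" for t
  proof -
    have "ennreal \<bar>av t ?g z\<bar> \<le> ?B * scaled_mean (real k) t (\<lambda>y. ennreal \<bar>?g y\<bar>) z"
      by (rule av_le[OF g that])
    also have "\<dots> \<le> ?B * scaled_mean (real k) t (\<lambda>y. ?c * osc k f (2 * s) y) z"
      by (intro mult_left_mono scaled_mean_mono av_diff_le s) auto
    finally show ?thesis by (simp add: scaled_mean_cmult)
  qed
  have "av s (av s f) z - av (2 * s) (av (2 * s) f) z = av s ?g z + av (2 * s) ?g z"
    using s li av_commute[OF f, of s "2 * s" z] by (simp add: av_diff)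
  then have "ennreal \<bar>av s (av s f) z - av (2 * s) (av (2 * s) f) z\<bar> \<le> ennreal \<bar>av s ?g z\<bar> + ennreal \<bar>av (2 * s) ?g z\<bar>"
    by (simp only: ennreal_abs_add_le)
  also have "\<dots> \<le> ?B * (?c * scaled_mean (real k) s (osc k f (2 * s)) z) + ?B * (?c * ?N)"
    using s by (intro add_mono a) auto
  also have "\<dots> \<le> ?B * (?c * (ennreal (2 ^ DIM('a)) * ?N)) + ?B * (?c * ?N)"
    using s by (intro add_mono mult_left_mono scaled_mean_doubling) auto
  finally show ?thesis by (simp add: distrib_left distrib_right mult_ac)
qed

lemma av_av_telescope:
  assumes s: "s > 0"
  shows "ennreal \<bar>av s (av s f) z\<bar> \<le>
    ennreal (diff_kernel_bound TYPE('a) k) * (ennreal (1 / unit_ball_vol DIM('a)) * (ennreal (2 ^ DIM('a)) + 1)) * (ennreal (2 ^ DIM('a)) + 1)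
      * (\<Sum>m<M. scaled_mean (real k) (2 ^ Suc m * s) (osc k f (2 ^ Suc m * s)) z) + ennreal \<bar>av (2 ^ M * s) (av (2 ^ M * s) f) z\<bar>"
proof (induction M)
  case (Suc M)
  let ?C = "ennreal (diff_kernel_bound TYPE('a) k) * (ennreal (1 / unit_ball_vol DIM('a)) * (ennreal (2 ^ DIM('a)) + 1)) * (ennreal (2 ^ DIM('a)) + 1)"
  let ?X = "\<lambda>M. av (2 ^ M * s) (av (2 ^ M * s) f) z" and ?N = "\<lambda>m. scaled_mean (real k) (2 ^ m * s) (osc k f (2 ^ m * s)) z"
  have "ennreal \<bar>?X M\<bar> = ennreal \<bar>(?X M - ?X (Suc M)) + ?X (Suc M)\<bar>" by simp
  also have "\<dots> \<le> ennreal \<bar>?X M - ?X (Suc M)\<bar> + ennreal \<bar>?X (Suc M)\<bar>" by (rule ennreal_abs_add_le)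
  also have "ennreal \<bar>?X M - ?X (Suc M)\<bar> \<le> ?C * ?N (Suc M)"
    using av_av_diff_le[of "2 ^ M * s" z] s by (simp add: mult.assoc)
  finally have "ennreal \<bar>?X M\<bar> \<le> ?C * ?N (Suc M) + ennreal \<bar>?X (Suc M)\<bar>" by (simp add: add_right_mono)
  then have "ennreal \<bar>av s (av s f) z\<bar> \<le> ?C * (\<Sum>m<M. ?N (Suc m)) + (?C * ?N (Suc M) + ennreal \<bar>?X (Suc M)\<bar>)"
    by (intro order_trans[OF Suc] add_left_mono)
  then show ?case by (simp add: distrib_left add_ac)
qed simp

text \<open>With A the average at scale \<open>t\<close>, f = (f - A f) + A (f - A f) + A A f. The
  first part leaves an oscillation at the point \<open>z\<close> itself; it becomes a mean only when
  integrated against the heat kernel.\<close>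

lemma pointwise_le_mean_osc:
  assumes t: "t > 0"
  shows "ennreal \<bar>f z\<bar> \<le> ennreal (1 / unit_ball_vol DIM('a)) * osc k f t z
     + ennreal (diff_kernel_bound TYPE('a) k) * (ennreal (1 / unit_ball_vol DIM('a)) * scaled_mean (real k) t (osc k f t) z)
     + ennreal \<bar>av t (av t f) z\<bar>"
proof -
  note [measurable] = loc_int_measurable[OF f]
  let ?r = "\<lambda>x. f x - av t f x"
  have eq: "?r z + (av t ?r z + av t (av t f) z) = f z"
    using f t by (simp add: av_diff loc_int_av)
  have "ennreal \<bar>?r z + (av t ?r z + av t (av t f) z)\<bar> \<le> ennreal \<bar>?r z\<bar> + (ennreal \<bar>av t ?r z\<bar> + ennreal \<bar>av t (av t f) z\<bar>)"
    by (intro order_trans[OF ennreal_abs_add_le add_left_mono] ennreal_abs_add_le)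
  then have "ennreal \<bar>f z\<bar> \<le> ennreal \<bar>?r z\<bar> + (ennreal \<bar>av t ?r z\<bar> + ennreal \<bar>av t (av t f) z\<bar>)"
    unfolding eq .
  also have "\<dots> \<le> ennreal (1 / unit_ball_vol DIM('a)) * osc k f t z
     + (ennreal (diff_kernel_bound TYPE('a) k) * scaled_mean (real k) t (\<lambda>y. ennreal (1 / unit_ball_vol DIM('a)) * osc k f t y) z
     + ennreal \<bar>av t (av t f) z\<bar>)"
  proof (intro add_mono minus_av_le t order_refl)
    have "ennreal \<bar>av t ?r z\<bar> \<le> ennreal (diff_kernel_bound TYPE('a) k) * scaled_mean (real k) t (\<lambda>y. ennreal \<bar>?r y\<bar>) z"
      using t by (intro av_le) measurable
    also have "\<dots> \<le> ennreal (diff_kernel_bound TYPE('a) k) * scaled_mean (real k) t (\<lambda>y. ennreal (1 / unit_ball_vol DIM('a)) * osc k f t y) z"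
      by (intro mult_left_mono scaled_mean_mono minus_av_le t) auto
    finally show "ennreal \<bar>av t ?r z\<bar> \<le> ennreal (diff_kernel_bound TYPE('a) k) * scaled_mean (real k) t (\<lambda>y. ennreal (1 / unit_ball_vol DIM('a)) * osc k f t y) z" .
  qed
  finally show ?thesis by (simp add: scaled_mean_cmult add.assoc)
qed

end


section \<open>Decay of the averages at infinity and the pointwise bound\<close>

lemma ennreal_le_of_add_tendsto_0:
  fixes a S :: ennreal
  assumes le: "\<And>M. a \<le> S + b M" and b: "b \<longlonglongrightarrow> 0"
  shows "a \<le> S"
proof (rule ennreal_le_epsilon)
  fix e :: real assume "0 < e"
  then have "eventually (\<lambda>M. b M < ennreal e) sequentially"
    using order_tendstoD(2)[OF b] by simp
  then obtain M where "b M < ennreal e" by (auto simp: eventually_sequentially)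
  then show "a \<le> S + ennreal e" using le[of M] by (meson add_left_mono less_imp_le order_trans)
qed

lemma ennreal_cmult_tendsto_0:
  fixes b :: "nat \<Rightarrow> ennreal"
  assumes "b \<longlonglongrightarrow> 0" "c < \<infinity>" shows "(\<lambda>i. c * b i) \<longlonglongrightarrow> 0"
  using ennreal_tendsto_cmult[of c b 0 sequentially] assms by simp

lemma nn_integral_scaled_mean:
  fixes g :: "'a::euclidean_space \<Rightarrow> ennreal"
  assumes [measurable]: "g \<in> borel_measurable borel" and s: "s > 0" and \<rho>: "\<rho> \<ge> 0"
  shows "(\<integral>\<^sup>+z. scaled_mean \<rho> s g z \<partial>lborel) = ennreal (unit_ball_vol DIM('a) * \<rho> ^ DIM('a)) * (\<integral>\<^sup>+y. g y \<partial>lborel)"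
proof -
  have "(\<integral>\<^sup>+z. scaled_mean \<rho> s g z \<partial>lborel) = ennreal (1 / s ^ DIM('a)) * (\<integral>\<^sup>+z. \<integral>\<^sup>+y. (if dist z y < \<rho> * s then g y else 0) \<partial>lborel \<partial>lborel)"
    unfolding scaled_mean_def by (rule nn_integral_cmult) measurable
  also have "(\<integral>\<^sup>+z. \<integral>\<^sup>+y. (if dist z y < \<rho> * s then g y else 0) \<partial>lborel \<partial>lborel)
     = (\<integral>\<^sup>+y. \<integral>\<^sup>+z. (if dist z y < \<rho> * s then g y else 0) \<partial>lborel \<partial>lborel)"
    by (rule lborel_pair.Fubini') measurable
  also have "\<dots> = (\<integral>\<^sup>+y. g y * ennreal (unit_ball_vol DIM('a) * (\<rho> * s) ^ DIM('a)) \<partial>lborel)"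
  proof (rule nn_integral_cong)
    fix y :: 'a
    have "(\<integral>\<^sup>+z. (if dist z y < \<rho> * s then g y else 0) \<partial>lborel) = (\<integral>\<^sup>+z. g y * indicator (ball y (\<rho> * s)) z \<partial>lborel)"
      by (intro nn_integral_cong) (auto simp: indicator_def dist_commute)
    then show "(\<integral>\<^sup>+z. (if dist z y < \<rho> * s then g y else 0) \<partial>lborel) = g y * ennreal (unit_ball_vol DIM('a) * (\<rho> * s) ^ DIM('a))"
      using s \<rho> by (simp add: nn_integral_cmult_indicator emeasure_lborel_ball)
  qed
  also have "\<dots> = (\<integral>\<^sup>+y. g y \<partial>lborel) * ennreal (unit_ball_vol DIM('a) * (\<rho> * s) ^ DIM('a))"
    by (rule nn_integral_multc) measurable
  also have "ennreal (1 / s ^ DIM('a)) * ((\<integral>\<^sup>+y. g y \<partial>lborel) * ennreal (unit_ball_vol DIM('a) * (\<rho> * s) ^ DIM('a)))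
     = (ennreal (1 / s ^ DIM('a)) * ennreal (unit_ball_vol DIM('a) * (\<rho> * s) ^ DIM('a))) * (\<integral>\<^sup>+y. g y \<partial>lborel)"
    by (simp add: mult_ac)
  also have "ennreal (1 / s ^ DIM('a)) * ennreal (unit_ball_vol DIM('a) * (\<rho> * s) ^ DIM('a)) = ennreal (unit_ball_vol DIM('a) * \<rho> ^ DIM('a))"
    using s \<rho> by (simp add: ennreal_mult[symmetric] power_mult_distrib)
  finally show ?thesis .
qed

lemma nn_integral_osc_eq:
  fixes f :: "'a::euclidean_space \<Rightarrow> real"
  assumes [measurable]: "f \<in> borel_measurable borel"
  shows "(\<integral>\<^sup>+y. osc k f s y \<partial>lborel) =
    ennreal (1 / s ^ DIM('a)) * (\<integral>\<^sup>+h. (if norm h < s then (\<integral>\<^sup>+y. ennreal \<bar>(fdiff h ^^ k) f y\<bar> \<partial>lborel) else 0) \<partial>lborel)"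
proof -
  have "(\<integral>\<^sup>+y. osc k f s y \<partial>lborel) = ennreal (1 / s ^ DIM('a)) *
     (\<integral>\<^sup>+(y::'a). \<integral>\<^sup>+(h::'a). (if dist 0 h < 1 * s then ennreal \<bar>(fdiff h ^^ k) f y\<bar> else 0) \<partial>lborel \<partial>lborel)"
    unfolding osc_def scaled_mean_def by (rule nn_integral_cmult) measurable
  also have "(\<integral>\<^sup>+(y::'a). \<integral>\<^sup>+(h::'a). (if dist 0 h < 1 * s then ennreal \<bar>(fdiff h ^^ k) f y\<bar> else 0) \<partial>lborel \<partial>lborel)
     = (\<integral>\<^sup>+(h::'a). \<integral>\<^sup>+(y::'a). (if dist 0 h < 1 * s then ennreal \<bar>(fdiff h ^^ k) f y\<bar> else 0) \<partial>lborel \<partial>lborel)"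
    by (rule lborel_pair.Fubini') measurable
  also have "\<dots> = (\<integral>\<^sup>+h. (if norm h < s then (\<integral>\<^sup>+y. ennreal \<bar>(fdiff h ^^ k) f y\<bar> \<partial>lborel) else 0) \<partial>lborel)"
    by (intro nn_integral_cong) (auto simp: dist_norm)
  finally show ?thesis .
qed

text \<open>On |h| < s the factor s^(n+\<beta>) / |h|^(n+\<beta>) is at least 1 and may be inserted;
  dividing by s^n leaves s^\<beta>.\<close>

lemma nn_integral_osc_le_W_norm:
  fixes f :: "'a::euclidean_space \<Rightarrow> real"
  assumes [measurable]: "f \<in> borel_measurable borel" and \<beta>: "\<beta> > 0" and s: "s > 0"
  shows "(\<integral>\<^sup>+y. osc (1 + nat \<lfloor>\<beta>\<rfloor>) f s y \<partial>lborel) \<le> ennreal (s powr \<beta>) * W_norm \<beta> f"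
proof -
  define k where "k = 1 + nat \<lfloor>\<beta>\<rfloor>"
  let ?n = "real DIM('a)"
  let ?I = "\<lambda>h. \<integral>\<^sup>+y. ennreal \<bar>(fdiff h ^^ k) f y\<bar> \<partial>lborel"
  have "(\<integral>\<^sup>+h. (if norm h < s then ?I h else 0) \<partial>lborel)
     \<le> (\<integral>\<^sup>+h. ennreal (s powr (?n + \<beta>)) * (?I h / ennreal (norm h powr (?n + \<beta>))) \<partial>lborel)"
  proof (rule nn_integral_mono_AE)
    have "AE h in lborel. h \<noteq> (0::'a)" by (rule AE_lborel_singleton)
    then show "AE h in lborel. (if norm h < s then ?I h else 0) \<le> ennreal (s powr (?n + \<beta>)) * (?I h / ennreal (norm h powr (?n + \<beta>)))"
    proof eventually_elim
      fix h :: 'a assume h: "h \<noteq> 0"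
      show "(if norm h < s then ?I h else 0) \<le> ennreal (s powr (?n + \<beta>)) * (?I h / ennreal (norm h powr (?n + \<beta>)))"
      proof (cases "norm h < s")
        case True
        have p: "norm h powr (?n + \<beta>) > 0" using h by simp
        have "norm h powr (?n + \<beta>) \<le> s powr (?n + \<beta>)" using True \<beta> by (intro powr_mono2) auto
        then have "1 \<le> s powr (?n + \<beta>) / norm h powr (?n + \<beta>)" using p by (simp add: le_divide_eq)
        then have "1 \<le> ennreal (s powr (?n + \<beta>)) / ennreal (norm h powr (?n + \<beta>))"
          using p by (simp add: divide_ennreal)
        from mult_left_mono[OF this, of "?I h"] have "?I h \<le> ?I h * (ennreal (s powr (?n + \<beta>)) / ennreal (norm h powr (?n + \<beta>)))"
          by simp
        then show ?thesis using True by (simp add: divide_ennreal_def mult_ac)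
      qed simp
    qed
  qed
  also have "\<dots> = ennreal (s powr (?n + \<beta>)) * W_norm \<beta> f"
    unfolding W_norm_altdef k_def[symmetric] by (rule nn_integral_cmult) measurable
  finally have "(\<integral>\<^sup>+y. osc k f s y \<partial>lborel) \<le> ennreal (1 / s ^ DIM('a)) * (ennreal (s powr (?n + \<beta>)) * W_norm \<beta> f)"
    by (subst nn_integral_osc_eq) (auto intro: mult_left_mono)
  also have "\<dots> = ennreal (1 / s ^ DIM('a) * s powr (?n + \<beta>)) * W_norm \<beta> f"
    by (subst ennreal_mult) (use s in \<open>simp_all add: mult.assoc\<close>)
  also have "1 / s ^ DIM('a) * s powr (?n + \<beta>) = s powr \<beta>"
    using s by (simp add: powr_add powr_realpow)
  finally show ?thesis unfolding k_def .
qed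

lemma scaled_mean_osc_le_W_norm:
  fixes f :: "'a::euclidean_space \<Rightarrow> real" and \<beta> :: real
  assumes f: "f \<in> borel_measurable borel" and \<beta>: "\<beta> > 0" and s: "s > 0"
  shows "scaled_mean \<rho> s (osc (1 + nat \<lfloor>\<beta>\<rfloor>) f s) z \<le> ennreal (s powr (\<beta> - DIM('a))) * W_norm \<beta> f"
proof -
  have "scaled_mean \<rho> s (osc (1 + nat \<lfloor>\<beta>\<rfloor>) f s) z \<le> ennreal (1 / s ^ DIM('a)) * (ennreal (s powr \<beta>) * W_norm \<beta> f)"
    by (intro order_trans[OF scaled_mean_le_total] mult_left_mono nn_integral_osc_le_W_norm f s) (use \<beta> in auto)
  also have "\<dots> = ennreal (1 / s ^ DIM('a) * s powr \<beta>) * W_norm \<beta> f"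
    by (subst ennreal_mult) (use s in \<open>simp_all add: mult.assoc\<close>)
  also have "1 / s ^ DIM('a) * s powr \<beta> = s powr (\<beta> - DIM('a))"
    using s by (simp add: powr_diff powr_realpow)
  finally show ?thesis .
qed

lemma loc_int_test_function:
  assumes f: "f \<in> test_functions" shows "(\<integral>\<^sup>+x. ennreal \<bar>f x\<bar> \<partial>lborel) < \<infinity>" "loc_int (f :: 'a::euclidean_space \<Rightarrow> real)"
proof -
  obtain R where R: "R > 0" "\<And>x. norm x > R \<Longrightarrow> f x = 0" using test_functions_support[OF f] by blast
  obtain A where A: "A > 0" "\<And>x. \<bar>f x\<bar> \<le> A" using test_functions_bounded[OF f] by blast
  have "(\<integral>\<^sup>+x. ennreal \<bar>f x\<bar> \<partial>lborel) \<le> (\<integral>\<^sup>+(x::'a). ennreal A * indicator (ball 0 (2 * R)) x \<partial>lborel)"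
  proof (rule nn_integral_mono)
    fix x
    show "ennreal \<bar>f x\<bar> \<le> ennreal A * indicator (ball 0 (2 * R)) x"
      using A(2)[of x] R(1) R(2)[of x] by (cases "norm x > R") (auto simp: indicator_def ennreal_leI)
  qed
  also have "\<dots> < \<infinity>" using R by (simp add: nn_integral_cmult_indicator emeasure_lborel_ball ennreal_mult_less_top)
  finally show i: "(\<integral>\<^sup>+x. ennreal \<bar>f x\<bar> \<partial>lborel) < \<infinity>" .
  have "(\<integral>\<^sup>+x. (if norm x < R then ennreal \<bar>f x\<bar> else 0) \<partial>lborel) \<le> (\<integral>\<^sup>+x. ennreal \<bar>f x\<bar> \<partial>lborel)" for R
    by (intro nn_integral_mono) auto
  then show "loc_int f" unfolding loc_int_def using i test_functions_measurable[OF f] by (auto intro: le_less_trans)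
qed

text \<open>What later arguments retain of a Cauchy sequence: a uniform bound \<omega> of the
  seminorms, obtained from an index after which all terms are within 1 of \<open>\<phi> N\<close>,
  and local convergence in L^1. No comparison of \<omega> with the seminorm of the limit is
  made.\<close>

lemma W_space_approx:
  fixes f :: "'a::euclidean_space \<Rightarrow> real"
  assumes "f \<in> W_space \<beta>" and \<beta>: "\<beta> > 0"
  shows "\<exists>\<phi> \<omega>. (\<forall>j::nat. \<phi> j \<in> test_functions \<and> W_norm \<beta> (\<phi> j) \<le> \<omega>) \<and> \<omega> < \<infinity> \<and>
    (\<forall>R. (\<lambda>j. \<integral>\<^sup>+x. (if norm x < R then ennreal \<bar>\<phi> j x - f x\<bar> else 0) \<partial>lborel) \<longlonglongrightarrow> 0)"
proof -
  from assms(1) obtain \<phi> where \<phi>: "\<And>j. \<phi> j \<in> test_functions"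
    and cauchy: "\<And>e. e > 0 \<Longrightarrow> \<exists>N. \<forall>i\<ge>N. \<forall>j\<ge>N. W_norm \<beta> (\<lambda>x. \<phi> i x - \<phi> j x) < ennreal e"
    and lim: "\<And>K. compact K \<Longrightarrow> (\<lambda>j. \<integral>\<^sup>+ x\<in>K. ennreal \<bar>\<phi> j x - f x\<bar> \<partial>lborel) \<longlonglongrightarrow> 0"
    and f[measurable]: "f \<in> borel_measurable borel"
    unfolding W_space_def by blast
  have [measurable]: "\<phi> j \<in> borel_measurable borel" for j using \<phi> by (rule test_functions_measurable)
  obtain N where N: "\<And>i j. i \<ge> N \<Longrightarrow> j \<ge> N \<Longrightarrow> W_norm \<beta> (\<lambda>x. \<phi> i x - \<phi> j x) < ennreal 1"
    using cauchy[of 1] by auto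
  show ?thesis
  proof (intro exI[of _ "\<lambda>j. \<phi> (j + N)"] exI[of _ "1 + W_norm \<beta> (\<phi> N)"] conjI allI)
    show "1 + W_norm \<beta> (\<phi> N) < \<infinity>" using W_norm_test_lt_top[OF \<phi> \<beta>] by simp
    show "W_norm \<beta> (\<phi> (j + N)) \<le> 1 + W_norm \<beta> (\<phi> N)" for j
    proof -
      have "W_norm \<beta> (\<lambda>x. (\<phi> (j + N) x - \<phi> N x) + \<phi> N x) \<le> W_norm \<beta> (\<lambda>x. \<phi> (j + N) x - \<phi> N x) + W_norm \<beta> (\<phi> N)"
        by (intro W_norm_add_le) measurable
      also have "\<dots> \<le> 1 + W_norm \<beta> (\<phi> N)"
        using N[of "j + N" N] by (intro add_right_mono) simp
      finally show ?thesis by simp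
    qed
    fix R
    have 1: "(\<lambda>j. \<integral>\<^sup>+ x\<in>cball 0 R. ennreal \<bar>\<phi> (j + N) x - f x\<bar> \<partial>lborel) \<longlonglongrightarrow> 0"
      using lim[OF compact_cball[of 0 R]] by (rule LIMSEQ_ignore_initial_segment)
    show "(\<lambda>j. \<integral>\<^sup>+x. (if norm x < R then ennreal \<bar>\<phi> (j + N) x - f x\<bar> else 0) \<partial>lborel) \<longlonglongrightarrow> 0"
      by (rule tendsto_sandwich[OF _ _ tendsto_const 1])
        (auto intro!: always_eventually nn_integral_mono simp: indicator_def)
  qed (use \<phi> in auto)
qed

lemma W_space_loc_int:
  fixes f :: "'a::euclidean_space \<Rightarrow> real"
  assumes f: "f \<in> W_space \<beta>" and \<beta>: "\<beta> > 0"
  shows "loc_int f"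
proof -
  have [measurable]: "f \<in> borel_measurable borel" using f by (simp add: W_space_def)
  from W_space_approx[OF f \<beta>] obtain \<phi> \<omega>
    where \<phi>': "\<forall>j::nat. \<phi> j \<in> test_functions \<and> W_norm \<beta> (\<phi> j) \<le> \<omega>"
      and lim': "\<forall>R. (\<lambda>j. \<integral>\<^sup>+x. (if norm x < R then ennreal \<bar>\<phi> j x - f x\<bar> else 0) \<partial>lborel) \<longlonglongrightarrow> 0"
    by (elim exE conjE)
  have \<phi>: "\<phi> j \<in> test_functions" for j using \<phi>' by blast
  note lim = lim'[rule_format]
  have [measurable]: "\<phi> j \<in> borel_measurable borel" for j using \<phi> by (rule test_functions_measurable)
  have "(\<integral>\<^sup>+x. (if norm x < R then ennreal \<bar>f x\<bar> else 0) \<partial>lborel) < \<infinity>" for R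
  proof -
    have "eventually (\<lambda>j. (\<integral>\<^sup>+x. (if norm x < R then ennreal \<bar>\<phi> j x - f x\<bar> else 0) \<partial>lborel) < 1) sequentially"
      using order_tendstoD(2)[OF lim[of R], of 1] by simp
    then obtain j where j: "(\<integral>\<^sup>+x. (if norm x < R then ennreal \<bar>\<phi> j x - f x\<bar> else 0) \<partial>lborel) < 1"
      by (auto simp: eventually_sequentially)
    have le: "ennreal \<bar>f x\<bar> \<le> ennreal \<bar>\<phi> j x\<bar> + ennreal \<bar>\<phi> j x - f x\<bar>" for x
      using ennreal_abs_diff_le[of "\<phi> j x" "\<phi> j x - f x"] by simp
    have "(\<integral>\<^sup>+x. (if norm x < R then ennreal \<bar>f x\<bar> else 0) \<partial>lborel) \<le>
       (\<integral>\<^sup>+x. (if norm x < R then ennreal \<bar>\<phi> j x\<bar> else 0) + (if norm x < R then ennreal \<bar>\<phi> j x - f x\<bar> else 0) \<partial>lborel)"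
      by (intro nn_integral_mono) (auto intro: le)
    also have "\<dots> = (\<integral>\<^sup>+x. (if norm x < R then ennreal \<bar>\<phi> j x\<bar> else 0) \<partial>lborel) + (\<integral>\<^sup>+x. (if norm x < R then ennreal \<bar>\<phi> j x - f x\<bar> else 0) \<partial>lborel)"
      by (rule nn_integral_add) measurable
    also have "\<dots> < \<infinity>"
      using loc_int_test_function(2)[OF \<phi>, of j] j by (auto simp: loc_int_def intro: less_trans)
    finally show ?thesis .
  qed
  then show ?thesis by (simp add: loc_int_def)
qed

text \<open>Letting the scale of the averages tend to infinity shows that an element of the completion
  is determined by its differences: nothing like an additive constant survives.\<close>

lemma pointwise_le_sum_scaled_mean_osc:
  assumes \<beta>: "0 < \<beta>" "\<beta> < real DIM('a::euclidean_space)" and k_def: "k = 1 + nat \<lfloor>\<beta>\<rfloor>"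
  obtains C :: real where "C > 0" "\<And>(f :: 'a \<Rightarrow> real) t z. f \<in> W_space \<beta> \<Longrightarrow> t > 0 \<Longrightarrow>
     ennreal \<bar>f z\<bar> \<le> ennreal C * (osc k f t z + (\<Sum>m. scaled_mean (real k) (2 ^ m * t) (osc k f (2 ^ m * t)) z))"
proof -
  have k: "k > 0" by (simp add: k_def)
  interpret averaging_kernel "diff_kernel k :: 'a \<Rightarrow> real" "diff_kernel_bound TYPE('a) k" "real k"
    by (rule averaging_kernel_diff_kernel[OF k])
  let ?B = "ennreal (diff_kernel_bound TYPE('a) k)" and ?c = "ennreal (1 / unit_ball_vol DIM('a))"
  define D where "D = ?B * (?c * (ennreal (2 ^ DIM('a)) + 1)) * (ennreal (2 ^ DIM('a)) + 1)"
  have D: "D < \<infinity>" by (simp add: D_def ennreal_mult_less_top)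
  define d where "d = real DIM('a) - \<beta>"
  have d: "d > 0" using \<beta> by (simp add: d_def)
  define G where "G = (\<Sum>m::nat. ennreal ((2 powr (-d)) ^ m))"
  have G: "G < \<infinity>" unfolding G_def by (rule suminf_powr_lt_top[OF d])
  let ?N = "\<lambda>f s m z. scaled_mean (real k) (2 ^ m * s) (osc k f (2 ^ m * s)) z"
  have scale_to_0: "(\<lambda>M. ennreal (c / (2 ^ M * s) powr e)) \<longlonglongrightarrow> 0" if "s > 0" "e > 0" for c s e :: real
  proof -
    have "filterlim (\<lambda>M::nat. s * 2 ^ M) at_top sequentially"
    proof (rule filterlim_tendsto_pos_mult_at_top[OF tendsto_const \<open>s > 0\<close>])
      show "filterlim (\<lambda>M::nat. 2 ^ M :: real) at_top sequentially"
        by (rule filterlim_at_top_mono[OF filterlim_real_sequentially]) (auto intro!: always_eventually less_imp_le of_nat_less_two_power)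
    qed
    then have "(\<lambda>M::nat. (2 ^ M * s) powr (-e)) \<longlonglongrightarrow> 0"
      using that by (intro tendsto_neg_powr) (auto simp: mult.commute)
    from tendsto_mult_left[OF this, of c] have "(\<lambda>M::nat. c * (2 ^ M * s) powr (-e)) \<longlonglongrightarrow> 0" by simp
    then have "(\<lambda>M::nat. c / (2 ^ M * s) powr e) \<longlonglongrightarrow> 0" by (simp add: powr_minus divide_inverse)
    from tendsto_ennrealI[OF this] show ?thesis by simp
  qed
  \<comment> \<open>A test function is integrable, so its double average at scale s is O(s^(-n)) and
    the telescoping can be carried to infinity. The terms then form a geometric series of ratio
    2^(-d). The final bound involves the seminorm alone, not the L^1 norm, so it can survive a limit
    of test functions.\<close>
  have test_case: "ennreal \<bar>av s (av s \<phi>) z\<bar> \<le> D * (G * (ennreal (s powr (-d)) * W_norm \<beta> \<phi>))"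
    if \<phi>: "\<phi> \<in> test_functions" and s: "s > 0" for \<phi> :: "'a \<Rightarrow> real" and s z
  proof -
    have [measurable]: "\<phi> \<in> borel_measurable borel" using \<phi> by (rule test_functions_measurable)
    let ?X = "\<lambda>M. ennreal \<bar>av (2 ^ M * s) (av (2 ^ M * s) \<phi>) z\<bar>"
    define Q where "Q = diff_kernel_bound TYPE('a) k * diff_kernel_bound TYPE('a) k * (unit_ball_vol DIM('a) * real k ^ DIM('a))"
    have X0: "?X \<longlonglongrightarrow> 0"
    proof (rule tendsto_sandwich[OF _ _ tendsto_const])
      show "\<forall>\<^sub>F M in sequentially. ?X M \<le> (\<integral>\<^sup>+x. ennreal \<bar>\<phi> x\<bar> \<partial>lborel) * ennreal (Q / (2 ^ M * s) powr real DIM('a))"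
      proof (intro always_eventually allI)
        fix M
        have "?X M \<le> ennreal (Q / (2 ^ M * s) ^ DIM('a)) *
           (\<integral>\<^sup>+y. (if dist z y < real k * (2 ^ M * s + 2 ^ M * s) then ennreal \<bar>\<phi> y\<bar> else 0) \<partial>lborel)"
          using av_av_le[of \<phi> "2 ^ M * s" "2 ^ M * s" z] s by (simp add: Q_def)
        also have "\<dots> \<le> ennreal (Q / (2 ^ M * s) ^ DIM('a)) * (\<integral>\<^sup>+x. ennreal \<bar>\<phi> x\<bar> \<partial>lborel)"
          by (intro mult_left_mono nn_integral_mono) auto
        finally show "?X M \<le> (\<integral>\<^sup>+x. ennreal \<bar>\<phi> x\<bar> \<partial>lborel) * ennreal (Q / (2 ^ M * s) powr real DIM('a))"
          using s by (simp add: powr_realpow mult.commute)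
      qed
      show "(\<lambda>M. (\<integral>\<^sup>+x. ennreal \<bar>\<phi> x\<bar> \<partial>lborel) * ennreal (Q / (2 ^ M * s) powr real DIM('a))) \<longlonglongrightarrow> 0"
        using s loc_int_test_function(1)[OF \<phi>] by (intro ennreal_cmult_tendsto_0 scale_to_0) auto
    qed simp
    have "ennreal \<bar>av s (av s \<phi>) z\<bar> \<le> D * (\<Sum>m. ?N \<phi> s (Suc m) z)"
    proof (rule ennreal_le_of_add_tendsto_0[OF _ X0])
      fix M
      have "ennreal \<bar>av s (av s \<phi>) z\<bar> \<le> D * (\<Sum>m<M. ?N \<phi> s (Suc m) z) + ?X M"
        unfolding D_def by (rule av_av_telescope[OF k loc_int_test_function(2)[OF \<phi>] s])
      also have "\<dots> \<le> D * (\<Sum>m. ?N \<phi> s (Suc m) z) + ?X M"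
        by (intro add_right_mono mult_left_mono sum_le_suminf) auto
      finally show "ennreal \<bar>av s (av s \<phi>) z\<bar> \<le> D * (\<Sum>m. ?N \<phi> s (Suc m) z) + ?X M" .
    qed
    also have "\<dots> \<le> D * (\<Sum>m. ennreal ((2 powr (-d)) ^ m) * (ennreal (s powr (-d)) * W_norm \<beta> \<phi>))"
    proof (intro mult_left_mono suminf_le)
      fix m
      have "?N \<phi> s (Suc m) z \<le> ennreal ((2 ^ Suc m * s) powr (- d)) * W_norm \<beta> \<phi>"
        using scaled_mean_osc_le_W_norm[of \<phi> \<beta> "2 ^ Suc m * s" "real k" z] s \<beta> by (simp add: k_def d_def)
      also have "\<dots> \<le> ennreal ((2 powr (-d)) ^ m * s powr (-d)) * W_norm \<beta> \<phi>"
      proof (intro mult_right_mono ennreal_leI)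
        have "(2 ^ Suc m * s) powr (- d) \<le> (2 ^ m * s) powr (- d)" using s d by (intro powr_mono2') auto
        also have "\<dots> = (2 powr (-d)) ^ m * s powr (-d)" using s by (simp only: powr_power_two powr_mult)
        finally show "(2 ^ Suc m * s) powr (- d) \<le> (2 powr (-d)) ^ m * s powr (-d)" .
      qed simp
      finally show "?N \<phi> s (Suc m) z \<le> ennreal ((2 powr (-d)) ^ m) * (ennreal (s powr (-d)) * W_norm \<beta> \<phi>)"
        by (simp add: ennreal_mult mult.assoc)
    qed auto
    finally show ?thesis by (simp add: ennreal_suminf_multc G_def)
  qed
  have avav0: "(\<lambda>M. ennreal \<bar>av (2 ^ M * t) (av (2 ^ M * t) f) z\<bar>) \<longlonglongrightarrow> 0"
    if f: "f \<in> W_space \<beta>" and t: "t > 0" for f :: "'a \<Rightarrow> real" and t z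
  proof -
    have li: "loc_int f" by (rule W_space_loc_int[OF f \<beta>(1)])
    have [measurable]: "f \<in> borel_measurable borel" using f by (simp add: W_space_def)
    from W_space_approx[OF f \<beta>(1)] obtain \<phi> \<omega>
      where \<phi>': "\<forall>j::nat. \<phi> j \<in> test_functions \<and> W_norm \<beta> (\<phi> j) \<le> \<omega>" and \<omega>1: "\<omega> < \<infinity>"
        and lim': "\<forall>R. (\<lambda>j. \<integral>\<^sup>+x. (if norm x < R then ennreal \<bar>\<phi> j x - f x\<bar> else 0) \<partial>lborel) \<longlonglongrightarrow> 0"
      by (elim exE conjE)
    have \<phi>: "\<phi> j \<in> test_functions" for j using \<phi>' by blast
    have \<omega>2: "W_norm \<beta> (\<phi> j) \<le> \<omega>" for j using \<phi>' by blast
    note \<omega> = \<omega>1 \<omega>2 and lim = lim'[rule_format]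
    have [measurable]: "\<phi> j \<in> borel_measurable borel" for j using \<phi> by (rule test_functions_measurable)
    \<comment> \<open>At a fixed scale the double average is continuous under local L^1 convergence,
      with error \<open>?b j\<close>. Hence \<open>f\<close> inherits the bound for test functions
      with \<omega> in place of the seminorm.\<close>
    have le: "ennreal \<bar>av s (av s f) z\<bar> \<le> D * (G * (ennreal (s powr (-d)) * \<omega>))" if s: "s > 0" for s
    proof -
      let ?q = "ennreal (diff_kernel_bound TYPE('a) k * diff_kernel_bound TYPE('a) k * (unit_ball_vol DIM('a) * real k ^ DIM('a) / s ^ DIM('a)))"
      let ?b = "\<lambda>j. ?q * (\<integral>\<^sup>+x. (if norm x < norm z + real k * (s + s) then ennreal \<bar>\<phi> j x - f x\<bar> else 0) \<partial>lborel)"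
      have "?b \<longlonglongrightarrow> 0" by (intro ennreal_cmult_tendsto_0 lim) simp
      moreover have "ennreal \<bar>av s (av s f) z\<bar> \<le> D * (G * (ennreal (s powr (-d)) * \<omega>)) + ?b j" for j
      proof -
        have "av s (av s (\<lambda>x. \<phi> j x - f x)) z = av s (av s (\<phi> j)) z - av s (av s f) z"
        proof -
          have "av s (\<lambda>x. \<phi> j x - f x) = (\<lambda>y. av s (\<phi> j) y - av s f y)"
            using av_diff[OF loc_int_test_function(2)[OF \<phi>] li s] by (rule ext)
          then show ?thesis using av_diff[OF loc_int_av[OF loc_int_test_function(2)[OF \<phi>] s] loc_int_av[OF li s] s] by simp
        qed
        then have "ennreal \<bar>av s (av s f) z\<bar> \<le> ennreal \<bar>av s (av s (\<phi> j)) z\<bar> + ennreal \<bar>av s (av s (\<lambda>x. \<phi> j x - f x)) z\<bar>"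
          using ennreal_abs_diff_le[of "av s (av s (\<phi> j)) z" "av s (av s (\<phi> j)) z - av s (av s f) z"] by simp
        also have "\<dots> \<le> D * (G * (ennreal (s powr (-d)) * \<omega>)) + ?b j"
        proof (rule add_mono)
          have "ennreal \<bar>av s (av s (\<phi> j)) z\<bar> \<le> D * (G * (ennreal (s powr (-d)) * W_norm \<beta> (\<phi> j)))" by (rule test_case[OF \<phi> s])
          also have "\<dots> \<le> D * (G * (ennreal (s powr (-d)) * \<omega>))" by (intro mult_left_mono \<omega>) auto
          finally show "ennreal \<bar>av s (av s (\<phi> j)) z\<bar> \<le> D * (G * (ennreal (s powr (-d)) * \<omega>))" .
          have "norm x < norm z + real k * (s + s)" if "dist z x < real k * (s + s)" for x
            using that norm_triangle_ineq2[of x z] by (simp add: dist_norm norm_minus_commute)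
          then have "(\<integral>\<^sup>+x. (if dist z x < real k * (s + s) then ennreal \<bar>\<phi> j x - f x\<bar> else 0) \<partial>lborel) \<le>
            (\<integral>\<^sup>+x. (if norm x < norm z + real k * (s + s) then ennreal \<bar>\<phi> j x - f x\<bar> else 0) \<partial>lborel)"
            by (intro nn_integral_mono) auto
          moreover have "ennreal \<bar>av s (av s (\<lambda>x. \<phi> j x - f x)) z\<bar> \<le> ?q * (\<integral>\<^sup>+x. (if dist z x < real k * (s + s) then ennreal \<bar>\<phi> j x - f x\<bar> else 0) \<partial>lborel)"
            by (rule av_av_le[OF _ s s]) measurable
          ultimately show "ennreal \<bar>av s (av s (\<lambda>x. \<phi> j x - f x)) z\<bar> \<le> ?b j"
            by (meson mult_left_mono order_trans zero_le)
        qed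
        finally show ?thesis .
      qed
      ultimately show ?thesis by (rule ennreal_le_of_add_tendsto_0[rotated])
    qed
    show ?thesis
    proof (rule tendsto_sandwich[OF _ _ tendsto_const])
      show "\<forall>\<^sub>F M in sequentially. ennreal \<bar>av (2 ^ M * t) (av (2 ^ M * t) f) z\<bar> \<le> (D * G * \<omega>) * ennreal (1 / (2 ^ M * t) powr d)"
      proof (intro always_eventually allI)
        fix M
        show "ennreal \<bar>av (2 ^ M * t) (av (2 ^ M * t) f) z\<bar> \<le> (D * G * \<omega>) * ennreal (1 / (2 ^ M * t) powr d)"
          using le[of "2 ^ M * t"] t by (simp add: powr_minus divide_inverse mult_ac)
      qed
      show "(\<lambda>M. (D * G * \<omega>) * ennreal (1 / (2 ^ M * t) powr d)) \<longlonglongrightarrow> 0"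
        using D G \<omega>(1) t d by (intro ennreal_cmult_tendsto_0 scale_to_0) (auto simp: ennreal_mult_less_top)
    qed auto
  qed
  have "?c + ?B * ?c + D < \<infinity>" using D by (simp add: ennreal_mult_less_top)
  then obtain C0 where C0: "C0 \<ge> 0" "?c + ?B * ?c + D = ennreal C0" by (cases "?c + ?B * ?c + D") auto
  show ?thesis
  proof (rule that[of "C0 + 1"])
    show "C0 + 1 > 0" using C0 by simp
    fix f :: "'a \<Rightarrow> real" and t :: real and z
    assume f: "f \<in> W_space \<beta>" and t: "t > 0"
    have li: "loc_int f" by (rule W_space_loc_int[OF f \<beta>(1)])
    let ?S = "\<Sum>m. ?N f t m z"
    have "ennreal \<bar>f z\<bar> \<le> ?c * osc k f t z + ?B * (?c * ?S) + D * ?S"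
    proof (rule ennreal_le_of_add_tendsto_0[OF _ avav0[OF f t, of z]])
      fix M
      let ?X = "ennreal \<bar>av (2 ^ M * t) (av (2 ^ M * t) f) z\<bar>"
      have "ennreal \<bar>f z\<bar> \<le> ?c * osc k f t z + ?B * (?c * ?N f t 0 z) + ennreal \<bar>av t (av t f) z\<bar>"
        using pointwise_le_mean_osc[OF k li t, of z] by simp
      also have "\<dots> \<le> ?c * osc k f t z + ?B * (?c * ?N f t 0 z) + (D * (\<Sum>m<M. ?N f t (Suc m) z) + ?X)"
        unfolding D_def by (intro add_left_mono av_av_telescope[OF k li t])
      also have "\<dots> \<le> ?c * osc k f t z + ?B * (?c * ?S) + (D * ?S + ?X)"
      proof (intro add_mono mult_left_mono order_refl)
        show "?N f t 0 z \<le> ?S" by (rule suminf_ge_term_ennreal)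
        have "(\<Sum>m<M. ?N f t (Suc m) z) \<le> (\<Sum>m<Suc M. ?N f t m z)"
          by (subst sum.lessThan_Suc_shift) simp
        also have "\<dots> \<le> ?S" by (intro sum_le_suminf) auto
        finally show "(\<Sum>m<M. ?N f t (Suc m) z) \<le> ?S" .
      qed auto
      finally show "ennreal \<bar>f z\<bar> \<le> ?c * osc k f t z + ?B * (?c * ?S) + D * ?S + ?X" by (simp add: add.assoc)
    qed
    also have "\<dots> \<le> (?c + ?B * ?c + D) * (osc k f t z + ?S)"
    proof -
      have "?c * osc k f t z + ?B * (?c * ?S) + D * ?S = ?c * osc k f t z + (?B * ?c + D) * ?S"
        by (simp add: distrib_right mult_ac add_ac)
      also have "\<dots> \<le> (?c + ?B * ?c + D) * osc k f t z + (?c + ?B * ?c + D) * ?S"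
        by (intro add_mono mult_right_mono) (auto simp: add.assoc)
      finally show ?thesis by (simp add: distrib_left)
    qed
    also have "\<dots> \<le> ennreal (C0 + 1) * (osc k f t z + ?S)"
      unfolding C0 by (intro mult_right_mono ennreal_leI) auto
    finally show "ennreal \<bar>f z\<bar> \<le> ennreal (C0 + 1) * (osc k f t z + ?S)" .
  qed
qed

section \<open>Caloric extension and dyadic level sums\<close>


lemma suminf_ennreal_swap:
  fixes f :: "nat \<Rightarrow> nat \<Rightarrow> ennreal"
  shows "(\<Sum>m. \<Sum>i. f m i) = (\<Sum>i. \<Sum>m. f m i)"
proof -
  have "(\<Sum>m. \<Sum>i. f m i) = (\<integral>\<^sup>+m. (\<Sum>i. f m i) \<partial>count_space UNIV)" by (simp add: nn_integral_count_space_nat)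
  also have "\<dots> = (\<Sum>i. \<integral>\<^sup>+m. f m i \<partial>count_space UNIV)" by (rule nn_integral_suminf) simp
  finally show ?thesis by (simp add: nn_integral_count_space_nat)
qed

lemma suminf_shift_le:
  fixes h :: "nat \<Rightarrow> ennreal" shows "(\<Sum>m. h (m + i)) \<le> (\<Sum>m. h m)"
  using suminf_offset[of h i] by (simp add: summableI)

text \<open>By assumption \<open>a\<close> is at most A / max(s, r)^n. The first i with r < 2^i s
  has 2^i s at most 2 max(s, r), which costs 2^n. Stating the bound with the whole sum avoids
  choosing i as a function of the point when it is integrated; the factor 1 in the condition matches
  \<open>scaled_mean 1\<close>.\<close>

lemma le_sum_dyadic_shells:
  fixes a :: ennreal and A r s :: real
  assumes s: "s > 0" and r: "r \<ge> 0" and A: "A \<ge> 0"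
    and a1: "a * ennreal (s ^ n) \<le> ennreal A" and a2: "a * ennreal (r ^ n) \<le> ennreal A"
  shows "a \<le> ennreal (2 ^ n * A) * (\<Sum>i. ennreal (1 / (2 ^ i * s) ^ n) * (if r < 1 * (2 ^ i * s) then 1 else 0))"
proof -
  have "a \<noteq> \<infinity>" using a1 s by (auto simp: ennreal_top_mult top_unique)
  then obtain b where b: "b \<ge> 0" "a = ennreal b" by (cases a) auto
  have b1: "b * s ^ n \<le> A" and b2: "b * r ^ n \<le> A"
    using a1 a2 s r A b by (simp_all add: ennreal_mult[symmetric])
  have "\<exists>i. r < 2 ^ i * s \<and> b \<le> 2 ^ n * A * (1 / (2 ^ i * s) ^ n)"
  proof (cases "r < s")
    case True
    have "b \<le> A / s ^ n" using b1 s by (simp add: le_divide_eq)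
    also have "\<dots> \<le> 2 ^ n * A * (1 / (2 ^ 0 * s) ^ n)"
      using s A mult_right_mono[of 1 "2 ^ n" "A / s ^ n"] by simp
    finally show ?thesis using True by (intro exI[of _ 0]) simp
  next
    case False
    then have "1 \<le> r / s" using s by simp
    then obtain j where j: "2 ^ j \<le> r / s" "r / s < 2 ^ Suc j" using dyadic_bracket by blast
    have j': "2 ^ j * s \<le> r" "r < 2 ^ Suc j * s" using j s by (simp_all add: le_divide_eq divide_less_eq)
    have "b * (2 ^ j * s) ^ n \<le> b * r ^ n" using j' s b by (intro mult_left_mono power_mono) auto
    then have "b * (2 ^ j * s) ^ n \<le> A" using b2 by simp
    then have "b \<le> A / (2 ^ j * s) ^ n" using s by (simp add: le_divide_eq)
    also have "\<dots> = 2 ^ n * A * (1 / (2 ^ Suc j * s) ^ n)" using s by (simp add: power_mult_distrib)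
    finally show ?thesis using j' by blast
  qed
  then obtain i where i: "r < 2 ^ i * s" "b \<le> 2 ^ n * A * (1 / (2 ^ i * s) ^ n)" by blast
  have "a \<le> ennreal (2 ^ n * A * (1 / (2 ^ i * s) ^ n))" unfolding b using i by (simp add: ennreal_leI)
  also have "\<dots> = ennreal (2 ^ n * A) * (ennreal (1 / (2 ^ i * s) ^ n) * (if r < 1 * (2 ^ i * s) then 1 else 0))"
    using i s A by (subst ennreal_mult) auto
  also have "\<dots> \<le> ennreal (2 ^ n * A) * (\<Sum>i. ennreal (1 / (2 ^ i * s) ^ n) * (if r < 1 * (2 ^ i * s) then 1 else 0))"
    by (intro mult_left_mono) (rule suminf_ge_term_ennreal[of _ i], simp)
  finally show ?thesis .
qed

text \<open>A kernel that is only O(min(s^(-n), |x - y|^(-n))) acts like a sum of ball means over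
  all dyadic radii from \<open>s\<close> upwards, without any decay in the radius.\<close>

lemma nn_integral_le_sum_scaled_mean:
  fixes a g :: "'a::euclidean_space \<Rightarrow> ennreal"
  assumes [measurable]: "g \<in> borel_measurable borel"
    and s: "s > 0" and A: "A \<ge> 0"
    and a: "\<And>y. a y * ennreal (s ^ DIM('a)) \<le> ennreal A" "\<And>y. a y * ennreal (dist x y ^ DIM('a)) \<le> ennreal A"
  shows "(\<integral>\<^sup>+y. a y * g y \<partial>lborel) \<le> ennreal (2 ^ DIM('a) * A) * (\<Sum>i. scaled_mean 1 (2 ^ i * s) g x)"
proof -
  have "(\<integral>\<^sup>+y. a y * g y \<partial>lborel)
     \<le> (\<integral>\<^sup>+y. ennreal (2 ^ DIM('a) * A) * (\<Sum>i. ennreal (1 / (2 ^ i * s) ^ DIM('a)) * (if dist x y < 1 * (2 ^ i * s) then g y else 0)) \<partial>lborel)"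
  proof (rule nn_integral_mono)
    fix y
    have "a y * g y \<le> ennreal (2 ^ DIM('a) * A) * (\<Sum>i. ennreal (1 / (2 ^ i * s) ^ DIM('a)) * (if dist x y < 1 * (2 ^ i * s) then 1 else 0)) * g y"
      by (intro mult_right_mono le_sum_dyadic_shells s A a) auto
    also have "\<dots> = ennreal (2 ^ DIM('a) * A) * (\<Sum>i. ennreal (1 / (2 ^ i * s) ^ DIM('a)) * (if dist x y < 1 * (2 ^ i * s) then 1 else 0) * g y)"
      by (subst mult.assoc, subst ennreal_suminf_multc) (rule refl)
    also have "(\<lambda>i. ennreal (1 / (2 ^ i * s) ^ DIM('a)) * (if dist x y < 1 * (2 ^ i * s) then 1 else 0) * g y)
      = (\<lambda>i. ennreal (1 / (2 ^ i * s) ^ DIM('a)) * (if dist x y < 1 * (2 ^ i * s) then g y else 0))"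
      by auto
    finally show "a y * g y \<le> ennreal (2 ^ DIM('a) * A) * (\<Sum>i. ennreal (1 / (2 ^ i * s) ^ DIM('a)) * (if dist x y < 1 * (2 ^ i * s) then g y else 0))" .
  qed
  also have "\<dots> = ennreal (2 ^ DIM('a) * A) * (\<integral>\<^sup>+y. (\<Sum>i. ennreal (1 / (2 ^ i * s) ^ DIM('a)) * (if dist x y < 1 * (2 ^ i * s) then g y else 0)) \<partial>lborel)"
    by (rule nn_integral_cmult) measurable
  also have "(\<integral>\<^sup>+y. (\<Sum>i. ennreal (1 / (2 ^ i * s) ^ DIM('a)) * (if dist x y < 1 * (2 ^ i * s) then g y else 0)) \<partial>lborel)
    = (\<Sum>i. \<integral>\<^sup>+y. ennreal (1 / (2 ^ i * s) ^ DIM('a)) * (if dist x y < 1 * (2 ^ i * s) then g y else 0) \<partial>lborel)"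
    by (rule nn_integral_suminf) measurable
  also have "\<dots> = (\<Sum>i. scaled_mean 1 (2 ^ i * s) g x)"
    unfolding scaled_mean_def by (intro suminf_cong nn_integral_cmult) measurable
  finally show ?thesis .
qed

text \<open>Everything averaged over radius 2^l: oscillations at this scale and at all finer ones,
  the index \<open>i\<close> counting the shells between the two scales. \<sigma> is 1 in the
  pointwise bound and n + 1 after passing to cells.\<close>

definition level_sum :: "nat \<Rightarrow> ('a::euclidean_space \<Rightarrow> real) \<Rightarrow> real \<Rightarrow> int \<Rightarrow> 'a \<Rightarrow> ennreal" where
  "level_sum k f \<sigma> l x = (\<Sum>i. scaled_mean \<sigma> (2 powr of_int l) (osc k f (2 powr of_int (l - int i))) x)"

lemma borel_measurable_level_sum[measurable]:
  assumes [measurable]: "f \<in> borel_measurable borel"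
  shows "level_sum k f \<sigma> l \<in> borel_measurable borel"
  unfolding level_sum_def[abs_def] by measurable

section \<open>Dilates of a decaying kernel\<close>

locale decaying_kernel =
  fixes q :: "'a::euclidean_space \<Rightarrow> real" and C :: real
  assumes q_measurable[measurable]: "q \<in> borel_measurable borel"
    and q_nonneg: "q x \<ge> 0" and C_pos: "C > 0" and q_le: "q x \<le> C" and q_decay: "norm x ^ DIM('a) * q x \<le> C"
    and q_integral: "(\<integral>\<^sup>+x. ennreal (q x) \<partial>lborel) \<le> ennreal C"
begin

definition dil :: "real \<Rightarrow> 'a \<Rightarrow> real" where
  "dil t x = q ((1 / t) *\<^sub>R x) / t ^ DIM('a)"

lemma dil_measurable[measurable]: "dil t \<in> borel_measurable borel"
  unfolding dil_def[abs_def] by measurable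

lemma dil_nonneg: "t > 0 \<Longrightarrow> dil t x \<ge> 0"
  by (simp add: dil_def q_nonneg)

lemma dil_le: "t > 0 \<Longrightarrow> dil t x * t ^ DIM('a) \<le> C"
  by (simp add: dil_def q_le)

lemma dil_decay:
  assumes "t > 0" shows "norm x ^ DIM('a) * dil t x \<le> C"
proof -
  have "norm ((1 / t) *\<^sub>R x) ^ DIM('a) = norm x ^ DIM('a) / t ^ DIM('a)"
    using assms by (simp add: power_divide)
  then show ?thesis using q_decay[of "(1 / t) *\<^sub>R x"] by (simp add: dil_def)
qed

lemma nn_integral_dil:
  assumes t: "t > 0" shows "(\<integral>\<^sup>+z. ennreal (dil t (x - z)) \<partial>lborel) = (\<integral>\<^sup>+z. ennreal (q z) \<partial>lborel)"
proof -
  have "(\<integral>\<^sup>+z. ennreal (dil t (x - z)) \<partial>lborel) = (\<integral>\<^sup>+z. ennreal (dil t z) \<partial>lborel)"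
    by (rule nn_integral_lborel_reflect) measurable
  also have "\<dots> = ennreal (\<bar>t\<bar> ^ DIM('a)) * (\<integral>\<^sup>+z. ennreal (dil t (0 + t *\<^sub>R z)) \<partial>lborel)"
    using t by (intro nn_integral_lborel_affine) auto
  also have "\<dots> = (\<integral>\<^sup>+z. ennreal (t ^ DIM('a)) * ennreal (dil t (t *\<^sub>R z)) \<partial>lborel)"
    using t by (subst nn_integral_cmult) auto
  also have "\<dots> = (\<integral>\<^sup>+z. ennreal (q z) \<partial>lborel)"
    using t by (intro nn_integral_cong) (simp add: dil_def ennreal_mult'[symmetric])
  finally show ?thesis .
qed

lemma nn_integral_dil_le: "t > 0 \<Longrightarrow> (\<integral>\<^sup>+z. ennreal (dil t (x - z)) \<partial>lborel) \<le> ennreal C"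
  using nn_integral_dil q_integral by simp

lemma nn_integral_dil_mult_le:
  fixes g :: "'a \<Rightarrow> ennreal"
  assumes [measurable]: "g \<in> borel_measurable borel" and t: "t > 0" "t \<le> s" "s \<le> 2 * t"
  shows "(\<integral>\<^sup>+z. ennreal (dil t (x - z)) * g z \<partial>lborel) \<le> ennreal (2 ^ DIM('a) * (2 ^ DIM('a) * C)) * (\<Sum>i. scaled_mean 1 (2 ^ i * s) g x)"
proof (rule nn_integral_le_sum_scaled_mean)
  show "s > 0" "2 ^ DIM('a) * C \<ge> 0" using t C_pos by auto
  have C1: "C \<le> 2 ^ DIM('a) * C" using C_pos mult_right_mono[of 1 "2 ^ DIM('a)" C] by simp
  fix y
  have "dil t (x - y) * s ^ DIM('a) \<le> dil t (x - y) * (2 * t) ^ DIM('a)"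
    using t by (intro mult_left_mono power_mono dil_nonneg) auto
  also have "\<dots> = 2 ^ DIM('a) * (dil t (x - y) * t ^ DIM('a))" by (simp add: power_mult_distrib)
  also have "\<dots> \<le> 2 ^ DIM('a) * C" using t by (intro mult_left_mono dil_le) auto
  finally show "ennreal (dil t (x - y)) * ennreal (s ^ DIM('a)) \<le> ennreal (2 ^ DIM('a) * C)"
    using t dil_nonneg[of t "x - y"] by (simp add: ennreal_mult[symmetric] ennreal_leI)
  have "dil t (x - y) * dist x y ^ DIM('a) \<le> 2 ^ DIM('a) * C"
    using dil_decay[OF t(1), of "x - y"] C1 by (simp add: dist_norm mult.commute)
  then show "ennreal (dil t (x - y)) * ennreal (dist x y ^ DIM('a)) \<le> ennreal (2 ^ DIM('a) * C)"
    using t dil_nonneg[of t "x - y"] by (simp add: ennreal_mult[symmetric] ennreal_leI)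
qed measurable

text \<open>By Fubini's theorem the ball mean is moved onto the kernel. The smoothed kernel
  satisfies the bounds of \<open>nn_integral_le_sum_scaled_mean\<close> at scale \<open>s\<close>
  even if \<open>t\<close> is much smaller, because its supremum is controlled by the integral of
  \<open>q\<close> instead of its supremum.\<close>

lemma nn_integral_dil_scaled_mean_le:
  fixes g :: "'a \<Rightarrow> ennreal"
  assumes [measurable]: "g \<in> borel_measurable borel" and t: "t > 0" and s: "s > 0" and \<rho>: "\<rho> > 0"
  shows "(\<integral>\<^sup>+z. ennreal (dil t (x - z)) * scaled_mean \<rho> s g z \<partial>lborel) \<le>
    ennreal (2 ^ DIM('a) * (C * (1 + (2 * \<rho>) ^ DIM('a) + 2 ^ DIM('a) * (unit_ball_vol DIM('a) * \<rho> ^ DIM('a))))) * (\<Sum>i. scaled_mean 1 (2 ^ i * s) g x)"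
proof -
  let ?n = "DIM('a)" and ?v = "unit_ball_vol DIM('a)"
  let ?A = "C * (1 + (2 * \<rho>) ^ ?n + 2 ^ ?n * (?v * \<rho> ^ ?n))"
  let ?w = "\<lambda>z y. if dist z y < \<rho> * s then ennreal (1 / s ^ ?n) else 0"
  define a where "a = (\<lambda>y. \<integral>\<^sup>+z. ennreal (dil t (x - z)) * ?w z y \<partial>lborel)"
  have "(\<integral>\<^sup>+z. ennreal (dil t (x - z)) * scaled_mean \<rho> s g z \<partial>lborel)
     = (\<integral>\<^sup>+z. \<integral>\<^sup>+y. ennreal (dil t (x - z)) * ?w z y * g y \<partial>lborel \<partial>lborel)"
  proof (rule nn_integral_cong)
    fix z :: 'a
    have "(\<integral>\<^sup>+y. ennreal (dil t (x - z)) * ?w z y * g y \<partial>lborel)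
       = (\<integral>\<^sup>+y. ennreal (dil t (x - z)) * (ennreal (1 / s ^ ?n) * (if dist z y < \<rho> * s then g y else 0)) \<partial>lborel)"
      by (intro nn_integral_cong) (auto simp: mult.assoc)
    also have "\<dots> = ennreal (dil t (x - z)) * scaled_mean \<rho> s g z"
      unfolding scaled_mean_def by (subst nn_integral_cmult, measurable, subst nn_integral_cmult) simp_all
    finally show "ennreal (dil t (x - z)) * scaled_mean \<rho> s g z = (\<integral>\<^sup>+y. ennreal (dil t (x - z)) * ?w z y * g y \<partial>lborel)" ..
  qed
  also have "\<dots> = (\<integral>\<^sup>+y. \<integral>\<^sup>+z. ennreal (dil t (x - z)) * ?w z y * g y \<partial>lborel \<partial>lborel)"
    by (rule lborel_pair.Fubini') measurable
  also have "\<dots> = (\<integral>\<^sup>+y. a y * g y \<partial>lborel)"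
    unfolding a_def by (intro nn_integral_cong nn_integral_multc) measurable
  also have "\<dots> \<le> ennreal (2 ^ ?n * ?A) * (\<Sum>i. scaled_mean 1 (2 ^ i * s) g x)"
  proof (rule nn_integral_le_sum_scaled_mean[OF _ s])
    show "?A \<ge> 0" using C_pos \<rho> by (intro mult_nonneg_nonneg add_nonneg_nonneg) auto
    fix y
    have CA: "C \<le> ?A" "C * ((2 * \<rho>) ^ ?n + 2 ^ ?n * (?v * \<rho> ^ ?n)) \<le> ?A"
      using C_pos \<rho> by (auto simp: distrib_left intro!: mult_nonneg_nonneg add_nonneg_nonneg)
    have "a y * ennreal (s ^ ?n) = (\<integral>\<^sup>+z. ennreal (dil t (x - z)) * ?w z y * ennreal (s ^ ?n) \<partial>lborel)"
      unfolding a_def by (rule nn_integral_multc[symmetric]) measurable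
    also have "\<dots> \<le> (\<integral>\<^sup>+z. ennreal (dil t (x - z)) \<partial>lborel)"
      using s by (intro nn_integral_mono) (auto simp: mult.assoc ennreal_mult[symmetric])
    also have "\<dots> \<le> ennreal ?A" using nn_integral_dil_le[OF t] ennreal_leI[OF CA(1)] by (rule order_trans)
    finally show "a y * ennreal (s ^ ?n) \<le> ennreal ?A" .
    have "a y * ennreal (dist x y ^ ?n) = (\<integral>\<^sup>+z. ennreal (dil t (x - z)) * ?w z y * ennreal (dist x y ^ ?n) \<partial>lborel)"
      unfolding a_def by (rule nn_integral_multc[symmetric]) measurable
    also have "\<dots> \<le> (\<integral>\<^sup>+z. ennreal ((2 * \<rho>) ^ ?n) * ennreal (dil t (x - z)) + ennreal (2 ^ ?n * C / s ^ ?n) * indicator (ball y (\<rho> * s)) z \<partial>lborel)"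
    proof (rule nn_integral_mono)
      fix z
      have nn: "dil t (x - z) \<ge> 0" using t by (rule dil_nonneg)
      show "ennreal (dil t (x - z)) * ?w z y * ennreal (dist x y ^ ?n) \<le>
        ennreal ((2 * \<rho>) ^ ?n) * ennreal (dil t (x - z)) + ennreal (2 ^ ?n * C / s ^ ?n) * indicator (ball y (\<rho> * s)) z"
      proof (cases "dist z y < \<rho> * s")
        case z: True
        have eq: "ennreal (dil t (x - z)) * ?w z y * ennreal (dist x y ^ ?n) = ennreal (dil t (x - z) * (1 / s ^ ?n) * dist x y ^ ?n)"
          using z s nn by (simp add: ennreal_mult[symmetric])
        \<comment> \<open>If y is within 2 \<rho> s of x, the power of the distance is absorbed by
          s^(-n) and the total mass of the kernel remains. Otherwise |x - z| is at least half the
          distance from x to y, and the decay of the kernel takes over.\<close>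
        show ?thesis
        proof (cases "dist x y \<le> 2 * \<rho> * s")
          case True
          have "dist x y ^ ?n \<le> (2 * \<rho> * s) ^ ?n" using True by (intro power_mono) auto
          then have "(1 / s ^ ?n) * dist x y ^ ?n \<le> (2 * \<rho>) ^ ?n"
            using s by (simp add: power_mult_distrib divide_le_eq)
          from mult_left_mono[OF this nn]
          have "ennreal (dil t (x - z) * (1 / s ^ ?n) * dist x y ^ ?n) \<le> ennreal ((2 * \<rho>) ^ ?n * dil t (x - z))"
            by (intro ennreal_leI) (simp add: mult_ac)
          also have "\<dots> = ennreal ((2 * \<rho>) ^ ?n) * ennreal (dil t (x - z))" using nn \<rho> by (simp add: ennreal_mult)
          finally show ?thesis unfolding eq by (rule order_trans) simp
        next
          case False
          have "dist x y \<le> 2 * norm (x - z)"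
            using False z dist_triangle[of x y z] by (simp add: dist_norm)
          then have "dist x y ^ ?n \<le> (2 * norm (x - z)) ^ ?n" by (intro power_mono) auto
          then have "dil t (x - z) * dist x y ^ ?n \<le> dil t (x - z) * (2 * norm (x - z)) ^ ?n" by (rule mult_left_mono[OF _ nn])
          also have "\<dots> = 2 ^ ?n * (norm (x - z) ^ ?n * dil t (x - z))" by (simp add: power_mult_distrib)
          also have "\<dots> \<le> 2 ^ ?n * C" by (intro mult_left_mono dil_decay t) auto
          finally have "(1 / s ^ ?n) * (dil t (x - z) * dist x y ^ ?n) \<le> (1 / s ^ ?n) * (2 ^ ?n * C)" using s by (intro mult_left_mono) auto
          then have "ennreal (dil t (x - z) * (1 / s ^ ?n) * dist x y ^ ?n) \<le> ennreal (2 ^ ?n * C / s ^ ?n)"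
            by (intro ennreal_leI) (simp add: mult_ac)
          also have "\<dots> = ennreal (2 ^ ?n * C / s ^ ?n) * indicator (ball y (\<rho> * s)) z" using z by (simp add: dist_commute)
          finally show ?thesis unfolding eq by (rule order_trans) simp
        qed
      qed simp
    qed
    also have "\<dots> = ennreal ((2 * \<rho>) ^ ?n) * (\<integral>\<^sup>+z. ennreal (dil t (x - z)) \<partial>lborel) + ennreal (2 ^ ?n * C / s ^ ?n) * ennreal (?v * (\<rho> * s) ^ ?n)"
      using s \<rho> by (subst nn_integral_add) (auto simp: nn_integral_cmult nn_integral_cmult_indicator emeasure_lborel_ball)
    also have "\<dots> \<le> ennreal ((2 * \<rho>) ^ ?n) * ennreal C + ennreal (2 ^ ?n * C / s ^ ?n) * ennreal (?v * (\<rho> * s) ^ ?n)"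
      by (intro add_right_mono mult_left_mono nn_integral_dil_le t) auto
    also have "\<dots> = ennreal (C * ((2 * \<rho>) ^ ?n + 2 ^ ?n * (?v * \<rho> ^ ?n)))"
    proof -
      have "2 ^ ?n * C / s ^ ?n * (?v * (\<rho> * s) ^ ?n) = C * (2 ^ ?n * (?v * \<rho> ^ ?n))"
        using s by (simp add: power_mult_distrib)
      then have "ennreal (2 ^ ?n * C / s ^ ?n) * ennreal (?v * (\<rho> * s) ^ ?n) = ennreal (C * (2 ^ ?n * (?v * \<rho> ^ ?n)))"
        using s C_pos \<rho> by (subst ennreal_mult[symmetric]) auto
      moreover have "ennreal ((2 * \<rho>) ^ ?n) * ennreal C = ennreal (C * (2 * \<rho>) ^ ?n)"
        using C_pos \<rho> by (simp add: ennreal_mult[symmetric] mult.commute)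
      ultimately show ?thesis using C_pos \<rho>
        by (simp only:) (subst ennreal_plus[symmetric], auto simp: distrib_left)
    qed
    also have "\<dots> \<le> ennreal ?A" by (rule ennreal_leI[OF CA(2)])
    finally show "a y * ennreal (dist x y ^ ?n) \<le> ennreal ?A" .
  qed simp
  finally show ?thesis .
qed

lemma nn_integral_dil_W_space_le:
  assumes \<beta>: "0 < \<beta>" "\<beta> < real DIM('a)" and k_def: "k = 1 + nat \<lfloor>\<beta>\<rfloor>"
  obtains K :: real where "K > 0" "\<And>f t x l. f \<in> W_space \<beta> \<Longrightarrow> t > 0 \<Longrightarrow> t \<le> 2 powr of_int l \<Longrightarrow> 2 powr of_int l \<le> 2 * t \<Longrightarrow>
     (\<integral>\<^sup>+z. ennreal (dil t (x - z)) * ennreal \<bar>f z\<bar> \<partial>lborel) \<le> ennreal K * (\<Sum>p. level_sum k f 1 (l + int p) x)"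
proof -
  obtain C0 where C0: "C0 > 0" "\<And>(f :: 'a \<Rightarrow> real) t z. f \<in> W_space \<beta> \<Longrightarrow> t > 0 \<Longrightarrow>
     ennreal \<bar>f z\<bar> \<le> ennreal C0 * (osc k f t z + (\<Sum>m. scaled_mean (real k) (2 ^ m * t) (osc k f (2 ^ m * t)) z))"
    using pointwise_le_sum_scaled_mean_osc[OF \<beta> k_def] by blast
  have k: "real k > 0" by (simp add: k_def)
  define A1 where "A1 = 2 ^ DIM('a) * (2 ^ DIM('a) * C)"
  define A2 where "A2 = 2 ^ DIM('a) * (C * (1 + (2 * real k) ^ DIM('a) + 2 ^ DIM('a) * (unit_ball_vol DIM('a) * real k ^ DIM('a))))"
  have A: "A1 > 0" "A2 > 0"
    unfolding A1_def A2_def using C_pos by (auto intro!: mult_pos_pos add_pos_nonneg mult_nonneg_nonneg)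
  show ?thesis
  proof (rule that[of "C0 * (A1 + A2)"])
    show "C0 * (A1 + A2) > 0" using C0 A by simp
    fix f :: "'a \<Rightarrow> real" and t :: real and x :: 'a and l :: int
    assume f: "f \<in> W_space \<beta>" and t: "t > 0" "t \<le> 2 powr of_int l" "2 powr of_int l \<le> 2 * t"
    have [measurable]: "f \<in> borel_measurable borel" using f by (simp add: W_space_def)
    define \<tau> :: real where "\<tau> = 2 powr of_int l"
    have \<tau>: "\<tau> > 0" by (simp add: \<tau>_def)
    define U where "U = (\<lambda>l i. scaled_mean 1 (2 powr of_int l) (osc k f (2 powr of_int (l - int i))) x)"
    \<comment> \<open>The oscillation is at level l + m, the averaging radius i levels above.
      Writing the pair as averaging level l + (m + i) and offset i prepares the regrouping by
      averaging level.\<close>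
    have U: "scaled_mean 1 (2 ^ i * (2 ^ m * \<tau>)) (osc k f (2 ^ m * \<tau>)) x = U (l + int (m + i)) i" for m i
    proof -
      have "2 ^ i * (2 ^ m * \<tau>) = 2 powr of_int (l + int (m + i))"
        by (simp add: \<tau>_def powr_add powr_realpow mult_ac)
      moreover have "2 ^ m * \<tau> = 2 powr of_int (l + int (m + i) - int i)"
        by (simp add: \<tau>_def powr_add powr_realpow mult_ac)
      ultimately show ?thesis by (simp only: U_def)
    qed
    let ?S = "\<Sum>m. \<Sum>i. U (l + int (m + i)) i"
    let ?N = "\<lambda>m z. scaled_mean (real k) (2 ^ m * \<tau>) (osc k f (2 ^ m * \<tau>)) z"
    have "(\<integral>\<^sup>+z. ennreal (dil t (x - z)) * ennreal \<bar>f z\<bar> \<partial>lborel)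
       \<le> (\<integral>\<^sup>+z. ennreal C0 * (ennreal (dil t (x - z)) * osc k f \<tau> z + (\<Sum>m. ennreal (dil t (x - z)) * ?N m z)) \<partial>lborel)"
    proof (rule nn_integral_mono)
      fix z
      have "ennreal (dil t (x - z)) * ennreal \<bar>f z\<bar> \<le> ennreal (dil t (x - z)) * (ennreal C0 * (osc k f \<tau> z + (\<Sum>m. ?N m z)))"
        by (intro mult_left_mono C0 f \<tau>) auto
      then show "ennreal (dil t (x - z)) * ennreal \<bar>f z\<bar> \<le> ennreal C0 * (ennreal (dil t (x - z)) * osc k f \<tau> z + (\<Sum>m. ennreal (dil t (x - z)) * ?N m z))"
        by (simp add: ennreal_suminf_cmult distrib_left mult_ac)
    qed
    also have "\<dots> = ennreal C0 * ((\<integral>\<^sup>+z. ennreal (dil t (x - z)) * osc k f \<tau> z \<partial>lborel) + (\<Sum>m. \<integral>\<^sup>+z. ennreal (dil t (x - z)) * ?N m z \<partial>lborel))"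
      by (subst nn_integral_cmult, measurable, subst nn_integral_add, measurable, subst nn_integral_suminf, measurable)
    also have "\<dots> \<le> ennreal C0 * (ennreal A1 * ?S + ennreal A2 * ?S)"
    proof (intro mult_left_mono add_mono)
      have "(\<integral>\<^sup>+z. ennreal (dil t (x - z)) * osc k f \<tau> z \<partial>lborel) \<le> ennreal A1 * (\<Sum>i. scaled_mean 1 (2 ^ i * \<tau>) (osc k f \<tau>) x)"
        unfolding A1_def \<tau>_def by (rule nn_integral_dil_mult_le) (use t in auto)
      also have "(\<Sum>i. scaled_mean 1 (2 ^ i * \<tau>) (osc k f \<tau>) x) = (\<Sum>i. U (l + int (0 + i)) i)"
        using U[of _ 0] by simp
      also have "ennreal A1 * \<dots> \<le> ennreal A1 * ?S"
        by (intro mult_left_mono suminf_ge_term_ennreal[of "\<lambda>m. \<Sum>i. U (l + int (m + i)) i" 0]) simp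
      finally show "(\<integral>\<^sup>+z. ennreal (dil t (x - z)) * osc k f \<tau> z \<partial>lborel) \<le> ennreal A1 * ?S" .
      have "(\<Sum>m. \<integral>\<^sup>+z. ennreal (dil t (x - z)) * ?N m z \<partial>lborel) \<le> (\<Sum>m. ennreal A2 * (\<Sum>i. U (l + int (m + i)) i))"
      proof (intro suminf_le)
        fix m
        have "(\<integral>\<^sup>+z. ennreal (dil t (x - z)) * ?N m z \<partial>lborel) \<le> ennreal A2 * (\<Sum>i. scaled_mean 1 (2 ^ i * (2 ^ m * \<tau>)) (osc k f (2 ^ m * \<tau>)) x)"
          unfolding A2_def by (rule nn_integral_dil_scaled_mean_le) (use t \<tau> k in auto)
        then show "(\<integral>\<^sup>+z. ennreal (dil t (x - z)) * ?N m z \<partial>lborel) \<le> ennreal A2 * (\<Sum>i. U (l + int (m + i)) i)"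
          by (simp only: U)
      qed auto
      also have "\<dots> = ennreal A2 * ?S" by (rule ennreal_suminf_cmult)
      finally show "(\<Sum>m. \<integral>\<^sup>+z. ennreal (dil t (x - z)) * ?N m z \<partial>lborel) \<le> ennreal A2 * ?S" .
    qed simp
    also have "\<dots> = ennreal (C0 * (A1 + A2)) * ?S"
      using C0 A by (simp add: ennreal_mult distrib_right mult.assoc)
    also have "?S = (\<Sum>i. \<Sum>m. U (l + int (m + i)) i)" by (rule suminf_ennreal_swap)
    \<comment> \<open>With p = m + i the inner sum runs over p \<ge> i; the missing terms are added
      so that the two sums decouple and can be exchanged.\<close>
    also have "\<dots> \<le> (\<Sum>i. \<Sum>p. U (l + int p) i)"
      by (intro suminf_le suminf_shift_le[of "\<lambda>p. U (l + int p) i" i for i]) auto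
    also have "\<dots> = (\<Sum>p. \<Sum>i. U (l + int p) i)" by (rule suminf_ennreal_swap)
    also have "\<dots> = (\<Sum>p. level_sum k f 1 (l + int p) x)" by (simp add: level_sum_def U_def)
    finally show "(\<integral>\<^sup>+z. ennreal (dil t (x - z)) * ennreal \<bar>f z\<bar> \<partial>lborel) \<le> ennreal (C0 * (A1 + A2)) * (\<Sum>p. level_sum k f 1 (l + int p) x)"
      by (simp add: mult_left_mono)
  qed
qed

end

section \<open>Stratification over dyadic cells\<close>


text \<open>The lowest vertex of the half-open dyadic cube of side 2^l containing \<open>x\<close>.
  It represents the cube, so that \<open>range (corner l)\<close> indexes the cubes of level
  \<open>l\<close>.\<close>

definition corner :: "int \<Rightarrow> 'a::euclidean_space \<Rightarrow> 'a" where
  "corner l x = (\<Sum>b\<in>Basis. (2 powr of_int l * of_int \<lfloor>(x \<bullet> b) / 2 powr of_int l\<rfloor>) *\<^sub>R b)"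

lemma corner_inner:
  "b \<in> Basis \<Longrightarrow> corner l x \<bullet> b = 2 powr of_int l * of_int \<lfloor>(x \<bullet> b) / 2 powr of_int l\<rfloor>"
  unfolding corner_def by (rule inner_sum_left_Basis)

lemma corner_eq_iff:
  "corner l x = corner l y \<longleftrightarrow> (\<forall>b\<in>Basis. \<lfloor>(x \<bullet> b) / 2 powr of_int l\<rfloor> = \<lfloor>(y \<bullet> b) / 2 powr of_int l\<rfloor>)"
  by (subst euclidean_eq_iff) (simp add: corner_inner)

lemma corner_corner[simp]: "corner l (corner l x) = corner l x"
  unfolding corner_eq_iff by (simp add: corner_inner)

lemma corner_nested:
  assumes "corner l x = corner l y" shows "corner (l + int p) x = corner (l + int p) y"
proof -
  have *: "\<lfloor>r / 2 powr of_int (l + int p)\<rfloor> = \<lfloor>r / 2 powr of_int l\<rfloor> div 2 ^ p" for r :: real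
  proof -
    have "r / 2 powr of_int (l + int p) = (r / 2 powr of_int l) / of_int (2 ^ p)"
      by (simp add: powr_add powr_realpow)
    then show ?thesis by (simp only: floor_divide_real_eq_div zero_le_power zero_le_numeral)
  qed
  show ?thesis using assms unfolding corner_eq_iff * by simp
qed

lemma borel_measurable_corner[measurable]: "corner l \<in> borel_measurable borel"
  unfolding corner_def[abs_def] by measurable

lemma countable_range_corner: "countable (range (corner l :: 'a::euclidean_space \<Rightarrow> 'a))"
proof -
  let ?g = "\<lambda>m::'a \<Rightarrow> int. \<Sum>b\<in>Basis. (2 powr of_int l * of_int (m b)) *\<^sub>R b"
  have "range (corner l :: 'a \<Rightarrow> 'a) \<subseteq> ?g ` (PiE Basis (\<lambda>_. UNIV))"
  proof clarify
    fix x :: 'a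
    show "corner l x \<in> ?g ` (PiE Basis (\<lambda>_. UNIV))"
    proof (rule image_eqI)
      show "corner l x = ?g (restrict (\<lambda>b. \<lfloor>(x \<bullet> b) / 2 powr of_int l\<rfloor>) Basis)" by (simp add: corner_def)
    qed (auto simp: PiE_def extensional_def)
  qed
  moreover have "countable (?g ` (PiE Basis (\<lambda>_. UNIV)))" by (intro countable_image countable_PiE) auto
  ultimately show ?thesis by (rule countable_subset)
qed

lemma dist_le_if_corner_eq:
  fixes x y :: "'a::euclidean_space"
  assumes "corner l x = corner l y" shows "dist x y \<le> real DIM('a) * 2 powr of_int l"
proof -
  have "\<bar>(x - y) \<bullet> b\<bar> \<le> 2 powr of_int l" if b: "b \<in> Basis" for b
  proof -
    let ?u = "(x \<bullet> b) / 2 powr of_int l" and ?w = "(y \<bullet> b) / 2 powr of_int l"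
    have "\<lfloor>?u\<rfloor> = \<lfloor>?w\<rfloor>" using assms b by (simp add: corner_eq_iff)
    then have "\<bar>?u - ?w\<bar> \<le> 1" by linarith
    moreover have "?u - ?w = ((x - y) \<bullet> b) / 2 powr of_int l" by (simp add: inner_diff_left diff_divide_distrib)
    ultimately show ?thesis by (simp add: abs_divide divide_le_eq)
  qed
  then have "(\<Sum>b\<in>Basis. \<bar>(x - y) \<bullet> b\<bar>) \<le> (\<Sum>b\<in>(Basis :: 'a set). 2 powr of_int l)" by (intro sum_mono) auto
  then show ?thesis using norm_le_l1[of "x - y"] by (simp add: dist_norm)
qed

lemma cell_mass:
  fixes x :: "'a::euclidean_space"
  shows "ennreal ((2 powr of_int l) ^ DIM('a)) \<le> (\<integral>\<^sup>+y. (if corner l y = corner l x then 1 else 0) \<partial>lborel)"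
proof -
  define r where "r = (2::real) powr of_int l"
  have r: "r > 0" by (simp add: r_def)
  define a where "a = corner l x"
  define c where "c = a + r *\<^sub>R One"
  have c: "(c - a) \<bullet> b = r" if "b \<in> Basis" for b using that by (simp add: c_def)
  have "emeasure lborel (box a c) = ennreal (\<Prod>b\<in>Basis. (c - a) \<bullet> b)"
    using r by (intro emeasure_lborel_box) (simp add: c_def inner_add_left)
  also have "(\<Prod>b\<in>Basis. (c - a) \<bullet> b) = r ^ DIM('a)" by (simp add: c)
  finally have "ennreal (r ^ DIM('a)) = (\<integral>\<^sup>+y. indicator (box a c) y \<partial>lborel)" by simp
  also have "\<dots> \<le> (\<integral>\<^sup>+y. (if corner l y = corner l x then 1 else 0) \<partial>lborel)"
  proof (rule nn_integral_mono)
    fix y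
    have "corner l y = corner l x" if y: "y \<in> box a c"
      unfolding corner_eq_iff
    proof
      fix b :: 'a assume b: "b \<in> Basis"
      have "a \<bullet> b < y \<bullet> b" "y \<bullet> b < a \<bullet> b + r" using y b c[OF b] by (auto simp: mem_box inner_diff_left)
      then have "of_int \<lfloor>(x \<bullet> b) / r\<rfloor> < (y \<bullet> b) / r" "(y \<bullet> b) / r < of_int \<lfloor>(x \<bullet> b) / r\<rfloor> + 1"
        using b r by (simp_all add: a_def corner_inner r_def[symmetric] field_simps)
      then show "\<lfloor>(y \<bullet> b) / 2 powr of_int l\<rfloor> = \<lfloor>(x \<bullet> b) / 2 powr of_int l\<rfloor>"
        unfolding r_def[symmetric] by linarith
    qed
    then show "indicator (box a c) y \<le> (if corner l y = corner l x then 1 else (0::ennreal))" by (auto simp: indicator_def)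
  qed
  finally show ?thesis by (simp add: r_def)
qed

text \<open>The stratification needs coefficients that are constant on cubes, so a function of level
  \<open>l\<close> is replaced by its mean over the cube, whose volume is 2^(l n).\<close>

definition cell_mean :: "(int \<Rightarrow> 'a::euclidean_space \<Rightarrow> ennreal) \<Rightarrow> int \<Rightarrow> 'a \<Rightarrow> ennreal" where
  "cell_mean G l x = ennreal (1 / (2 powr of_int l) ^ DIM('a)) * (\<integral>\<^sup>+y. (if corner l y = corner l x then G l y else 0) \<partial>lborel)"

lemma cell_mean_cong: "corner l x = corner l y \<Longrightarrow> cell_mean G l x = cell_mean G l y"
  by (simp add: cell_mean_def)

lemma le_cell_mean:
  fixes x :: "'a::euclidean_space"
  assumes "\<And>y. corner l y = corner l x \<Longrightarrow> A \<le> G l y"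
  shows "A \<le> cell_mean G l x"
proof -
  have "A = A * (ennreal (1 / (2 powr of_int l) ^ DIM('a)) * ennreal ((2 powr of_int l) ^ DIM('a)))"
    by (subst ennreal_mult[symmetric]) auto
  also have "\<dots> \<le> A * (ennreal (1 / (2 powr of_int l) ^ DIM('a)) * (\<integral>\<^sup>+y. (if corner l y = corner l x then 1 else 0) \<partial>lborel))"
    by (intro mult_left_mono cell_mass) auto
  also have "\<dots> = ennreal (1 / (2 powr of_int l) ^ DIM('a)) * (\<integral>\<^sup>+y. A * (if corner l y = corner l x then 1 else 0) \<partial>lborel)"
    by (subst nn_integral_cmult) (auto simp: mult_ac)
  also have "\<dots> \<le> cell_mean G l x"
    unfolding cell_mean_def by (intro mult_left_mono nn_integral_mono) (auto intro: assms)
  finally show ?thesis .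
qed

text \<open>Each point \<open>y\<close> lies in exactly one cube of level \<open>l\<close>, so after
  exchanging sum and integral the inner sum has a single term.\<close>

lemma sum_cell_mean:
  fixes G :: "int \<Rightarrow> 'a::euclidean_space \<Rightarrow> ennreal"
  assumes [measurable]: "G l \<in> borel_measurable borel"
  shows "(\<integral>\<^sup>+a. cell_mean G l a \<partial>count_space (range (corner l))) = ennreal (1 / (2 powr of_int l) ^ DIM('a)) * (\<integral>\<^sup>+y. G l y \<partial>lborel)"
proof -
  let ?R = "range (corner l) :: 'a set"
  have "(\<integral>\<^sup>+a. cell_mean G l a \<partial>count_space ?R)
     = ennreal (1 / (2 powr of_int l) ^ DIM('a)) * (\<integral>\<^sup>+a. \<integral>\<^sup>+y. (if corner l y = corner l a then G l y else 0) \<partial>lborel \<partial>count_space ?R)"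
    unfolding cell_mean_def by (rule nn_integral_cmult) simp
  also have "(\<integral>\<^sup>+a. \<integral>\<^sup>+y. (if corner l y = corner l a then G l y else 0) \<partial>lborel \<partial>count_space ?R)
    = (\<integral>\<^sup>+y. \<integral>\<^sup>+a. (if corner l y = corner l a then G l y else 0) \<partial>count_space ?R \<partial>lborel)"
    by (rule nn_integral_count_space_nn_integral[symmetric, OF countable_range_corner]) measurable
  also have "\<dots> = (\<integral>\<^sup>+y. G l y \<partial>lborel)"
  proof (rule nn_integral_cong)
    fix y
    have "(\<integral>\<^sup>+a. (if corner l y = corner l a then G l y else 0) \<partial>count_space ?R) = (\<integral>\<^sup>+a. G l y * indicator {corner l y} a \<partial>count_space ?R)"
      by (intro nn_integral_cong) (auto simp: indicator_def)
    also have "\<dots> = G l y * emeasure (count_space ?R) {corner l y}" by (rule nn_integral_cmult_indicator) auto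
    finally show "(\<integral>\<^sup>+a. (if corner l y = corner l a then G l y else 0) \<partial>count_space ?R) = G l y"
      by (simp add: emeasure_count_space)
  qed
  finally show ?thesis .
qed

lemma borel_measurable_nn_integral_count_space:
  assumes R: "countable R" and f: "\<And>a. a \<in> R \<Longrightarrow> (\<lambda>x. f a x :: ennreal) \<in> borel_measurable M"
  shows "(\<lambda>x. \<integral>\<^sup>+a. f a x \<partial>count_space R) \<in> borel_measurable M"
proof -
  interpret sigma_finite_measure "count_space R" by (rule sigma_finite_measure_count_space_countable[OF R])
  have "(\<lambda>p. f (snd p) (fst p)) \<in> borel_measurable (M \<Otimes>\<^sub>M count_space R)"
    by (rule measurable_compose_countable'[where f = "\<lambda>a p. f a (fst p)" and g = snd and I = R])
      (auto intro: measurable_compose[OF measurable_fst f] R)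
  then show ?thesis by (intro borel_measurable_nn_integral) (simp add: split_beta')
qed

text \<open>A sum of multiples of indicators of nested-or-disjoint boxes is stratified level by level: going
  down from the largest boxes, the first box at which the partial sum exceeds \<open>\<theta>\<close> is the only one
  charged at height \<open>\<theta>\<close>.  This replaces the (quasi-)sublinearity of Choquet integrals.\<close>

locale dyadic_layers =
  fixes c :: "int \<Rightarrow> 'a::euclidean_space \<Rightarrow> ennreal" and d :: real
  assumes d: "d > 0" and c_cong: "corner l x = corner l y \<Longrightarrow> c l x = c l y"
    and total: "(\<integral>\<^sup>+l. \<integral>\<^sup>+a. ennreal (2 powr (of_int l * d)) * c l a \<partial>count_space (range (corner l)) \<partial>count_space UNIV) < \<infinity>"
begin

abbreviation "T \<equiv> (\<integral>\<^sup>+l. \<integral>\<^sup>+a. ennreal (2 powr (of_int l * d)) * c l a \<partial>count_space (range (corner l)) \<partial>count_space UNIV)"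

definition S :: "int \<Rightarrow> 'a \<Rightarrow> ennreal" where "S l x = (\<Sum>p. c (l + int p) x)"

definition J :: "real \<Rightarrow> (int \<times> 'a) set" where
  "J \<theta> = {(l, a). a \<in> range (corner l) \<and> S (l + 1) a \<le> ennreal \<theta> \<and> ennreal \<theta> < S l a}"

lemma S_cong: "corner l x = corner l y \<Longrightarrow> S l x = S l y"
  unfolding S_def by (intro suminf_cong c_cong corner_nested)

lemma S_step: "S l x = c l x + S (l + 1) x"
  unfolding S_def using suminf_offset[of "\<lambda>p. c (l + int p) x" 1]
  by (simp add: summableI add_ac)

lemma c_le: "c l x \<le> T * ennreal (2 powr (- (of_int l * d)))"
proof -
  have "ennreal (2 powr (of_int l * d)) * c l (corner l x) \<le> (\<integral>\<^sup>+a. ennreal (2 powr (of_int l * d)) * c l a \<partial>count_space (range (corner l)))"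
    by (rule nn_integral_ge_point) simp
  also have "\<dots> \<le> T"
    by (rule nn_integral_ge_point[of l UNIV "\<lambda>l. \<integral>\<^sup>+a. ennreal (2 powr (of_int l * d)) * c l a \<partial>count_space (range (corner l))"]) simp
  finally have "ennreal (2 powr (of_int l * d)) * c l x \<le> T" using c_cong[of l "corner l x" x] by simp
  note le = this
  have eq: "ennreal (2 powr (- (of_int l * d))) * ennreal (2 powr (of_int l * d)) = 1"
    by (subst ennreal_mult[symmetric]) (auto simp: powr_add[symmetric])
  have "c l x = ennreal (2 powr (- (of_int l * d))) * (ennreal (2 powr (of_int l * d)) * c l x)"
    by (simp only: mult.assoc[symmetric] eq mult_1_left)
  also have "\<dots> \<le> ennreal (2 powr (- (of_int l * d))) * T" by (rule mult_left_mono[OF le]) simp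
  also have "\<dots> = T * ennreal (2 powr (- (of_int l * d)))" by (rule mult.commute)
  finally show ?thesis .
qed

text \<open>A single term of the finite total bounds \<open>c l x\<close> by a multiple of 2^(-l d);
  as d > 0 these bounds are summable upwards. This gives finiteness of \<open>S\<close> and its
  decay for large cubes, without which no first cube would exist.\<close>

lemma S_le: "S l x \<le> T * (\<Sum>p. ennreal ((2 powr (-d)) ^ p)) * ennreal (2 powr (- (of_int l * d)))"
proof -
  have "S l x \<le> (\<Sum>p. T * ennreal (2 powr (- (of_int l * d))) * ennreal ((2 powr (-d)) ^ p))"
    unfolding S_def
  proof (intro suminf_le)
    fix p
    have "2 powr (- (of_int (l + int p) * d)) = 2 powr (- (of_int l * d)) * (2 powr (-d)) ^ p"
      unfolding powr_power_two by (simp add: powr_realpow[symmetric] powr_powr powr_add[symmetric] distrib_right)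
    then have "ennreal (2 powr (- (of_int (l + int p) * d))) = ennreal (2 powr (- (of_int l * d))) * ennreal ((2 powr (-d)) ^ p)"
      by (simp only:) (rule ennreal_mult; simp)
    then show "c (l + int p) x \<le> T * ennreal (2 powr (- (of_int l * d))) * ennreal ((2 powr (-d)) ^ p)"
      using c_le[of "l + int p" x] by (simp only: mult.assoc)
  qed auto
  also have "\<dots> = T * ennreal (2 powr (- (of_int l * d))) * (\<Sum>p. ennreal ((2 powr (-d)) ^ p))"
    by (rule ennreal_suminf_cmult)
  finally show ?thesis by (simp only: mult_ac)
qed

lemma S_finite: "S l x < \<infinity>"
proof (rule le_less_trans[OF S_le])
  show "T * (\<Sum>p. ennreal ((2 powr (-d)) ^ p)) * ennreal (2 powr (- (of_int l * d))) < \<infinity>"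
    using total suminf_powr_lt_top[OF d] by (intro ennreal_mult_less_top_lt) auto
qed

lemma S_tendsto_0: "(\<lambda>p. S (l + int p) x) \<longlonglongrightarrow> 0"
proof (rule tendsto_sandwich[OF _ _ tendsto_const])
  let ?A = "T * (\<Sum>p. ennreal ((2 powr (-d)) ^ p))"
  show "\<forall>\<^sub>F p in sequentially. S (l + int p) x \<le> ?A * ennreal (2 powr (- (of_int (l + int p) * d)))"
    by (intro always_eventually allI S_le)
  have "2 powr (-d) < 2 powr (0::real)" using d by (intro powr_less_mono) auto
  then have "(\<lambda>p. (2 powr (-d)) ^ p) \<longlonglongrightarrow> 0" by (intro LIMSEQ_realpow_zero) auto
  from tendsto_mult_left[OF this, of "2 powr (- (of_int l * d))"]
  have "(\<lambda>p. 2 powr (- (of_int l * d)) * (2 powr (-d)) ^ p) \<longlonglongrightarrow> 0" by simp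
  moreover have "2 powr (- (of_int l * d)) * (2 powr (-d)) ^ p = 2 powr (- (of_int (l + int p) * d))" for p
    unfolding powr_power_two by (simp add: powr_realpow[symmetric] powr_powr powr_add[symmetric] distrib_right)
  ultimately have "(\<lambda>p. 2 powr (- (of_int (l + int p) * d))) \<longlonglongrightarrow> 0" by (simp only:)
  from tendsto_ennrealI[OF this] have "(\<lambda>p. ennreal (2 powr (- (of_int (l + int p) * d)))) \<longlonglongrightarrow> 0" by simp
  then show "(\<lambda>p. ?A * ennreal (2 powr (- (of_int (l + int p) * d)))) \<longlonglongrightarrow> 0"
    using total suminf_powr_lt_top[OF d] by (intro ennreal_cmult_tendsto_0 ennreal_mult_less_top_lt) auto
qed simp

lemma exists_layer:
  assumes "\<theta> > 0" "ennreal \<theta> < S l x"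
  shows "\<exists>p. (l + int p, corner (l + int p) x) \<in> J \<theta>"
proof -
  have "\<exists>p. S (l + int p) x \<le> ennreal \<theta>"
    using order_tendstoD(2)[OF S_tendsto_0[of l x], of "ennreal \<theta>"] assms(1)
    by (auto simp: eventually_sequentially intro: less_imp_le)
  \<comment> \<open>The cube wanted is one level below: \<open>p\<close> is the first level where
    the sum no longer exceeds \<theta>, and it is not 0 because the sum exceeds \<theta> at
    \<open>l\<close>.\<close>
  define p where "p = (LEAST p. S (l + int p) x \<le> ennreal \<theta>)"
  have p: "S (l + int p) x \<le> ennreal \<theta>" unfolding p_def by (rule LeastI_ex) fact
  then obtain r where r: "p = Suc r" using assms(2) by (cases p) auto
  have "\<not> S (l + int r) x \<le> ennreal \<theta>" using not_less_Least[of r "\<lambda>p. S (l + int p) x \<le> ennreal \<theta>"] r p_def by simp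
  then have "ennreal \<theta> < S (l + int r) (corner (l + int r) x)" using S_cong[of "l + int r" "corner (l + int r) x" x] by simp
  moreover have "S (l + int r + 1) (corner (l + int r) x) \<le> ennreal \<theta>"
    using p r S_cong[of "l + int r + int 1", OF corner_nested[of "l + int r" "corner (l + int r) x" x 1]] by (simp add: add_ac)
  ultimately show ?thesis unfolding J_def by blast
qed

text \<open>Both sums are finite and differ by \<open>c l a\<close>, so the admissible heights form
  an interval of that length.\<close>

lemma nn_integral_layer:
  "(\<integral>\<^sup>+\<theta>. indicator {0<..} \<theta> * (if S (l + 1) a \<le> ennreal \<theta> \<and> ennreal \<theta> < S l a then 1 else 0) \<partial>lborel) \<le> c l a"
proof -
  obtain u where u: "u \<ge> 0" "S (l + 1) a = ennreal u" using S_finite[of "l + 1" a] by (cases "S (l + 1) a") auto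
  have "c l a < \<infinity>" using S_finite[of l a] S_step[of l a] by (auto simp: less_top[symmetric])
  then obtain w where w: "w \<ge> 0" "c l a = ennreal w" by (cases "c l a") auto
  have Sl: "S l a = ennreal (w + u)" using S_step[of l a] u w by simp
  have "(\<integral>\<^sup>+\<theta>. indicator {0<..} \<theta> * (if S (l + 1) a \<le> ennreal \<theta> \<and> ennreal \<theta> < S l a then 1 else 0) \<partial>lborel)
     \<le> (\<integral>\<^sup>+\<theta>. indicator {u..w + u} \<theta> \<partial>lborel)"
    unfolding u Sl using u w by (intro nn_integral_mono) (auto simp: indicator_def ennreal_less_iff simp del: ennreal_plus)
  also have "\<dots> = c l a" using u w by simp
  finally show ?thesis .
qed

lemma layers_measurable[measurable]:
  "(\<lambda>\<theta>. \<integral>\<^sup>+l. \<integral>\<^sup>+a. ennreal (2 powr (of_int l * d)) * (if (l, a) \<in> J \<theta> then 1 else 0) \<partial>count_space (range (corner l)) \<partial>count_space UNIV) \<in> borel_measurable borel"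
  unfolding J_def mem_Collect_eq prod.case
  by (intro borel_measurable_nn_integral_count_space countable_range_corner) (simp, measurable)

lemma countable_J: "countable (J \<theta>)"
proof (rule countable_subset)
  show "J \<theta> \<subseteq> (SIGMA l:UNIV. range (corner l))" by (auto simp: J_def)
qed (intro countable_SIGMA countable_range_corner, simp)

lemma nn_integral_layers:
  "(\<integral>\<^sup>+\<theta>. indicator {0<..} \<theta> * (\<integral>\<^sup>+l. \<integral>\<^sup>+a. ennreal (2 powr (of_int l * d)) * (if (l, a) \<in> J \<theta> then 1 else 0) \<partial>count_space (range (corner l)) \<partial>count_space UNIV) \<partial>lborel) \<le> T"
proof -
  let ?w = "\<lambda>l::int. ennreal (2 powr (of_int l * d))"
  let ?e = "\<lambda>l a \<theta>. ?w l * (indicator {0<..} \<theta> * (if S (l + 1) a \<le> ennreal \<theta> \<and> ennreal \<theta> < S l a then 1 else 0))"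
  have [measurable]: "?e l a \<in> borel_measurable lborel" for l a by measurable
  have [measurable]: "(\<lambda>\<theta>. \<integral>\<^sup>+a. ?e l a \<theta> \<partial>count_space (range (corner l))) \<in> borel_measurable lborel" for l
    by (rule borel_measurable_nn_integral_count_space[OF countable_range_corner]) measurable
  have "(\<integral>\<^sup>+\<theta>. indicator {0<..} \<theta> * (\<integral>\<^sup>+l. \<integral>\<^sup>+a. ?w l * (if (l, a) \<in> J \<theta> then 1 else 0) \<partial>count_space (range (corner l)) \<partial>count_space UNIV) \<partial>lborel)
    = (\<integral>\<^sup>+\<theta>. \<integral>\<^sup>+l. \<integral>\<^sup>+a. ?e l a \<theta> \<partial>count_space (range (corner l)) \<partial>count_space UNIV \<partial>lborel)"
  proof (rule nn_integral_cong)
    fix \<theta> :: real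
    have "indicator {0<..} \<theta> * (\<integral>\<^sup>+l. \<integral>\<^sup>+a. ?w l * (if (l, a) \<in> J \<theta> then 1 else 0) \<partial>count_space (range (corner l)) \<partial>count_space UNIV)
      = (\<integral>\<^sup>+l. \<integral>\<^sup>+a. indicator {0<..} \<theta> * (?w l * (if (l, a) \<in> J \<theta> then 1 else 0)) \<partial>count_space (range (corner l)) \<partial>count_space UNIV)"
      by (simp add: nn_integral_cmult)
    also have "\<dots> = (\<integral>\<^sup>+l. \<integral>\<^sup>+a. ?e l a \<theta> \<partial>count_space (range (corner l)) \<partial>count_space UNIV)"
      by (intro nn_integral_cong) (auto simp: J_def mult_ac)
    finally show "indicator {0<..} \<theta> * (\<integral>\<^sup>+l. \<integral>\<^sup>+a. ?w l * (if (l, a) \<in> J \<theta> then 1 else 0) \<partial>count_space (range (corner l)) \<partial>count_space UNIV)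
      = (\<integral>\<^sup>+l. \<integral>\<^sup>+a. ?e l a \<theta> \<partial>count_space (range (corner l)) \<partial>count_space UNIV)" .
  qed
  also have "\<dots> = (\<integral>\<^sup>+l. \<integral>\<^sup>+\<theta>. \<integral>\<^sup>+a. ?e l a \<theta> \<partial>count_space (range (corner l)) \<partial>lborel \<partial>count_space UNIV)"
    by (rule nn_integral_count_space_nn_integral) auto
  also have "\<dots> = (\<integral>\<^sup>+l. \<integral>\<^sup>+a. \<integral>\<^sup>+\<theta>. ?e l a \<theta> \<partial>lborel \<partial>count_space (range (corner l)) \<partial>count_space UNIV)"
    by (intro nn_integral_cong nn_integral_count_space_nn_integral countable_range_corner) auto
  also have "\<dots> \<le> T"
  proof (intro nn_integral_mono)
    fix l a
    have "(\<integral>\<^sup>+\<theta>. ?e l a \<theta> \<partial>lborel) = ?w l * (\<integral>\<^sup>+\<theta>. indicator {0<..} \<theta> * (if S (l + 1) a \<le> ennreal \<theta> \<and> ennreal \<theta> < S l a then 1 else 0) \<partial>lborel)"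
      by (rule nn_integral_cmult) measurable
    also have "\<dots> \<le> ?w l * c l a" by (intro mult_left_mono nn_integral_layer) simp
    finally show "(\<integral>\<^sup>+\<theta>. ?e l a \<theta> \<partial>lborel) \<le> ?w l * c l a" .
  qed
  finally show ?thesis .
qed

end

section \<open>Discretization of the seminorm\<close>

lemma nn_integral_count_space_int_from:
  fixes F :: "int \<Rightarrow> ennreal"
  assumes "\<And>j. j < j0 \<Longrightarrow> F j = 0"
  shows "(\<integral>\<^sup>+j. F j \<partial>count_space UNIV) = (\<Sum>p. F (j0 + int p))"
proof -
  have bij: "bij_betw (\<lambda>p. j0 + int p) UNIV {j0..}"
    by (rule bij_betwI[where g = "\<lambda>j. nat (j - j0)"]) auto
  have "(\<integral>\<^sup>+j. F j \<partial>count_space UNIV) = (\<integral>\<^sup>+j. F j \<partial>count_space {j0..})"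
    using assms by (intro nn_integral_count_space_eq) (auto simp: not_le)
  also have "\<dots> = (\<integral>\<^sup>+p. F (j0 + int p) \<partial>count_space UNIV)"
    using nn_integral_bij_count_space[OF bij, of F] by simp
  finally show ?thesis by (simp add: nn_integral_count_space_nat)
qed

lemma nn_integral_count_space_int_shift:
  fixes F :: "int \<Rightarrow> ennreal"
  shows "(\<integral>\<^sup>+l. F (l - i) \<partial>count_space UNIV) = (\<integral>\<^sup>+l. F l \<partial>count_space UNIV)"
  by (rule nn_integral_bij_count_space) (rule bij_betwI[where g = "\<lambda>l. l + i"], auto)

text \<open>After exchanging the order, a step h is counted at the levels j with |h| < 2^j, with
  weight 2^(-j(n+\<beta>)). These weights form a geometric series whose first term is at most
  |h|^(-n-\<beta>), the weight in \<open>W_norm\<close>.\<close>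

lemma sum_dyadic_osc_le:
  fixes f :: "'a::euclidean_space \<Rightarrow> real"
  assumes [measurable]: "f \<in> borel_measurable borel" and \<beta>: "\<beta> > 0" and k_def: "k = 1 + nat \<lfloor>\<beta>\<rfloor>"
  shows "(\<integral>\<^sup>+j. ennreal (2 powr (- (of_int j * \<beta>))) * (\<integral>\<^sup>+y. osc k f (2 powr of_int j) y \<partial>lborel) \<partial>count_space UNIV)
    \<le> (\<Sum>p. ennreal ((2 powr (- (real DIM('a) + \<beta>))) ^ p)) * W_norm \<beta> f"
proof -
  let ?n = "real DIM('a)" and ?\<gamma> = "real DIM('a) + \<beta>"
  let ?I = "\<lambda>h. \<integral>\<^sup>+y. ennreal \<bar>(fdiff h ^^ k) f y\<bar> \<partial>lborel"
  let ?G = "\<Sum>p. ennreal ((2 powr (- ?\<gamma>)) ^ p)"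
  have 1: "ennreal (2 powr (- (of_int j * \<beta>))) * (\<integral>\<^sup>+y. osc k f (2 powr of_int j) y \<partial>lborel)
     = (\<integral>\<^sup>+h. ennreal (2 powr (- (of_int j * ?\<gamma>))) * (if norm h < 2 powr of_int j then ?I h else 0) \<partial>lborel)" for j :: int
  proof -
    have "2 powr (- (of_int j * \<beta>)) * (1 / (2 powr of_int j) ^ DIM('a)) = 2 powr (- (of_int j * ?\<gamma>))"
    proof -
      have "1 / (2 powr of_int j) ^ DIM('a) = 2 powr (- (of_int j * ?n))"
        by (simp add: powr_minus powr_realpow[symmetric] powr_powr divide_inverse)
      then show ?thesis by (simp only: powr_add[symmetric]) (simp add: algebra_simps)
    qed
    then have "ennreal (2 powr (- (of_int j * \<beta>))) * ennreal (1 / (2 powr of_int j) ^ DIM('a)) = ennreal (2 powr (- (of_int j * ?\<gamma>)))"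
      by (subst ennreal_mult[symmetric]) auto
    then have "ennreal (2 powr (- (of_int j * \<beta>))) * (\<integral>\<^sup>+y. osc k f (2 powr of_int j) y \<partial>lborel)
      = ennreal (2 powr (- (of_int j * ?\<gamma>))) * (\<integral>\<^sup>+h. (if norm h < 2 powr of_int j then ?I h else 0) \<partial>lborel)"
      by (subst nn_integral_osc_eq) (simp_all only: mult.assoc[symmetric] assms(1))
    also have "\<dots> = (\<integral>\<^sup>+h. ennreal (2 powr (- (of_int j * ?\<gamma>))) * (if norm h < 2 powr of_int j then ?I h else 0) \<partial>lborel)"
      by (rule nn_integral_cmult[symmetric]) measurable
    finally show ?thesis .
  qed
  have "(\<integral>\<^sup>+j. ennreal (2 powr (- (of_int j * \<beta>))) * (\<integral>\<^sup>+y. osc k f (2 powr of_int j) y \<partial>lborel) \<partial>count_space UNIV)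
     = (\<integral>\<^sup>+h. \<integral>\<^sup>+j. ennreal (2 powr (- (of_int j * ?\<gamma>))) * (if norm h < 2 powr of_int j then ?I h else 0) \<partial>count_space UNIV \<partial>lborel)"
    unfolding 1 by (rule nn_integral_count_space_nn_integral[symmetric]) (simp, measurable)
  also have "\<dots> \<le> (\<integral>\<^sup>+h. ?G * (?I h / ennreal (norm h powr ?\<gamma>)) \<partial>lborel)"
  proof (rule nn_integral_mono_AE)
    have "AE h in lborel. h \<noteq> (0::'a)" by (rule AE_lborel_singleton)
    then show "AE h in lborel. (\<integral>\<^sup>+j. ennreal (2 powr (- (of_int j * ?\<gamma>))) * (if norm h < 2 powr of_int j then ?I h else 0) \<partial>count_space UNIV)
       \<le> ?G * (?I h / ennreal (norm h powr ?\<gamma>))"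
    proof eventually_elim
      fix h :: 'a assume h: "h \<noteq> 0"
      \<comment> \<open>The least integer j with |h| < 2^j; the inequality is strict, hence the
        floor plus 1 rather than the ceiling.\<close>
      define j0 where "j0 = \<lfloor>log 2 (norm h)\<rfloor> + 1"
      have less_iff: "norm h < 2 powr of_int j \<longleftrightarrow> j0 \<le> j" for j :: int
      proof -
        have "norm h < 2 powr of_int j \<longleftrightarrow> log 2 (norm h) < of_int j" using h by (simp add: log_less_iff)
        then show ?thesis unfolding j0_def by linarith
      qed
      have "(\<integral>\<^sup>+j. ennreal (2 powr (- (of_int j * ?\<gamma>))) * (if norm h < 2 powr of_int j then ?I h else 0) \<partial>count_space UNIV)
        = (\<Sum>p. ennreal (2 powr (- (of_int (j0 + int p) * ?\<gamma>))) * (if norm h < 2 powr of_int (j0 + int p) then ?I h else 0))"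
        by (rule nn_integral_count_space_int_from) (simp add: less_iff)
      also have "\<dots> \<le> (\<Sum>p. ennreal ((2 powr (- ?\<gamma>)) ^ p) * (?I h / ennreal (norm h powr ?\<gamma>)))"
      proof (intro suminf_le)
        fix p
        have "2 powr (- (of_int (j0 + int p) * ?\<gamma>)) = (2 powr (- ?\<gamma>)) ^ p * (2 powr of_int j0) powr (- ?\<gamma>)"
          unfolding powr_power_two by (simp add: powr_realpow[symmetric] powr_powr powr_add[symmetric] algebra_simps)
        also have "\<dots> \<le> (2 powr (- ?\<gamma>)) ^ p * norm h powr (- ?\<gamma>)"
          using less_iff[of j0] h \<beta> by (intro mult_left_mono powr_mono2') auto
        finally have "ennreal (2 powr (- (of_int (j0 + int p) * ?\<gamma>))) \<le> ennreal ((2 powr (- ?\<gamma>)) ^ p) * ennreal (norm h powr (- ?\<gamma>))"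
          by (subst ennreal_mult[symmetric]) (auto intro: ennreal_leI)
        moreover have "ennreal (norm h powr (- ?\<gamma>)) = inverse (ennreal (norm h powr ?\<gamma>))"
          using h by (simp only: powr_minus) (subst inverse_ennreal, auto)
        ultimately have "ennreal (2 powr (- (of_int (j0 + int p) * ?\<gamma>))) * ?I h \<le> ennreal ((2 powr (- ?\<gamma>)) ^ p) * inverse (ennreal (norm h powr ?\<gamma>)) * ?I h"
          by (intro mult_right_mono) auto
        then show "ennreal (2 powr (- (of_int (j0 + int p) * ?\<gamma>))) * (if norm h < 2 powr of_int (j0 + int p) then ?I h else 0)
           \<le> ennreal ((2 powr (- ?\<gamma>)) ^ p) * (?I h / ennreal (norm h powr ?\<gamma>))"
          by (simp add: less_iff divide_ennreal_def mult_ac)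
      qed auto
      also have "\<dots> = ?G * (?I h / ennreal (norm h powr ?\<gamma>))" by (rule ennreal_suminf_multc)
      finally show "(\<integral>\<^sup>+j. ennreal (2 powr (- (of_int j * ?\<gamma>))) * (if norm h < 2 powr of_int j then ?I h else 0) \<partial>count_space UNIV)
       \<le> ?G * (?I h / ennreal (norm h powr ?\<gamma>))" .
    qed
  qed
  also have "\<dots> = ?G * W_norm \<beta> f"
    unfolding W_norm_altdef k_def[symmetric] by (rule nn_integral_cmult) measurable
  finally show ?thesis .
qed

section \<open>Capacitary estimates\<close>


lemma enn_powr_mono: "x \<le> y \<Longrightarrow> a \<ge> 0 \<Longrightarrow> enn_powr x a \<le> enn_powr y a"
  by (auto simp: enn_powr_def top_unique less_top intro!: ennreal_leI powr_mono2 enn2real_mono)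

lemma enn_powr_enn_powr:
  assumes "a > 0" shows "enn_powr (enn_powr x a) (1 / a) = x"
  using assms by (cases x) (auto simp: enn_powr_def powr_powr)

lemma enn_powr_le_iff:
  assumes a: "a > 0" shows "enn_powr x a \<le> B \<longleftrightarrow> x \<le> enn_powr B (1 / a)"
proof
  assume "enn_powr x a \<le> B"
  then show "x \<le> enn_powr B (1 / a)"
    using enn_powr_mono[of "enn_powr x a" B "1 / a"] a by (simp add: enn_powr_enn_powr)
next
  assume "x \<le> enn_powr B (1 / a)"
  then have "enn_powr x a \<le> enn_powr (enn_powr B (1 / a)) a" using a by (intro enn_powr_mono) auto
  then show "enn_powr x a \<le> B" using enn_powr_enn_powr[of "1 / a" B] a by simp
qed

lemma Lqinf_norm_le_Lq_norm:
  assumes q: "q > 0" shows "Lqinf_norm q M f \<le> Lq_norm q M f"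
  unfolding Lqinf_norm_def
proof (rule SUP_least)
  fix l :: real assume "l \<in> {0<..}"
  then have l: "l > 0" by simp
  let ?A = "{z \<in> space M. norm (f z) > l}" and ?I = "\<integral>\<^sup>+ z. ennreal (norm (f z) powr q) \<partial>M"
  have cheb: "ennreal (l powr q) * distr_fn M f l \<le> ?I"
  proof (cases "?A \<in> sets M")
    case True
    have "ennreal (l powr q) * distr_fn M f l = (\<integral>\<^sup>+z. ennreal (l powr q) * indicator ?A z \<partial>M)"
      unfolding distr_fn_def by (rule nn_integral_cmult_indicator[symmetric, OF True])
    also have "\<dots> \<le> ?I"
      using l q by (intro nn_integral_mono) (auto simp: indicator_def intro!: ennreal_leI powr_mono2)
    finally show ?thesis .
  next
    \<comment> \<open>A set outside the sigma-algebra has \<open>emeasure\<close> 0, so the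
      inequality is trivial and no measurability of \<open>f\<close> is assumed.\<close>
    case False then show ?thesis by (simp add: distr_fn_def emeasure_notin_sets)
  qed
  have "ennreal l * enn_powr (distr_fn M f l) (1 / q) = enn_powr (ennreal (l powr q) * distr_fn M f l) (1 / q)"
  proof (cases "distr_fn M f l")
    case (real r)
    then have "ennreal (l powr q) * distr_fn M f l = ennreal (l powr q * r)" by (simp add: ennreal_mult)
    then show ?thesis using real l q by (simp add: enn_powr_def powr_mult powr_powr ennreal_mult[symmetric])
  next
    case top
    then show ?thesis using l by (simp add: enn_powr_def ennreal_mult_top)
  qed
  also have "\<dots> \<le> Lq_norm q M f" unfolding Lq_norm_def using cheb q by (intro enn_powr_mono) auto
  finally show "ennreal l * enn_powr (distr_fn M f l) (1 / q) \<le> Lq_norm q M f" .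
qed

text \<open>The degenerate denominators agree with the conventions: w = 0 forces x = 0, where 0 / 0
  = 0, and a quotient by infinity is 0.\<close>

lemma ennreal_divide_le_of_le_mult:
  fixes x w c :: ennreal assumes "x \<le> c * w" "c < \<infinity>" shows "x / w \<le> c"
proof -
  consider "w = 0" | "w = \<infinity>" | "w \<noteq> 0" "w \<noteq> \<infinity>" by blast
  then show ?thesis
  proof cases
    case 1 then show ?thesis using assms by simp
  next
    case 2 then show ?thesis by simp
  next
    case 3
    then have "x / w \<le> c * w / w" using assms by (intro divide_right_mono_ennreal)
    then show ?thesis using 3 by (simp add: ennreal_mult_divide_eq)
  qed
qed

text \<open>Finiteness of \<open>w\<close> matters, because a quotient by infinity is 0 and says
  nothing about \<open>x\<close>.\<close>

lemma ennreal_le_mult_of_divide_le: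
  fixes x w c :: ennreal assumes "x / w \<le> c" "c < \<infinity>" "w < \<infinity>" shows "x \<le> c * w"
proof (cases "w = 0")
  case True
  then have "x = 0" using assms by (cases "x = 0") (auto simp: ennreal_divide_zero top_unique)
  then show ?thesis by simp
next
  case False
  have "x = x / w * w" using False assms(3) by (subst ennreal_divide_times) (simp add: ennreal_divide_self)
  also have "\<dots> \<le> c * w" using assms by (intro mult_right_mono) auto
  finally show ?thesis .
qed

section \<open>Cell means against the seminorm\<close>

lemma scaled_mean_le_shift:
  fixes x y :: "'a::euclidean_space"
  assumes "dist x y \<le> r * s"
  shows "scaled_mean 1 s g x \<le> scaled_mean (r + 1) s g y"
proof -
  have "dist y w < (r + 1) * s" if "dist x w < 1 * s" for w
    using that assms dist_triangle[of y w x] by (simp add: dist_commute distrib_right)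
  then show ?thesis unfolding scaled_mean_def by (intro mult_left_mono nn_integral_mono) auto
qed

text \<open>Two points of a cube of level \<open>l\<close> are at most n 2^l apart, so the ball of
  radius 2^l about one of them lies in the ball of radius (n + 1) 2^l about the other.\<close>

lemma level_sum_le_cell_mean:
  fixes x :: "'a::euclidean_space"
  shows "level_sum k f 1 l x \<le> cell_mean (level_sum k f (real DIM('a) + 1)) l x"
proof (rule le_cell_mean)
  fix y assume "corner l y = corner l x"
  then have "dist x y \<le> real DIM('a) * 2 powr of_int l" using dist_le_if_corner_eq[of l x y] by simp
  then show "level_sum k f 1 l x \<le> level_sum k f (real DIM('a) + 1) l y"
    unfolding level_sum_def by (intro suminf_le scaled_mean_le_shift) auto
qed

text \<open>The weight 2^(l(n-\<beta>)) divided by the volume 2^(l n) is 2^(-l \<beta>) = 2^(-i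
  \<beta>) 2^(-(l-i) \<beta>). The first factor sums over the shells i since \<beta> > 0; the
  second, after a shift of l, is the weight in \<open>sum_dyadic_osc_le\<close>.\<close>

lemma total_cell_mean_le:
  assumes \<beta>: "0 < \<beta>" and k_def: "k = 1 + nat \<lfloor>\<beta>\<rfloor>"
  obtains C :: real where "C > 0" "\<And>f :: 'a::euclidean_space \<Rightarrow> real. f \<in> borel_measurable borel \<Longrightarrow>
    (\<integral>\<^sup>+l. \<integral>\<^sup>+a. ennreal (2 powr (of_int l * (real DIM('a) - \<beta>))) * cell_mean (level_sum k f (real DIM('a) + 1)) l a \<partial>count_space (range (corner l)) \<partial>count_space UNIV)
      \<le> ennreal C * W_norm \<beta> f"
proof -
  let ?\<sigma> = "real DIM('a) + 1"
  define V where "V = ennreal (unit_ball_vol DIM('a) * ?\<sigma> ^ DIM('a))"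
  define G1 where "G1 = (\<Sum>i::nat. ennreal ((2 powr (-\<beta>)) ^ i))"
  define G2 where "G2 = (\<Sum>p::nat. ennreal ((2 powr (- (real DIM('a) + \<beta>))) ^ p))"
  have "G1 < \<infinity>" "G2 < \<infinity>" unfolding G1_def G2_def by (rule suminf_powr_lt_top, use \<beta> in simp)+
  then have "V * (G1 * G2) < \<infinity>" by (intro ennreal_mult_less_top_lt) (auto simp: V_def)
  then obtain C where C: "C \<ge> 0" "V * (G1 * G2) = ennreal C" by (cases "V * (G1 * G2)") auto
  show ?thesis
  proof (rule that[of "C + 1"])
    show "C + 1 > 0" using C by simp
    fix f :: "'a \<Rightarrow> real" assume [measurable]: "f \<in> borel_measurable borel"
    let ?O = "\<lambda>j. \<integral>\<^sup>+y. osc k f (2 powr of_int j) y \<partial>lborel"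
    let ?w = "\<lambda>j. ennreal (2 powr (- (of_int j * \<beta>)))"
    have 1: "(\<integral>\<^sup>+a. ennreal (2 powr (of_int l * (real DIM('a) - \<beta>))) * cell_mean (level_sum k f ?\<sigma>) l a \<partial>count_space (range (corner l)))
      = (\<Sum>i. V * (?w l * ?O (l - int i)))" for l
    proof -
      have "2 powr (of_int l * (real DIM('a) - \<beta>)) * (1 / (2 powr of_int l) ^ DIM('a)) = 2 powr (- (of_int l * \<beta>))"
      proof -
        have "1 / (2 powr of_int l) ^ DIM('a) = 2 powr (- (of_int l * real DIM('a)))"
          by (simp add: powr_minus powr_realpow[symmetric] powr_powr divide_inverse)
        then show ?thesis by (simp only: powr_add[symmetric]) (simp add: algebra_simps)
      qed
      then have w: "ennreal (2 powr (of_int l * (real DIM('a) - \<beta>))) * ennreal (1 / (2 powr of_int l) ^ DIM('a)) = ?w l"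
        by (subst ennreal_mult[symmetric]) auto
      have "(\<integral>\<^sup>+a. ennreal (2 powr (of_int l * (real DIM('a) - \<beta>))) * cell_mean (level_sum k f ?\<sigma>) l a \<partial>count_space (range (corner l)))
        = ennreal (2 powr (of_int l * (real DIM('a) - \<beta>))) * (\<integral>\<^sup>+a. cell_mean (level_sum k f ?\<sigma>) l a \<partial>count_space (range (corner l)))"
        by (rule nn_integral_cmult) simp
      also have "\<dots> = ?w l * (\<integral>\<^sup>+y. level_sum k f ?\<sigma> l y \<partial>lborel)"
        by (subst sum_cell_mean) (simp_all only: w mult.assoc[symmetric], measurable)
      also have "(\<integral>\<^sup>+y. level_sum k f ?\<sigma> l y \<partial>lborel) = (\<Sum>i. \<integral>\<^sup>+y. scaled_mean ?\<sigma> (2 powr of_int l) (osc k f (2 powr of_int (l - int i))) y \<partial>lborel)"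
        unfolding level_sum_def by (rule nn_integral_suminf) measurable
      also have "\<dots> = (\<Sum>i. V * ?O (l - int i))"
        unfolding V_def by (intro suminf_cong nn_integral_scaled_mean) auto
      also have "?w l * (\<Sum>i. V * ?O (l - int i)) = (\<Sum>i. ?w l * (V * ?O (l - int i)))"
        by (rule ennreal_suminf_cmult[symmetric])
      finally show ?thesis by (simp only: mult.left_commute)
    qed
    have 2: "(\<integral>\<^sup>+l. V * (?w l * ?O (l - int i)) \<partial>count_space UNIV) = V * (ennreal ((2 powr (-\<beta>)) ^ i) * (\<integral>\<^sup>+j. ?w j * ?O j \<partial>count_space UNIV))" for i
    proof -
      have "?w l = ennreal ((2 powr (-\<beta>)) ^ i) * ?w (l - int i)" for l
      proof -
        have "2 powr (- (of_int l * \<beta>)) = (2 powr (-\<beta>)) ^ i * 2 powr (- (of_int (l - int i) * \<beta>))"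
          unfolding powr_power_two by (simp add: powr_realpow[symmetric] powr_powr powr_add[symmetric] left_diff_distrib)
        then show ?thesis by (simp only:) (rule ennreal_mult; simp)
      qed
      then have "(\<integral>\<^sup>+l. V * (?w l * ?O (l - int i)) \<partial>count_space UNIV) = (\<integral>\<^sup>+l. (V * ennreal ((2 powr (-\<beta>)) ^ i)) * (?w (l - int i) * ?O (l - int i)) \<partial>count_space UNIV)"
        by (metis (no_types, lifting) mult.assoc)
      also have "\<dots> = (V * ennreal ((2 powr (-\<beta>)) ^ i)) * (\<integral>\<^sup>+l. ?w (l - int i) * ?O (l - int i) \<partial>count_space UNIV)"
        by (rule nn_integral_cmult) simp
      also have "(\<integral>\<^sup>+l. ?w (l - int i) * ?O (l - int i) \<partial>count_space UNIV) = (\<integral>\<^sup>+j. ?w j * ?O j \<partial>count_space UNIV)"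
        by (rule nn_integral_count_space_int_shift[of "\<lambda>j. ?w j * ?O j"])
      finally show ?thesis by (simp only: mult.assoc)
    qed
    have "(\<integral>\<^sup>+l. \<integral>\<^sup>+a. ennreal (2 powr (of_int l * (real DIM('a) - \<beta>))) * cell_mean (level_sum k f ?\<sigma>) l a \<partial>count_space (range (corner l)) \<partial>count_space UNIV)
       = (\<Sum>i. \<integral>\<^sup>+l. V * (?w l * ?O (l - int i)) \<partial>count_space UNIV)"
      unfolding 1 by (rule nn_integral_suminf) simp
    also have "\<dots> = V * (G1 * (\<integral>\<^sup>+j. ?w j * ?O j \<partial>count_space UNIV))"
      unfolding 2 G1_def by (simp only: ennreal_suminf_cmult ennreal_suminf_multc)
    also have "\<dots> \<le> V * (G1 * (G2 * W_norm \<beta> f))"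
      unfolding G2_def by (intro mult_left_mono sum_dyadic_osc_le \<beta> k_def) auto
    also have "\<dots> = ennreal C * W_norm \<beta> f" unfolding C(2)[symmetric] by (simp only: mult.assoc)
    also have "\<dots> \<le> ennreal (C + 1) * W_norm \<beta> f" by (intro mult_right_mono ennreal_leI) auto
    finally show "(\<integral>\<^sup>+l. \<integral>\<^sup>+a. ennreal (2 powr (of_int l * (real DIM('a) - \<beta>))) * cell_mean (level_sum k f ?\<sigma>) l a \<partial>count_space (range (corner l)) \<partial>count_space UNIV)
      \<le> ennreal (C + 1) * W_norm \<beta> f" .
  qed
qed

lemma sum_le_nn_integral_count_space:
  fixes g :: "'b \<Rightarrow> ennreal"
  assumes "finite A" "A \<subseteq> R" shows "(\<Sum>a\<in>A. g a) \<le> (\<integral>\<^sup>+a. g a \<partial>count_space R)"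
proof -
  have "(\<Sum>a\<in>A. g a) = (\<integral>\<^sup>+a. g a \<partial>count_space A)" using assms by (simp add: nn_integral_count_space_finite)
  also have "\<dots> = (\<integral>\<^sup>+a. g a * indicator A a \<partial>count_space UNIV)"
    by (rule nn_integral_count_space_indicator) simp
  also have "\<dots> \<le> (\<integral>\<^sup>+a. g a * indicator R a \<partial>count_space UNIV)"
    using assms(2) by (intro nn_integral_mono) (auto simp: indicator_def)
  also have "\<dots> = (\<integral>\<^sup>+a. g a \<partial>count_space R)"
    by (rule nn_integral_count_space_indicator[symmetric]) simp
  finally show ?thesis .
qed

lemma sum_le_nn_integral_count_space_Sigma:
  fixes w :: "'b \<Rightarrow> 'c \<Rightarrow> ennreal"
  assumes F: "finite F" "F \<subseteq> (SIGMA l:UNIV. R l)"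
  shows "(\<Sum>(l, a)\<in>F. w l a) \<le> (\<integral>\<^sup>+l. \<integral>\<^sup>+a. w l a \<partial>count_space (R l) \<partial>count_space UNIV)"
proof -
  have fin: "finite (F `` {l})" for l
    by (rule finite_subset[OF _ finite_imageI[OF F(1), of snd]]) force
  have "F = (SIGMA l:fst ` F. F `` {l})" by force
  then have "(\<Sum>(l, a)\<in>F. w l a) = (\<Sum>(l, a)\<in>(SIGMA l:fst ` F. F `` {l}). w l a)" by simp
  also have "\<dots> = (\<Sum>l\<in>fst ` F. \<Sum>a\<in>F `` {l}. w l a)"
    using F(1) fin by (subst sum.Sigma) auto
  also have "\<dots> \<le> (\<Sum>l\<in>fst ` F. \<integral>\<^sup>+a. w l a \<partial>count_space (R l))"
    using F fin by (intro sum_mono sum_le_nn_integral_count_space) auto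
  also have "\<dots> \<le> (\<integral>\<^sup>+l. \<integral>\<^sup>+a. w l a \<partial>count_space (R l) \<partial>count_space UNIV)"
    using F by (intro sum_le_nn_integral_count_space) auto
  finally show ?thesis .
qed

text \<open>Continuity from below along an enumeration. It extends the capacity bound, available for
  finite families of boxes, to all boxes of a layer.\<close>

lemma emeasure_countable_UN_le:
  assumes J: "countable J" and B: "\<And>i. i \<in> J \<Longrightarrow> B i \<in> sets M"
    and le: "\<And>F. finite F \<Longrightarrow> F \<subseteq> J \<Longrightarrow> emeasure M (\<Union>i\<in>F. B i) \<le> b"
  shows "emeasure M (\<Union>i\<in>J. B i) \<le> b"
proof (cases "J = {}")
  case False
  let ?f = "from_nat_into J"
  let ?A = "\<lambda>n. \<Union>i\<in>?f ` {..n}. B i"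
  have f: "?f n \<in> J" for n using False by (rule from_nat_into)
  have "(\<Union>i\<in>J. B i) = (\<Union>n. ?A n)"
  proof -
    have "(\<Union>i\<in>J. B i) = (\<Union>i\<in>range ?f. B i)" using range_from_nat_into[OF False J] by simp
    then show ?thesis by auto
  qed
  also have "emeasure M \<dots> = (SUP n. emeasure M (?A n))"
    using B f by (intro SUP_emeasure_incseq[symmetric]) (auto simp: incseq_def intro!: order_trans)
  also have "\<dots> \<le> b" using f by (intro SUP_least le) auto
  finally show ?thesis .
qed simp

section \<open>Boxes and tents\<close>

text \<open>The Carleson box over a dyadic cube, with height equal to the side. A point (t, x) lies
  in the boxes over precisely those cubes containing x whose side is at least t.\<close>

definition dyadic_box :: "int \<Rightarrow> 'a::euclidean_space \<Rightarrow> (real \<times> 'a) set" where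
  "dyadic_box l a = {z \<in> half_space. fst z \<le> 2 powr of_int l \<and> corner l (snd z) = a}"

lemma mem_half_space: "(t, x) \<in> half_space \<longleftrightarrow> t > 0"
  by (simp add: half_space_def)

lemma sets_half_space: "(half_space :: (real \<times> 'a::euclidean_space) set) \<in> sets borel"
  unfolding half_space_def by (intro borel_open open_Times) auto

lemma radon_sets: "radon_half_space \<mu> \<Longrightarrow> sets \<mu> = sets (restrict_space borel half_space)"
  by (simp only: radon_half_space_def)

lemma radon_sets_iff:
  fixes A :: "(real \<times> 'a::euclidean_space) set"
  assumes "radon_half_space \<mu>" shows "A \<in> sets \<mu> \<longleftrightarrow> A \<in> sets borel \<and> A \<subseteq> half_space"
  unfolding radon_sets[OF assms] by (subst sets_restrict_space_iff) (auto simp: sets_half_space)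

lemma radon_space: "radon_half_space \<mu> \<Longrightarrow> space \<mu> = half_space"
  using sets_eq_imp_space_eq[OF radon_sets] by (simp add: space_restrict_space)

lemma tent_sets:
  assumes "radon_half_space \<mu>" shows "tent U \<in> sets \<mu>"
proof -
  have "tent U = half_space \<inter> (\<Inter>y\<in>-U. {z. fst z \<le> dist (snd z) y})"
    by (auto simp: tent_def subset_iff not_less[symmetric])
  moreover have "closed (\<Inter>y\<in>-U. {z::real \<times> _. fst z \<le> dist (snd z) y})"
    by (intro closed_INT ballI closed_Collect_le continuous_intros)
  ultimately have "tent U \<in> sets borel" using sets_half_space by auto
  moreover have "tent U \<subseteq> half_space" by (auto simp: tent_def)
  ultimately show ?thesis using radon_sets_iff[OF assms] by simp
qed

lemma dyadic_box_sets:
  assumes "radon_half_space \<mu>" shows "dyadic_box l a \<in> sets \<mu>"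
proof -
  have [measurable]: "snd \<in> borel_measurable (borel :: (real \<times> 'a) measure)" "fst \<in> borel_measurable (borel :: (real \<times> 'a) measure)"
    by (simp_all add: borel_prod[symmetric])
  have "{z \<in> space borel. fst z \<le> 2 powr of_int l \<and> corner l (snd z) = a} \<in> sets (borel :: (real \<times> 'a) measure)"
    by measurable
  then have "half_space \<inter> {z. fst z \<le> 2 powr of_int l \<and> corner l (snd z) = a} \<in> sets borel" using sets_half_space by auto
  then show ?thesis using radon_sets_iff[OF assms] by (auto simp: dyadic_box_def Collect_conj_eq Int_assoc)
qed

text \<open>A ball about a point of the cube with radius at most 2^l stays within n 2^l + 2^l of the
  vertex \<open>a\<close>.\<close>

lemma dyadic_box_subset_tent:
  fixes a :: "'a::euclidean_space"
  assumes "a \<in> range (corner l)" "ball a ((real DIM('a) + 1) * 2 powr of_int l) \<subseteq> U"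
  shows "dyadic_box l a \<subseteq> tent U"
proof
  fix z assume z: "z \<in> dyadic_box l a"
  obtain t x where tx: "z = (t, x)" by (cases z)
  have *: "z \<in> half_space" "t \<le> 2 powr of_int l" "corner l x = a" using z tx by (auto simp: dyadic_box_def)
  have "corner l a = a" using assms(1) by auto
  then have d: "dist a x \<le> real DIM('a) * 2 powr of_int l" using dist_le_if_corner_eq[of l a x] * by simp
  have "ball x t \<subseteq> ball a ((real DIM('a) + 1) * 2 powr of_int l)"
  proof
    fix y assume "y \<in> ball x t"
    then have "dist x y < 2 powr of_int l" using * by simp
    then show "y \<in> ball a ((real DIM('a) + 1) * 2 powr of_int l)"
      using d dist_triangle[of a y x] by (simp add: distrib_right)
  qed
  then show "z \<in> tent U" using * assms(2) tx by (auto simp: tent_def)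
qed


context decaying_kernel
begin

text \<open>The coefficients are a constant times the cell means of the level sums. Finiteness of
  the seminorm makes their weighted total finite, as the stratification requires; \<open>K\<close>
  does not depend on \<open>f\<close>.\<close>

lemma dyadic_layers_W_space:
  assumes \<beta>: "0 < \<beta>" "\<beta> < real DIM('a)"
  shows "\<exists>(K::real) c. K > 0 \<and> (\<forall>f. f \<in> W_space \<beta> \<longrightarrow> W_norm \<beta> f < \<infinity> \<longrightarrow>
    dyadic_layers (c f) (real DIM('a) - \<beta>) \<and>
    (\<integral>\<^sup>+l. \<integral>\<^sup>+a. ennreal (2 powr (of_int l * (real DIM('a) - \<beta>))) * c f l a \<partial>count_space (range (corner l)) \<partial>count_space UNIV) \<le> ennreal K * W_norm \<beta> f \<and>
    (\<forall>t x l. t > 0 \<longrightarrow> t \<le> 2 powr of_int l \<longrightarrow> 2 powr of_int l \<le> 2 * t \<longrightarrow>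
       (\<integral>\<^sup>+z. ennreal (dil t (x - z)) * ennreal \<bar>f z\<bar> \<partial>lborel) \<le> (\<Sum>p. c f (l + int p) x)))"
proof -
  define k where "k = 1 + nat \<lfloor>\<beta>\<rfloor>"
  obtain K1 where K1: "K1 > 0" "\<And>f t x l. f \<in> W_space \<beta> \<Longrightarrow> t > 0 \<Longrightarrow> t \<le> 2 powr of_int l \<Longrightarrow> 2 powr of_int l \<le> 2 * t \<Longrightarrow>
     (\<integral>\<^sup>+z. ennreal (dil t (x - z)) * ennreal \<bar>f z\<bar> \<partial>lborel) \<le> ennreal K1 * (\<Sum>p. level_sum k f 1 (l + int p) x)"
    using nn_integral_dil_W_space_le[OF \<beta> k_def] by blast
  obtain K2 where K2: "K2 > 0" "\<And>f :: 'a \<Rightarrow> real. f \<in> borel_measurable borel \<Longrightarrow>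
    (\<integral>\<^sup>+l. \<integral>\<^sup>+a. ennreal (2 powr (of_int l * (real DIM('a) - \<beta>))) * cell_mean (level_sum k f (real DIM('a) + 1)) l a \<partial>count_space (range (corner l)) \<partial>count_space UNIV)
      \<le> ennreal K2 * W_norm \<beta> f"
    using total_cell_mean_le[OF \<beta>(1) k_def] by blast
  define c where "c f l x = ennreal K1 * cell_mean (level_sum k f (real DIM('a) + 1)) l x" for f :: "'a \<Rightarrow> real" and l x
  have tot: "(\<integral>\<^sup>+l. \<integral>\<^sup>+a. ennreal (2 powr (of_int l * (real DIM('a) - \<beta>))) * c f l a \<partial>count_space (range (corner l)) \<partial>count_space UNIV) \<le> ennreal (K1 * K2) * W_norm \<beta> f"
    if "f \<in> W_space \<beta>" for f
  proof -
    have f: "f \<in> borel_measurable borel" using that by (simp add: W_space_def)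
    have "(\<integral>\<^sup>+l. \<integral>\<^sup>+a. ennreal (2 powr (of_int l * (real DIM('a) - \<beta>))) * c f l a \<partial>count_space (range (corner l)) \<partial>count_space UNIV)
      = (\<integral>\<^sup>+l. ennreal K1 * (\<integral>\<^sup>+a. ennreal (2 powr (of_int l * (real DIM('a) - \<beta>))) * cell_mean (level_sum k f (real DIM('a) + 1)) l a \<partial>count_space (range (corner l))) \<partial>count_space UNIV)"
      by (intro nn_integral_cong, subst nn_integral_cmult[symmetric]) (simp_all add: c_def mult_ac)
    also have "\<dots> = ennreal K1 * (\<integral>\<^sup>+l. \<integral>\<^sup>+a. ennreal (2 powr (of_int l * (real DIM('a) - \<beta>))) * cell_mean (level_sum k f (real DIM('a) + 1)) l a \<partial>count_space (range (corner l)) \<partial>count_space UNIV)"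
      by (rule nn_integral_cmult) simp
    also have "\<dots> \<le> ennreal K1 * (ennreal K2 * W_norm \<beta> f)" by (intro mult_left_mono K2 f) auto
    finally show ?thesis using K1 K2 by (simp add: ennreal_mult mult.assoc)
  qed
  show ?thesis
  proof (intro exI[of _ "K1 * K2"] exI[of _ c] conjI allI impI)
    show "K1 * K2 > 0" using K1 K2 by simp
    fix f :: "'a \<Rightarrow> real" assume f: "f \<in> W_space \<beta>" "W_norm \<beta> f < \<infinity>"
    show "(\<integral>\<^sup>+l. \<integral>\<^sup>+a. ennreal (2 powr (of_int l * (real DIM('a) - \<beta>))) * c f l a \<partial>count_space (range (corner l)) \<partial>count_space UNIV) \<le> ennreal (K1 * K2) * W_norm \<beta> f"
      by (rule tot[OF f(1)])
    show "dyadic_layers (c f) (real DIM('a) - \<beta>)"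
    proof
      show "real DIM('a) - \<beta> > 0" using \<beta> by simp
      show "c f l x = c f l y" if "corner l x = corner l y" for l x y
        unfolding c_def using cell_mean_cong[OF that] by simp
      have "ennreal (K1 * K2) * W_norm \<beta> f < \<infinity>" using f(2) by (intro ennreal_mult_less_top_lt) auto
      then show "(\<integral>\<^sup>+l. \<integral>\<^sup>+a. ennreal (2 powr (of_int l * (real DIM('a) - \<beta>))) * c f l a \<partial>count_space (range (corner l)) \<partial>count_space UNIV) < \<infinity>"
        by (rule le_less_trans[OF tot[OF f(1)]])
    qed
    fix t :: real and x :: 'a and l :: int assume t: "t > 0" "t \<le> 2 powr of_int l" "2 powr of_int l \<le> 2 * t"
    have "(\<integral>\<^sup>+z. ennreal (dil t (x - z)) * ennreal \<bar>f z\<bar> \<partial>lborel) \<le> ennreal K1 * (\<Sum>p. level_sum k f 1 (l + int p) x)"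
      by (rule K1(2)[OF f(1) t])
    also have "\<dots> \<le> ennreal K1 * (\<Sum>p. cell_mean (level_sum k f (real DIM('a) + 1)) (l + int p) x)"
      by (intro mult_left_mono suminf_le level_sum_le_cell_mean) auto
    also have "\<dots> = (\<Sum>p. c f (l + int p) x)" unfolding c_def by (rule ennreal_suminf_cmult[symmetric])
    finally show "(\<integral>\<^sup>+z. ennreal (dil t (x - z)) * ennreal \<bar>f z\<bar> \<partial>lborel) \<le> (\<Sum>p. c f (l + int p) x)" .
  qed
qed

lemma dyadic_scale:
  fixes t :: real assumes "t > 0" obtains l :: int where "t \<le> 2 powr of_int l" "2 powr of_int l \<le> 2 * t"
proof (rule that[of "\<lceil>log 2 t\<rceil>"])
  have "t = 2 powr log 2 t" using assms by simp
  also have "\<dots> \<le> 2 powr of_int \<lceil>log 2 t\<rceil>" by (intro powr_mono) auto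
  finally show "t \<le> 2 powr of_int \<lceil>log 2 t\<rceil>" .
  have "2 powr of_int \<lceil>log 2 t\<rceil> \<le> 2 powr (log 2 t + 1)" by (intro powr_mono) linarith+
  also have "\<dots> = 2 * t" using assms by (simp add: powr_add)
  finally show "2 powr of_int \<lceil>log 2 t\<rceil> \<le> 2 * t" .
qed

text \<open>The dyadic sum that bounds the integral is finite at every point, not just almost
  everywhere, by \<open>S_finite\<close>. Thus the convolution converges absolutely for each
  x.\<close>

lemma nn_integral_dil_W_space_finite:
  assumes \<beta>: "0 < \<beta>" "\<beta> < real DIM('a)" and f: "f \<in> W_space \<beta>" "W_norm \<beta> f < \<infinity>" and t: "t > 0"
  shows "(\<integral>\<^sup>+z. ennreal (dil t (x - z)) * ennreal \<bar>f z\<bar> \<partial>lborel) < \<infinity>"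
proof -
  from dyadic_layers_W_space[OF \<beta>] obtain K :: real and c where
    "\<forall>f. f \<in> W_space \<beta> \<longrightarrow> W_norm \<beta> f < \<infinity> \<longrightarrow> dyadic_layers (c f) (real DIM('a) - \<beta>) \<and>
    (\<integral>\<^sup>+l. \<integral>\<^sup>+a. ennreal (2 powr (of_int l * (real DIM('a) - \<beta>))) * c f l a \<partial>count_space (range (corner l)) \<partial>count_space UNIV) \<le> ennreal K * W_norm \<beta> f \<and>
    (\<forall>t x l. t > 0 \<longrightarrow> t \<le> 2 powr of_int l \<longrightarrow> 2 powr of_int l \<le> 2 * t \<longrightarrow>
       (\<integral>\<^sup>+z. ennreal (dil t (x - z)) * ennreal \<bar>f z\<bar> \<partial>lborel) \<le> (\<Sum>p. c f (l + int p) x))"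
    by (elim exE conjE)
  note c = this[rule_format, OF f]
  note lay = conjunct1[OF c] and le = conjunct2[OF conjunct2[OF c], rule_format]
  interpret dyadic_layers "c f" "real DIM('a) - \<beta>" by (rule lay)
  obtain l where l: "t \<le> 2 powr of_int l" "2 powr of_int l \<le> 2 * t" using dyadic_scale[OF t] by blast
  show ?thesis using le[OF t l] S_finite[of l x] unfolding S_def by (rule le_less_trans)
qed

lemma nn_integral_dil_ball:
  assumes t: "t > 0"
  shows "(\<integral>\<^sup>+z. ennreal (dil t (x - z)) * indicator (ball x t) z \<partial>lborel) = (\<integral>\<^sup>+z. indicator (ball 0 1) z * ennreal (q z) \<partial>lborel)"
proof -
  have "(\<integral>\<^sup>+z. ennreal (dil t (x - z)) * indicator (ball x t) z \<partial>lborel) = (\<integral>\<^sup>+z. ennreal (dil t (x - z)) * indicator (ball 0 t) (x - z) \<partial>lborel)"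
    by (intro nn_integral_cong) (auto simp: indicator_def dist_norm norm_minus_commute)
  also have "\<dots> = (\<integral>\<^sup>+z. ennreal (dil t z) * indicator (ball 0 t) z \<partial>lborel)"
    by (rule nn_integral_lborel_reflect) measurable
  also have "\<dots> = ennreal (\<bar>t\<bar> ^ DIM('a)) * (\<integral>\<^sup>+z. ennreal (dil t (0 + t *\<^sub>R z)) * indicator (ball 0 t) (0 + t *\<^sub>R z) \<partial>lborel)"
    using t by (intro nn_integral_lborel_affine) auto
  also have "\<dots> = (\<integral>\<^sup>+z. ennreal (t ^ DIM('a)) * (ennreal (dil t (t *\<^sub>R z)) * indicator (ball 0 t) (t *\<^sub>R z)) \<partial>lborel)"
    using t by (subst nn_integral_cmult) auto
  also have "\<dots> = (\<integral>\<^sup>+z. indicator (ball 0 1) z * ennreal (q z) \<partial>lborel)"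
    using t by (intro nn_integral_cong) (auto simp: dil_def ennreal_mult'[symmetric] indicator_def)
  finally show ?thesis .
qed

end

section \<open>Weak type, tent capacity and strong type\<close>

text \<open>Here \<open>q\<close> is the profile of the heat kernel; the Lebesgue exponent called q
  in the theorem is \<open>exponent\<close>.\<close>

locale caloric = decaying_kernel q C for q :: "'a::euclidean_space \<Rightarrow> real" and C +
  fixes \<alpha> \<beta> exponent :: real and \<mu> :: "(real \<times> 'a) measure"
  assumes kernel: "\<And>s x. s > 0 \<Longrightarrow> heat_kernel \<alpha> (s powr (2 * \<alpha>)) x = complex_of_real (dil s x)"
    and mass: "(\<integral>\<^sup>+z. indicator (ball 0 1) z * ennreal (q z) \<partial>lborel) > 0"
    and \<beta>: "0 < \<beta>" "\<beta> < real DIM('a)" and exponent: "exponent > 0" and radon: "radon_half_space \<mu>"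
begin

lemma caloric_ext_eq:
  "t > 0 \<Longrightarrow> caloric_ext \<alpha> f (t, x) = complex_of_real (LINT y|lborel. dil t (x - y) * f y)"
  by (simp add: caloric_ext_def heat_semigroup_def kernel integral_complex_of_real[symmetric] del: integral_complex_of_real)

lemma caloric_ext_le:
  assumes "t > 0"
  shows "ennreal (norm (caloric_ext \<alpha> f (t, x))) \<le> (\<integral>\<^sup>+z. ennreal (dil t (x - z)) * ennreal \<bar>f z\<bar> \<partial>lborel)"
proof -
  have "ennreal (norm (caloric_ext \<alpha> f (t, x))) \<le> (\<integral>\<^sup>+z. ennreal \<bar>dil t (x - z) * f z\<bar> \<partial>lborel)"
    unfolding caloric_ext_eq[OF assms] norm_of_real by (rule ennreal_abs_integral_le)
  also have "\<dots> = (\<integral>\<^sup>+z. ennreal (dil t (x - z)) * ennreal \<bar>f z\<bar> \<partial>lborel)"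
    using dil_nonneg[OF assms] by (intro nn_integral_cong) (simp add: abs_mult ennreal_mult)
  finally show ?thesis .
qed

lemma caloric_level_sets:
  assumes [measurable]: "f \<in> borel_measurable borel"
  shows "{z \<in> space \<mu>. norm (caloric_ext \<alpha> f z) > r} \<in> sets \<mu>"
proof -
  have "caloric_ext \<alpha> f \<in> borel_measurable borel" by (rule borel_measurable_caloric_ext) fact
  then have "caloric_ext \<alpha> f \<in> borel_measurable (restrict_space borel half_space)" by (rule measurable_restrict_space1)
  then have [measurable]: "caloric_ext \<alpha> f \<in> borel_measurable \<mu>"
    using measurable_cong_sets[OF radon_sets[OF radon] refl] by blast
  show ?thesis by measurable
qed

lemma tent_capacity_of_weak_type:
  assumes weak: "C' > 0" "\<forall>v0 \<in> W_space \<beta>. Lqinf_norm exponent \<mu> (caloric_ext \<alpha> v0) \<le> ennreal C' * W_norm \<beta> v0"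
  shows "(SUP U \<in> {U :: 'a set. open U}. enn_powr (emeasure \<mu> (tent U)) (1 / exponent) / W_cap \<beta> U) < \<infinity>"
proof -
  let ?m = "\<integral>\<^sup>+z. indicator (ball 0 1) z * ennreal (q z) \<partial>lborel"
  have "?m \<le> (\<integral>\<^sup>+z. ennreal (q z) \<partial>lborel)" by (intro nn_integral_mono) (auto simp: indicator_def)
  then have "?m \<le> ennreal C" using q_integral by (rule order_trans)
  then have "?m < \<infinity>" by (simp add: le_less_trans)
  then obtain m where m: "m \<ge> 0" "?m = ennreal m" by (cases ?m) auto
  then have m0: "m > 0" using mass by auto
  \<comment> \<open>The extension is at least \<open>m\<close> on the tent, but level sets are
    defined by a strict inequality, so the height must be below \<open>m\<close>.\<close>
  define \<eta> where "\<eta> = m / 2"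
  have \<eta>: "\<eta> > 0" "\<eta> < m" using m0 by (auto simp: \<eta>_def)
  have main: "ennreal \<eta> * enn_powr (emeasure \<mu> (tent U)) (1 / exponent) \<le> ennreal C' * W_norm \<beta> f"
    if f: "f \<in> W_space \<beta>" "\<And>x. f x \<ge> 0" "U \<subseteq> interior {x. f x \<ge> 1}" for f and U :: "'a set"
  proof (cases "W_norm \<beta> f < \<infinity>")
    case False
    then have "W_norm \<beta> f = top" by (simp add: less_top[symmetric])
    then have "ennreal C' * W_norm \<beta> f = \<infinity>" using weak(1) by (simp add: ennreal_mult_top)
    then show ?thesis by simp
  next
    case fin: True
    have [measurable]: "f \<in> borel_measurable borel" using f by (simp add: W_space_def)
    have sub: "tent U \<subseteq> {z \<in> space \<mu>. norm (caloric_ext \<alpha> f z) > \<eta>}"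
    proof
      fix z assume z: "z \<in> tent U"
      obtain t x where tx: "z = (t, x)" by (cases z)
      have t: "t > 0" "ball x t \<subseteq> U" using z tx by (auto simp: tent_def mem_half_space)
      let ?g = "\<lambda>y. dil t (x - y) * f y"
      have g0: "?g y \<ge> 0" for y using dil_nonneg[OF t(1)] f(2) by simp
      have "(\<integral>\<^sup>+y. ennreal (norm (?g y)) \<partial>lborel) = (\<integral>\<^sup>+z. ennreal (dil t (x - z)) * ennreal \<bar>f z\<bar> \<partial>lborel)"
        using dil_nonneg[OF t(1)] by (intro nn_integral_cong) (simp add: abs_mult ennreal_mult)
      also have "\<dots> < \<infinity>" by (rule nn_integral_dil_W_space_finite[OF \<beta> f(1) fin t(1)])
      finally have int: "integrable lborel ?g" by (intro integrableI_bounded) auto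
      \<comment> \<open>The mass of the dilated kernel in the ball of radius t about x does not
        depend on t, and on that ball, which lies in U by definition of the tent, f is at least
        1.\<close>
      have "ennreal m = (\<integral>\<^sup>+y. ennreal (dil t (x - y)) * indicator (ball x t) y \<partial>lborel)"
        unfolding m(2)[symmetric] by (rule nn_integral_dil_ball[OF t(1), symmetric])
      also have "\<dots> \<le> (\<integral>\<^sup>+y. ennreal (?g y) \<partial>lborel)"
      proof (rule nn_integral_mono)
        fix y
        show "ennreal (dil t (x - y)) * indicator (ball x t) y \<le> ennreal (?g y)"
        proof (cases "y \<in> ball x t")
          case True
          then have "f y \<ge> 1" using t f(3) interior_subset by blast
          then have "dil t (x - y) * 1 \<le> ?g y" using dil_nonneg[OF t(1)] by (intro mult_left_mono) auto
          then show ?thesis using True by (simp add: ennreal_leI)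
        qed simp
      qed
      also have "\<dots> = ennreal (LINT y|lborel. ?g y)" by (rule nn_integral_eq_integral[OF int]) (simp add: g0)
      finally have "m \<le> (LINT y|lborel. ?g y)"
        using m0 by (subst (asm) ennreal_le_iff) (auto intro: integral_nonneg_AE simp: g0)
      then show "z \<in> {z \<in> space \<mu>. norm (caloric_ext \<alpha> f z) > \<eta>}"
        using \<eta> t radon_space[OF radon] by (simp add: tx caloric_ext_eq mem_half_space)
    qed
    have "emeasure \<mu> (tent U) \<le> distr_fn \<mu> (caloric_ext \<alpha> f) \<eta>"
      unfolding distr_fn_def by (rule emeasure_mono[OF sub caloric_level_sets]) measurable
    then have "ennreal \<eta> * enn_powr (emeasure \<mu> (tent U)) (1 / exponent) \<le> ennreal \<eta> * enn_powr (distr_fn \<mu> (caloric_ext \<alpha> f) \<eta>) (1 / exponent)"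
      using exponent by (intro mult_left_mono enn_powr_mono) auto
    also have "\<dots> \<le> Lqinf_norm exponent \<mu> (caloric_ext \<alpha> f)"
      unfolding Lqinf_norm_def using \<eta> by (intro SUP_upper) auto
    also have "\<dots> \<le> ennreal C' * W_norm \<beta> f" using weak f by blast
    finally show ?thesis .
  qed
  have "enn_powr (emeasure \<mu> (tent U)) (1 / exponent) / W_cap \<beta> U \<le> ennreal (C' / \<eta>)" for U :: "'a set"
  proof (rule ennreal_divide_le_of_le_mult)
    let ?x = "enn_powr (emeasure \<mu> (tent U)) (1 / exponent)"
    \<comment> \<open>The constants are moved to the left so that a lower bound for every admissible
      function is a lower bound for the infimum, including the empty one, which is infinite.\<close>
    have "ennreal (\<eta> / C') * ?x \<le> W_cap \<beta> U"
      unfolding W_cap_def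
    proof (rule Inf_greatest)
      fix w assume "w \<in> {W_norm \<beta> f |f. f \<in> W_space \<beta> \<and> (\<forall>x. 0 \<le> f x) \<and> U \<subseteq> interior {x. 1 \<le> f x}}"
      then obtain f where f: "w = W_norm \<beta> f" "f \<in> W_space \<beta>" "\<And>x. f x \<ge> 0" "U \<subseteq> interior {x. f x \<ge> 1}" by blast
      have "ennreal (1 / C') * (ennreal \<eta> * ?x) \<le> ennreal (1 / C') * (ennreal C' * w)"
        unfolding f(1) by (intro mult_left_mono main f) auto
      moreover have "ennreal (1 / C') * (ennreal \<eta> * ?x) = ennreal (\<eta> / C') * ?x"
        using weak(1) \<eta> by (simp add: mult.assoc[symmetric] ennreal_mult[symmetric])
      moreover have "ennreal (1 / C') * (ennreal C' * w) = w"
        using weak(1) by (simp add: mult.assoc[symmetric] ennreal_mult[symmetric])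
      ultimately show "ennreal (\<eta> / C') * ?x \<le> w" by simp
    qed
    then have "ennreal (C' / \<eta>) * (ennreal (\<eta> / C') * ?x) \<le> ennreal (C' / \<eta>) * W_cap \<beta> U" by (rule mult_left_mono) simp
    moreover have "ennreal (C' / \<eta>) * (ennreal (\<eta> / C') * ?x) = ?x"
      using weak(1) \<eta> by (simp add: mult.assoc[symmetric] ennreal_mult[symmetric])
    ultimately show "?x \<le> ennreal (C' / \<eta>) * W_cap \<beta> U" by simp
  qed simp
  then have "(SUP U \<in> {U :: 'a set. open U}. enn_powr (emeasure \<mu> (tent U)) (1 / exponent) / W_cap \<beta> U) \<le> ennreal (C' / \<eta>)"
    by (intro SUP_least)
  then show ?thesis by (rule le_less_trans) simp
qed

text \<open>Each cube is enlarged to a concentric-at-the-vertex ball of radius (n + 1) 2^l. The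
  union of these balls is an open set whose tent contains all the boxes and whose capacity is at
  most a multiple of the sum of (side)^(n-\<beta>).\<close>

lemma emeasure_dyadic_boxes_le:
  assumes cap: "(SUP U \<in> {U :: 'a set. open U}. enn_powr (emeasure \<mu> (tent U)) (1 / exponent) / W_cap \<beta> U) < \<infinity>"
  obtains M :: real where "M > 0" "\<And>F. finite F \<Longrightarrow> F \<subseteq> (SIGMA l:UNIV. range (corner l)) \<Longrightarrow>
    enn_powr (emeasure \<mu> (\<Union>(l, a)\<in>F. dyadic_box l a)) (1 / exponent) \<le> ennreal M * (\<Sum>(l, a)\<in>F. ennreal (2 powr (of_int l * (real DIM('a) - \<beta>))))"
proof -
  let ?d = "real DIM('a) - \<beta>" and ?\<sigma> = "real DIM('a) + 1"
  obtain A where A: "A \<ge> 0" "(SUP U \<in> {U :: 'a set. open U}. enn_powr (emeasure \<mu> (tent U)) (1 / exponent) / W_cap \<beta> U) = ennreal A"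
    using cap by (cases "SUP U \<in> {U :: 'a set. open U}. enn_powr (emeasure \<mu> (tent U)) (1 / exponent) / W_cap \<beta> U") auto
  obtain C1 where C1: "C1 > 0" "\<And>(I :: (int \<times> 'a) set) (a :: int \<times> 'a \<Rightarrow> 'a) r. finite I \<Longrightarrow> (\<And>i. i \<in> I \<Longrightarrow> r i > 0) \<Longrightarrow>
     W_cap \<beta> (\<Union>i\<in>I. ball (a i) (r i)) \<le> ennreal (C1 * (\<Sum>i\<in>I. r i powr ?d))"
    using W_cap_union_balls_le[OF \<beta>(1)] by blast
  show ?thesis
  proof (rule that[of "(A + 1) * (C1 * ?\<sigma> powr ?d)"])
    show "(A + 1) * (C1 * ?\<sigma> powr ?d) > 0" using A C1 by (intro mult_pos_pos) auto
    fix F :: "(int \<times> 'a) set" assume F: "finite F" "F \<subseteq> (SIGMA l:UNIV. range (corner l))"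
    define r where "r i = ?\<sigma> * 2 powr of_int (fst i)" for i :: "int \<times> 'a"
    define U where "U = (\<Union>i\<in>F. ball (snd i) (r i))"
    have U: "open U" unfolding U_def by auto
    have sub: "(\<Union>(l, a)\<in>F. dyadic_box l a) \<subseteq> tent U"
    proof clarify
      fix l a t x assume i: "(l, a) \<in> F" and z: "(t, x) \<in> dyadic_box l a"
      have "ball a (?\<sigma> * 2 powr of_int l) \<subseteq> U" unfolding U_def r_def using i by force
      moreover have "a \<in> range (corner l)" using F i by blast
      ultimately show "(t, x) \<in> tent U" using dyadic_box_subset_tent[of a l U] z by blast
    qed
    have cap_le: "W_cap \<beta> U \<le> ennreal (C1 * (\<Sum>i\<in>F. r i powr ?d))"
      unfolding U_def by (rule C1(2)[OF F(1)]) (simp add: r_def)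
    have "enn_powr (emeasure \<mu> (\<Union>(l, a)\<in>F. dyadic_box l a)) (1 / exponent) \<le> enn_powr (emeasure \<mu> (tent U)) (1 / exponent)"
      using exponent by (intro enn_powr_mono emeasure_mono sub tent_sets radon) auto
    also have "\<dots> \<le> ennreal A * W_cap \<beta> U"
    proof (rule ennreal_le_mult_of_divide_le)
      show "enn_powr (emeasure \<mu> (tent U)) (1 / exponent) / W_cap \<beta> U \<le> ennreal A"
        unfolding A(2)[symmetric] using U by (intro SUP_upper) simp
      \<comment> \<open>An infinite capacity would make the quotient 0, and the hypothesis would
        give no information on the tent.\<close>
      show "W_cap \<beta> U < \<infinity>" using cap_le by (simp add: le_less_trans)
    qed simp
    also have "\<dots> \<le> ennreal (A + 1) * ennreal (C1 * (\<Sum>i\<in>F. r i powr ?d))"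
      by (intro mult_mono cap_le ennreal_leI) auto
    also have "\<dots> = ennreal ((A + 1) * (C1 * ?\<sigma> powr ?d)) * ennreal (\<Sum>i\<in>F. 2 powr (of_int (fst i) * ?d))"
    proof -
      have "(\<Sum>i\<in>F. r i powr ?d) = ?\<sigma> powr ?d * (\<Sum>i\<in>F. 2 powr (of_int (fst i) * ?d))"
        by (simp add: r_def powr_mult powr_powr sum_distrib_left)
      then have "(A + 1) * (C1 * (\<Sum>i\<in>F. r i powr ?d)) = ((A + 1) * (C1 * ?\<sigma> powr ?d)) * (\<Sum>i\<in>F. 2 powr (of_int (fst i) * ?d))"
        by (simp only: mult.assoc)
      moreover have "ennreal ((A + 1) * (C1 * (\<Sum>i\<in>F. r i powr ?d))) = ennreal (A + 1) * ennreal (C1 * (\<Sum>i\<in>F. r i powr ?d))"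
        using A(1) C1(1) by (intro ennreal_mult mult_nonneg_nonneg sum_nonneg) auto
      moreover have "ennreal (((A + 1) * (C1 * ?\<sigma> powr ?d)) * (\<Sum>i\<in>F. 2 powr (of_int (fst i) * ?d)))
         = ennreal ((A + 1) * (C1 * ?\<sigma> powr ?d)) * ennreal (\<Sum>i\<in>F. 2 powr (of_int (fst i) * ?d))"
        using A(1) C1(1) by (intro ennreal_mult mult_nonneg_nonneg sum_nonneg) auto
      ultimately show ?thesis by (simp only:)
    qed
    also have "ennreal (\<Sum>i\<in>F. 2 powr (of_int (fst i) * ?d)) = (\<Sum>(l, a)\<in>F. ennreal (2 powr (of_int l * ?d)))"
      by (simp add: split_beta')
    finally show "enn_powr (emeasure \<mu> (\<Union>(l, a)\<in>F. dyadic_box l a)) (1 / exponent) \<le> ennreal ((A + 1) * (C1 * ?\<sigma> powr ?d)) * (\<Sum>(l, a)\<in>F. ennreal (2 powr (of_int l * ?d)))" .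
  qed
qed

lemma strong_type_of_tent_capacity:
  assumes cap: "(SUP U \<in> {U :: 'a set. open U}. enn_powr (emeasure \<mu> (tent U)) (1 / exponent) / W_cap \<beta> U) < \<infinity>"
  shows "\<exists>C'::real. C' > 0 \<and> (\<forall>v0 \<in> W_space \<beta>. Lq1_norm exponent \<mu> (caloric_ext \<alpha> v0) \<le> ennreal C' * W_norm \<beta> v0)"
proof -
  let ?d = "real DIM('a) - \<beta>"
  let ?w = "\<lambda>l::int. ennreal (2 powr (of_int l * ?d))"
  obtain M where M: "M > 0" "\<And>F. finite F \<Longrightarrow> F \<subseteq> (SIGMA l:UNIV. range (corner l)) \<Longrightarrow>
    enn_powr (emeasure \<mu> (\<Union>(l, a)\<in>F. dyadic_box l a)) (1 / exponent) \<le> ennreal M * (\<Sum>(l, a)\<in>F. ?w l)"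
    using emeasure_dyadic_boxes_le[OF cap] by blast
  from dyadic_layers_W_space[OF \<beta>] obtain K :: real and c where K: "K > 0" and
    c: "\<forall>f. f \<in> W_space \<beta> \<longrightarrow> W_norm \<beta> f < \<infinity> \<longrightarrow> dyadic_layers (c f) ?d \<and>
    (\<integral>\<^sup>+l. \<integral>\<^sup>+a. ?w l * c f l a \<partial>count_space (range (corner l)) \<partial>count_space UNIV) \<le> ennreal K * W_norm \<beta> f \<and>
    (\<forall>t x l. t > 0 \<longrightarrow> t \<le> 2 powr of_int l \<longrightarrow> 2 powr of_int l \<le> 2 * t \<longrightarrow>
       (\<integral>\<^sup>+z. ennreal (dil t (x - z)) * ennreal \<bar>f z\<bar> \<partial>lborel) \<le> (\<Sum>p. c f (l + int p) x))"
    by (elim exE conjE)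
  note c = c[rule_format]
  note lay = conjunct1[OF c] and tot = conjunct1[OF conjunct2[OF c]] and le = conjunct2[OF conjunct2[OF c], rule_format]
  have MK: "M * K > 0" using M K by simp
  have "Lq1_norm exponent \<mu> (caloric_ext \<alpha> f) \<le> ennreal (M * K) * W_norm \<beta> f" if f: "f \<in> W_space \<beta>" for f
  proof (cases "W_norm \<beta> f < \<infinity>")
    case False
    then have "W_norm \<beta> f = top" by (simp add: less_top[symmetric])
    then have "ennreal (M * K) * W_norm \<beta> f = \<infinity>" using M(1) K by (simp add: ennreal_mult_top)
    then show ?thesis by simp
  next
    case fin: True
    interpret dyadic_layers "c f" ?d by (rule lay[OF f fin])
    \<comment> \<open>The sum of (side)^d over the cubes of the layer at height \<theta>. Its
      integral over \<theta> is at most the total of the coefficients.\<close>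
    define N where "N \<theta> = (\<integral>\<^sup>+l. \<integral>\<^sup>+a. ?w l * (if (l, a) \<in> J \<theta> then 1 else 0) \<partial>count_space (range (corner l)) \<partial>count_space UNIV)" for \<theta>
    have [measurable]: "N \<in> borel_measurable borel" unfolding N_def[abs_def] by (rule layers_measurable)
    have layer: "enn_powr (distr_fn \<mu> (caloric_ext \<alpha> f) \<theta>) (1 / exponent) \<le> ennreal M * N \<theta>" if \<theta>: "\<theta> > 0" for \<theta>
    proof -
      have sub: "{z \<in> space \<mu>. norm (caloric_ext \<alpha> f z) > \<theta>} \<subseteq> (\<Union>(l, a)\<in>J \<theta>. dyadic_box l a)"
      proof clarify
        fix t x assume z: "(t, x) \<in> space \<mu>" and gt: "norm (caloric_ext \<alpha> f (t, x)) > \<theta>"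
        have t: "t > 0" using z radon_space[OF radon] by (simp add: mem_half_space)
        obtain l where l: "t \<le> 2 powr of_int l" "2 powr of_int l \<le> 2 * t" using dyadic_scale[OF t] by blast
        have "ennreal \<theta> < ennreal (norm (caloric_ext \<alpha> f (t, x)))" using gt \<theta> by (simp add: ennreal_less_iff)
        also have "\<dots> \<le> S l x" unfolding S_def using caloric_ext_le[OF t] le[OF f fin t l] by (rule order_trans)
        \<comment> \<open>The cube found has level at least \<open>l\<close>, hence side at least t,
          so its box reaches up to (t, x).\<close>
        finally obtain p where p: "(l + int p, corner (l + int p) x) \<in> J \<theta>" using exists_layer[OF \<theta>] by blast
        have le2: "(2::real) powr of_int l \<le> 2 powr of_int (l + int p)" by (intro powr_mono) auto
        have "(t, x) \<in> dyadic_box (l + int p) (corner (l + int p) x)"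
          using order_trans[OF l(1) le2] t by (simp add: dyadic_box_def mem_half_space)
        then show "(t, x) \<in> (\<Union>(l, a)\<in>J \<theta>. dyadic_box l a)" using p by blast
      qed
      \<comment> \<open>Continuity from below concerns \<mu> itself, so the power 1/q is moved to
        the other side before passing from finite subfamilies to the whole layer.\<close>
      have "emeasure \<mu> (\<Union>i\<in>J \<theta>. dyadic_box (fst i) (snd i)) \<le> enn_powr (ennreal M * N \<theta>) (1 / (1 / exponent))"
      proof (rule emeasure_countable_UN_le[OF countable_J])
        show "dyadic_box (fst i) (snd i) \<in> sets \<mu>" for i by (rule dyadic_box_sets[OF radon])
        fix F assume F: "finite F" "F \<subseteq> J \<theta>"
        have FS: "F \<subseteq> (SIGMA l:UNIV. range (corner l))" using F by (auto simp: J_def)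
        have "enn_powr (emeasure \<mu> (\<Union>(l, a)\<in>F. dyadic_box l a)) (1 / exponent) \<le> ennreal M * (\<Sum>(l, a)\<in>F. ?w l)"
          by (rule M(2)[OF F(1) FS])
        also have "(\<Sum>(l, a)\<in>F. ?w l) = (\<Sum>(l, a)\<in>F. ?w l * (if (l, a) \<in> J \<theta> then 1 else 0))"
          using F(2) by (intro sum.cong) auto
        also have "\<dots> \<le> N \<theta>" unfolding N_def by (rule sum_le_nn_integral_count_space_Sigma[OF F(1) FS])
        finally have "enn_powr (emeasure \<mu> (\<Union>(l, a)\<in>F. dyadic_box l a)) (1 / exponent) \<le> ennreal M * N \<theta>"
          by (simp add: mult_left_mono)
        then show "emeasure \<mu> (\<Union>i\<in>F. dyadic_box (fst i) (snd i)) \<le> enn_powr (ennreal M * N \<theta>) (1 / (1 / exponent))"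
          using exponent by (subst enn_powr_le_iff[symmetric]) (auto simp: split_beta')
      qed
      moreover have "distr_fn \<mu> (caloric_ext \<alpha> f) \<theta> \<le> emeasure \<mu> (\<Union>i\<in>J \<theta>. dyadic_box (fst i) (snd i))"
        unfolding distr_fn_def
      proof (rule emeasure_mono)
        show "{z \<in> space \<mu>. norm (caloric_ext \<alpha> f z) > \<theta>} \<subseteq> (\<Union>i\<in>J \<theta>. dyadic_box (fst i) (snd i))"
          using sub by (simp add: split_beta')
        show "(\<Union>i\<in>J \<theta>. dyadic_box (fst i) (snd i)) \<in> sets \<mu>"
          by (rule sets.countable_UN'[OF countable_J]) (auto intro: dyadic_box_sets[OF radon])
      qed
      ultimately show ?thesis using exponent by (subst enn_powr_le_iff) auto
    qed
    have "Lq1_norm exponent \<mu> (caloric_ext \<alpha> f) \<le> (\<integral>\<^sup>+\<theta>. ennreal M * (indicator {0<..} \<theta> * N \<theta>) \<partial>lborel)"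
      unfolding Lq1_norm_def
    proof (rule nn_integral_mono)
      fix \<theta> :: real
      show "enn_powr (distr_fn \<mu> (caloric_ext \<alpha> f) \<theta>) (1 / exponent) * indicator {0<..} \<theta> \<le> ennreal M * (indicator {0<..} \<theta> * N \<theta>)"
        using layer[of \<theta>] by (auto simp: indicator_def)
    qed
    also have "\<dots> = ennreal M * (\<integral>\<^sup>+\<theta>. indicator {0<..} \<theta> * N \<theta> \<partial>lborel)"
      by (rule nn_integral_cmult) measurable
    also have "\<dots> \<le> ennreal M * (ennreal K * W_norm \<beta> f)"
      unfolding N_def by (intro mult_left_mono order_trans[OF nn_integral_layers tot] f fin) auto
    also have "\<dots> = ennreal (M * K) * W_norm \<beta> f" using M K by (simp add: ennreal_mult mult.assoc)
    finally show ?thesis .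
  qed
  then show ?thesis using MK by blast
qed

end

lemma decaying_heat_kernel:
  assumes "0 < \<alpha>" "\<alpha> \<le> 1"
  shows "\<exists>(q :: 'a::euclidean_space \<Rightarrow> real) C. decaying_kernel q C \<and>
    (\<integral>\<^sup>+x. indicator (ball 0 1) x * ennreal (q x) \<partial>lborel) > 0 \<and>
    (\<forall>s x. s > 0 \<longrightarrow> heat_kernel \<alpha> (s powr (2 * \<alpha>)) x = complex_of_real (q ((1 / s) *\<^sub>R x) / s ^ DIM('a)))"
proof (rule heat_kernel_profile[OF assms, where 'a = 'a])
  fix k :: "'a \<Rightarrow> real" and C
  assume "k \<in> borel_measurable borel" "\<And>x. k x \<ge> 0" "C > 0" "\<And>x. k x \<le> C" "\<And>x. norm x ^ DIM('a) * k x \<le> C"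
    "(\<integral>\<^sup>+x. ennreal (k x) \<partial>lborel) \<le> ennreal C"
    and "(\<integral>\<^sup>+x. indicator (ball 0 1) x * ennreal (k x) \<partial>lborel) > 0"
    and "\<And>s x. s > 0 \<Longrightarrow> heat_kernel \<alpha> (s powr (2 * \<alpha>)) x = of_real (k ((1 / s) *\<^sub>R x) / s ^ DIM('a))"
  then show ?thesis by (intro exI[of _ k] exI[of _ C] conjI decaying_kernel.intro allI impI)
qed

theorem theorem1p7:
  fixes \<mu> :: "(real \<times> (real ^ 'n)) measure"
    and \<alpha> \<beta> q p :: real
  assumes "0 < \<alpha>" "\<alpha> \<le> 1"
    and "0 < \<beta>" "\<beta> < real CARD('n)" "\<beta> \<notin> \<nat>"
    and "0 < q" "q < p" "p = 1"
    and "radon_half_space \<mu>"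
  defines "a \<equiv> (\<exists>C::real. C > 0 \<and> (\<forall>v0 \<in> W_space \<beta>.
             Lq_norm q \<mu> (caloric_ext \<alpha> v0) \<le> ennreal C * W_norm \<beta> v0))"
    and "b \<equiv> (\<exists>C::real. C > 0 \<and> (\<forall>v0 \<in> W_space \<beta>.
             Lqinf_norm q \<mu> (caloric_ext \<alpha> v0) \<le> ennreal C * W_norm \<beta> v0))"
    and "c \<equiv> (SUP U \<in> {U :: (real ^ 'n) set. open U}.
             enn_powr (emeasure \<mu> (tent U)) (1 / q) / W_cap \<beta> U) < \<infinity>"
    and "d \<equiv> (\<exists>C::real. C > 0 \<and> (\<forall>v0 \<in> W_space \<beta>.
             Lq1_norm q \<mu> (caloric_ext \<alpha> v0) \<le> ennreal C * W_norm \<beta> v0))"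
  shows "(a \<longrightarrow> b) \<and> (b \<longrightarrow> c) \<and> (c \<longrightarrow> d)"
proof -
  from decaying_heat_kernel[OF \<open>0 < \<alpha>\<close> \<open>\<alpha> \<le> 1\<close>] obtain k :: "real ^ 'n \<Rightarrow> real" and C where
    "decaying_kernel k C" and mass: "(\<integral>\<^sup>+x. indicator (ball 0 1) x * ennreal (k x) \<partial>lborel) > 0"
    and kernel: "\<forall>s x. s > 0 \<longrightarrow> heat_kernel \<alpha> (s powr (2 * \<alpha>)) x = complex_of_real (k ((1 / s) *\<^sub>R x) / s ^ DIM(real ^ 'n))"
    by (elim exE conjE)
  interpret decaying_kernel k C by fact
  \<comment> \<open>The profile \<open>k\<close> takes the place of the kernel \<open>q\<close> of
    the locale, and the \<open>q\<close> of the theorem that of \<open>exponent\<close>.\<close>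
  interpret caloric k C \<alpha> \<beta> q \<mu>
    by standard (use assms mass kernel in \<open>auto simp: dil_def\<close>)
  have "a \<longrightarrow> b"
    unfolding a_def b_def using Lqinf_norm_le_Lq_norm[OF \<open>0 < q\<close>] by (meson order_trans)
  moreover have "b \<longrightarrow> c"
    unfolding b_def c_def using tent_capacity_of_weak_type by blast
  moreover have "c \<longrightarrow> d"
    unfolding c_def d_def using strong_type_of_tent_capacity by blast
  ultimately show ?thesis by blast
qed

end
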